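(* Let $d\geq 1$, let $\mu$ be a probability measure on $\mathrm{GL}_d(\mathbb{C})$ with finite first moment, i.e. $\int \log N(g)\, d\mu(g)<\infty$, and let $(X_n)_{n\geq 1}$ be a sequence of independent random variables with distribution $\mu$. For every $n\geq 1$, let $L_n=X_n\cdots X_1$. Then $\frac1n\log\rho(L_n)$ converges to $\lambda_1(\mu)$ in $L^1$, i.e. $$\mathbb{E}\left(\left|\frac1n\log\rho(L_n)-\lambda_1(\mu)\right|\right)\underset{n\to+\infty}{\longrightarrow}0.$$ In particular, $\frac1n\log\rho(L_n)$ converges to $\lambda_1(\mu)$ in probability.
   Context: For $g\in \mathrm{GL}_d(\mathbb{C})$: $\rho(g)$ denotes the spectral radius of $g$ (largest modulus of an eigenvalue), and $N(g)=\max\{\|g\|,\|g^{-1}\|\}$, where $\|\cdot\|$ is an operator norm (the moment condition does not depend on the choice of operator norm). For a probability measure $\mu$ on $\mathrm{GL}_d(\mathbb{C})$ with finite first moment, the first Lyapunov exponent $\lambda_1(\mu)\in\mathbb{R}$ is the constant defined by the almost sure convergence (Furstenberg--Kesten) $\frac1n\log\|X_n\cdots X_1\|\to\lambda_1(\mu)$, where the $X_i$ are i.i.d. with distribution $\mu$. *)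

theory Defs
  imports "HOL-Probability.Probability"
begin

definition GL :: "(complex^'n^'n) set"
  where "GL = {g. invertible g}"

definition GL_borel :: "(complex^'n^'n) measure"
  where "GL_borel = restrict_space borel GL"

text \<open>The operator norm induced by the Hermitian norm on $\mathbb{C}^n$.\<close>

definition op_norm :: "complex^'n^'n \<Rightarrow> real"
  where "op_norm g = onorm (\<lambda>v. g *v v)"

definition N :: "complex^'n^'n \<Rightarrow> real"
  where "N g = max (op_norm g) (op_norm (matrix_inv g))"

definition eigenvalue :: "complex^'n^'n \<Rightarrow> complex \<Rightarrow> bool"
  where "eigenvalue g c \<longleftrightarrow> (\<exists>v. v \<noteq> 0 \<and> g *v v = c *s v)"

text \<open>The set of eigenvalues is finite and, over the complex numbers, nonempty, so that
  the maximum is attained.\<close>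

definition spectral_radius :: "complex^'n^'n \<Rightarrow> real"
  where "spectral_radius g = Max {cmod c | c. eigenvalue g c}"

text \<open>Products on the left, \<open>x n ** \<dots> ** x 1\<close>; the entry \<open>x 0\<close> is not used.\<close>

primrec left_prod :: "(nat \<Rightarrow> complex^'n^'n) \<Rightarrow> nat \<Rightarrow> complex^'n^'n"
  where
    "left_prod x 0 = mat 1"
  | "left_prod x (Suc n) = x (Suc n) ** left_prod x n"

definition finite_first_moment :: "(complex^'n^'n) measure \<Rightarrow> bool"
  where "finite_first_moment \<mu> \<longleftrightarrow> integrable \<mu> (\<lambda>g. ln (N g))"

text \<open>The almost sure limit of $\frac1n \log \|X_n \cdots X_1\|$ for the canonical i.i.d.
  sequence with law \<open>\<mu>\<close>, namely the coordinates of the product space. For a probability measure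
  on \<open>GL\<close> with finite first moment, the Furstenberg--Kesten theorem gives its existence;
  otherwise the value is not meaningful.\<close>

definition lyapunov1 :: "(complex^'n^'n) measure \<Rightarrow> real"
  where "lyapunov1 \<mu> =
    (THE l. AE x in (\<Pi>\<^sub>M i\<in>{1..}. \<mu>).
       (\<lambda>n. 1 / real n * ln (op_norm (left_prod x n))) \<longlonglongrightarrow> l)"

end

theory Submission
  imports "Jordan_Normal_Form.Schur_Decomposition" "HOL-Real_Asymp.Real_Asymp" Defs
begin

text \<open>
  Since \<open>\<rho>(L\<^sub>n) \<le> \<parallel>L\<^sub>n\<parallel>\<close>, only a lower bound in probability is needed; uniform integrability comes from
  the law of large numbers for \<open>ln N\<close>. Split \<open>L\<^sub>n = A B\<close> into two halves. If \<open>A\<close> and \<open>B\<close> had rank one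
  then \<open>\<rho>(A B) = \<parallel>A B\<parallel> \<parallel>B A\<parallel> / (\<parallel>A\<parallel> \<parallel>B\<parallel>)\<close>, and \<open>B A\<close> has the same law as \<open>A B\<close>, so all four norms
  have the right exponential size. In general let \<open>p\<close> be the multiplicity of the top Lyapunov exponent
  and use the \<open>p\<close>-th compound matrices, which have rank one up to an error bounded by the
  \<open>(p+1)\<close>-minors; the latter are exponentially smaller because of the gap behind \<open>\<lambda>\<^sub>p\<close>, and the trace of
  the compound of \<open>A B\<close> is bounded by \<open>\<rho>(A B)\<^sup>p\<close>. The growth rates of the minors, and the
  Furstenberg--Kesten theorem, come from Kingman's theorem for the shift.
\<close>

text \<open>\<open>B ** A\<close> is not a product along the same sequence; it only shares the law
  of \<open>A ** B\<close>. Hence the method yields convergence in probability and in mean but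
  nothing almost sure. Compounds are needed because for a repeated top exponent the factors are not
  close to rank one on the exponential scale. The two largest singular values of a
  \<open>p\<close>-th compound have a product of at most the \<open>(p-1)\<close>-st power of the
  norm times the size of the \<open>(p+1)\<close>-minors. Its rate is
  \<open>(p-1) \<lambda> + (p+1) \<lambda> - \<gamma>\<close>, which falls short of the squared
  largest one, of rate \<open>2 p \<lambda>\<close>, by \<open>\<gamma>\<close>. The halves must
  have comparable lengths, since this gain is exponential in the length of one half while the
  fluctuations are paid over the whole length. Invertibility and the moment of \<open>N\<close>
  bound two logarithms from below: that of the minors, for Kingman's theorem, and that of the
  spectral radius, for integrability.\<close>

no_notation Matrix.vec_index (infixl "$" 100)
hide_const (open) Matrix.mat

section \<open>Minors indexed by tuples\<close>

text \<open>Minors are indexed by arbitrary tuples of rows and columns, not by subsets, so that no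
  order on the index type is needed. Each genuine minor then occurs several times up to sign,
  whence the factorials below.\<close>

definition minor :: "nat \<Rightarrow> ('i \<Rightarrow> 'j \<Rightarrow> complex) \<Rightarrow> (nat \<Rightarrow> 'i) \<Rightarrow> (nat \<Rightarrow> 'j) \<Rightarrow> complex"
  where "minor p a I J =
    (\<Sum>\<sigma> | \<sigma> permutes {..<p}. of_int (sign \<sigma>) * (\<Prod>k<p. a (I k) (J (\<sigma> k))))"

lemma minor_cong:
  assumes "\<And>k l. k < p \<Longrightarrow> l < p \<Longrightarrow> a (I k) (J l) = a' (I' k) (J' l)"
  shows "minor p a I J = minor p a' I' J'"
  unfolding minor_def
proof (intro sum.cong refl arg_cong2[where f="(*)"] prod.cong)
  fix \<sigma> k assume "\<sigma> \<in> {\<sigma>. \<sigma> permutes {..<p}}" "k \<in> {..<p}"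
  then have "\<sigma> k < p" using permutes_in_image[of \<sigma> "{..<p}" k] by auto
  then show "a (I k) (J (\<sigma> k)) = a' (I' k) (J' (\<sigma> k))"
    using assms \<open>k \<in> {..<p}\<close> by auto
qed

lemma finite_perms: "finite {\<sigma>. \<sigma> permutes {..<p::nat}}"
  by (rule finite_permutations) simp

lemma sign_compose_perms:
  assumes "\<sigma> permutes {..<p::nat}" "\<tau> permutes {..<p}"
  shows "sign (\<sigma> \<circ> \<tau>) = sign \<sigma> * sign \<tau>"
  using assms by (intro sign_compose permutation_permutes[THEN iffD2]) auto

lemma minor_permute_rows:
  assumes \<tau>: "\<tau> permutes {..<p}"
  shows "minor p a (I \<circ> \<tau>) J = of_int (sign \<tau>) * minor p a I J"
proof -
  have "minor p a I J = (\<Sum>\<sigma> | \<sigma> permutes {..<p}. of_int (sign \<sigma>) * (\<Prod>k<p. a ((I \<circ> \<tau>) k) (J ((\<sigma> \<circ> \<tau>) k))))"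
    unfolding minor_def
  proof (intro sum.cong refl arg_cong2[where f="(*)"])
    fix \<sigma>
    show "(\<Prod>k<p. a (I k) (J (\<sigma> k))) = (\<Prod>k<p. a ((I \<circ> \<tau>) k) (J ((\<sigma> \<circ> \<tau>) k)))"
      using prod.reindex_bij_betw[OF permutes_imp_bij[OF \<tau>], of "\<lambda>k. a (I k) (J (\<sigma> k))"] by simp
  qed
  also have "\<dots> = (\<Sum>\<sigma> | \<sigma> permutes {..<p}. of_int (sign \<tau>) * (of_int (sign (\<sigma> \<circ> \<tau>)) * (\<Prod>k<p. a ((I \<circ> \<tau>) k) (J ((\<sigma> \<circ> \<tau>) k)))))"
    using \<tau> by (intro sum.cong refl) (auto simp: sign_compose_perms algebra_simps simp flip: of_int_mult)
  also have "\<dots> = (\<Sum>\<sigma> | \<sigma> permutes {..<p}. of_int (sign \<tau>) * (of_int (sign \<sigma>) * (\<Prod>k<p. a ((I \<circ> \<tau>) k) (J (\<sigma> k)))))"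
    by (rule sum_permutations_compose_right[OF \<tau>, symmetric])
  also have "\<dots> = of_int (sign \<tau>) * minor p a (I \<circ> \<tau>) J"
    by (simp add: minor_def sum_distrib_left)
  finally show ?thesis by (simp add: sign_def)
qed

lemma minor_eq_0_if_rows_repeat:
  assumes "k < p" "l < p" "k \<noteq> l" "I k = I l"
  shows "minor p a I J = 0"
proof -
  let ?\<tau> = "Transposition.transpose k l"
  have \<tau>: "?\<tau> permutes {..<p}" using assms by (intro permutes_swap_id) auto
  have "I \<circ> ?\<tau> = I" using assms by (auto simp: fun_eq_iff Transposition.transpose_def)
  moreover have "sign ?\<tau> = -1" using assms by (simp add: sign_swap_id)
  ultimately show ?thesis using minor_permute_rows[OF \<tau>, of a I J] by simp
qed

text \<open>Extensional functions make the index set finite. A minor only sees the indices below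
  \<open>p\<close>, so any index function may be restricted to this set without changing it.\<close>

abbreviation tuples :: "nat \<Rightarrow> 'i set \<Rightarrow> (nat \<Rightarrow> 'i) set"
  where "tuples p S \<equiv> {..<p} \<rightarrow>\<^sub>E S"

text \<open>The multilinear half of Cauchy-Binet: the product of sums is expanded over all choices
  \<open>K\<close> of inner indices, and the factors of \<open>b\<close> reassemble into a minor.
  Only the entries of \<open>a\<close> are left unsymmetrized.\<close>

lemma minor_mult_expand:
  assumes S: "finite S" and c: "\<And>i j. c i j = (\<Sum>s\<in>S. a i s * b s j)"
  shows "minor p c I J = (\<Sum>K\<in>tuples p S. (\<Prod>k<p. a (I k) (K k)) * minor p b K J)"
proof -
  have "minor p c I J = (\<Sum>\<sigma> | \<sigma> permutes {..<p}. of_int (sign \<sigma>) * (\<Sum>K\<in>tuples p S. \<Prod>k<p. a (I k) (K k) * b (K k) (J (\<sigma> k))))"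
    unfolding minor_def c using S by (subst prod_sum_PiE) auto
  also have "\<dots> = (\<Sum>K\<in>tuples p S. \<Sum>\<sigma> | \<sigma> permutes {..<p}. of_int (sign \<sigma>) * (\<Prod>k<p. a (I k) (K k) * b (K k) (J (\<sigma> k))))"
    by (simp add: sum_distrib_left) (rule sum.swap)
  also have "\<dots> = (\<Sum>K\<in>tuples p S. (\<Prod>k<p. a (I k) (K k)) * minor p b K J)"
    unfolding minor_def by (simp add: prod.distrib sum_distrib_left mult_ac)
  finally show ?thesis .
qed

lemma tuples_compose:
  assumes \<tau>: "\<tau> permutes {..<p}"
  shows "bij_betw (\<lambda>K. K \<circ> \<tau>) (tuples p S) (tuples p S)"
proof (rule bij_betw_byWitness[where f'="\<lambda>K. K \<circ> Hilbert_Choice.inv \<tau>"])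
  have "K \<circ> \<pi> \<in> tuples p S" if "\<pi> permutes {..<p}" "K \<in> tuples p S" for K \<pi>
  proof (rule PiE_I)
    show "(K \<circ> \<pi>) k \<in> S" if "k \<in> {..<p}" for k
    proof -
      have "\<pi> k \<in> {..<p}" using permutes_in_image[OF \<open>\<pi> permutes _\<close>, of k] that by simp
      then show ?thesis using PiE_mem[OF \<open>K \<in> _\<close>] by simp
    qed
    show "(K \<circ> \<pi>) k = undefined" if "k \<notin> {..<p}" for k
      using permutes_not_in[OF \<open>\<pi> permutes _\<close> that] PiE_arb[OF \<open>K \<in> _\<close> that] by simp
  qed
  from this[OF \<tau>] this[OF permutes_inv[OF \<tau>]]
  show "(\<lambda>K. K \<circ> \<tau>) ` tuples p S \<subseteq> tuples p S" "(\<lambda>K. K \<circ> Hilbert_Choice.inv \<tau>) ` tuples p S \<subseteq> tuples p S"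
    by auto
qed (simp_all add: comp_assoc permutes_inv_o[OF \<tau>])

text \<open>Averaging \<open>minor_mult_expand\<close> over all reorderings of \<open>K\<close>
  antisymmetrizes the product of entries of \<open>a\<close> into a minor. As \<open>K\<close> runs
  over all tuples and not just the increasing ones, the sum is \<open>p!\<close> times the usual
  one.\<close>

lemma cauchy_binet:
  assumes S: "finite S" and c: "\<And>i j. c i j = (\<Sum>s\<in>S. a i s * b s j)"
  shows "of_nat (fact p) * minor p c I J = (\<Sum>K\<in>tuples p S. minor p a I K * minor p b K J)"
proof -
  have "of_nat (fact p) * minor p c I J = (\<Sum>\<tau> | \<tau> permutes {..<p}. minor p c I J)"
    using card_permutations[of "{..<p}" p] by simp
  also have "\<dots> = (\<Sum>\<tau> | \<tau> permutes {..<p}. \<Sum>K\<in>tuples p S. of_int (sign \<tau>) * (\<Prod>k<p. a (I k) (K (\<tau> k))) * minor p b K J)"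
  proof (intro sum.cong refl)
    fix \<tau> assume "\<tau> \<in> {\<tau>. \<tau> permutes {..<p}}"
    then have \<tau>: "\<tau> permutes {..<p}" by simp
    have "minor p c I J = (\<Sum>K\<in>tuples p S. (\<Prod>k<p. a (I k) ((K \<circ> \<tau>) k)) * minor p b (K \<circ> \<tau>) J)"
      unfolding minor_mult_expand[OF S c]
      by (rule sum.reindex_bij_betw[OF tuples_compose[OF \<tau>], symmetric])
    then show "minor p c I J = (\<Sum>K\<in>tuples p S. of_int (sign \<tau>) * (\<Prod>k<p. a (I k) (K (\<tau> k))) * minor p b K J)"
      by (simp add: minor_permute_rows[OF \<tau>] mult_ac)
  qed
  also have "\<dots> = (\<Sum>K\<in>tuples p S. \<Sum>\<tau> | \<tau> permutes {..<p}. of_int (sign \<tau>) * (\<Prod>k<p. a (I k) (K (\<tau> k))) * minor p b K J)"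
    by (rule sum.swap)
  also have "\<dots> = (\<Sum>K\<in>tuples p S. minor p a I K * minor p b K J)"
    by (simp add: minor_def sum_distrib_right)
  finally show ?thesis .
qed

text \<open>With only \<open>p\<close> inner indices, a tuple \<open>K\<close> with a repetition
  contributes zero and the others are permutations, which recombine without a factorial. Hence the
  compound of a matrix that factors through dimension \<open>p\<close> has rank at most one.\<close>

lemma minor_factor:
  assumes "\<And>i j. c i j = (\<Sum>s<p. a i s * b s j)"
  shows "minor p c I J = minor p a I id * minor p b id J"
proof -
  let ?f = "\<lambda>K. (\<Prod>k<p. a (I k) (K k)) * minor p b K J"
  let ?P = "{\<sigma>. \<sigma> permutes {..<p}}"
  have "minor p c I J = (\<Sum>K\<in>tuples p {..<p}. ?f K)"
    by (rule minor_mult_expand) (use assms in auto)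
  also have "\<dots> = (\<Sum>K\<in>(\<lambda>\<sigma>. restrict \<sigma> {..<p}) ` ?P. ?f K)"
  proof (rule sum.mono_neutral_right)
    show "(\<lambda>\<sigma>. restrict \<sigma> {..<p}) ` ?P \<subseteq> tuples p {..<p}"
    proof (rule image_subsetI)
      fix \<sigma> assume "\<sigma> \<in> ?P"
      then have "\<sigma> ` {..<p} \<subseteq> {..<p}" using permutes_image[of \<sigma> "{..<p}"] by simp
      then show "restrict \<sigma> {..<p} \<in> tuples p {..<p}" by (auto simp: restrict_PiE_iff)
    qed
    show "\<forall>K\<in>tuples p {..<p} - (\<lambda>\<sigma>. restrict \<sigma> {..<p}) ` ?P. ?f K = 0"
    proof
      fix K assume K: "K \<in> tuples p {..<p} - (\<lambda>\<sigma>. restrict \<sigma> {..<p}) ` ?P"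
      have "\<not> inj_on K {..<p}"
      proof
        assume inj: "inj_on K {..<p}"
        \<comment> \<open>Extended by the identity, an injective tuple with values below
          \<open>p\<close> is a permutation.\<close>
        define \<sigma> where "\<sigma> k = (if k < p then K k else k)" for k
        have "inj_on \<sigma> {..<p}" using inj by (auto simp: inj_on_def \<sigma>_def)
        moreover have "\<sigma> ` {..<p} \<subseteq> {..<p}" using K by (auto simp: \<sigma>_def)
        ultimately have "bij_betw \<sigma> {..<p} {..<p}"
          by (intro bij_betw_imageI endo_inj_surj) auto
        then have "\<sigma> permutes {..<p}" by (rule bij_imp_permutes) (auto simp: \<sigma>_def)
        moreover have "K = restrict \<sigma> {..<p}"
        proof
          fix k show "K k = restrict \<sigma> {..<p} k"
            using PiE_arb[of K "{..<p}" "\<lambda>_. {..<p}" k] K by (cases "k < p") (simp_all add: \<sigma>_def)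
        qed
        ultimately show False using K by auto
      qed
      then obtain k l where "k < p" "l < p" "k \<noteq> l" "K k = K l"
        unfolding inj_on_def by auto
      then show "?f K = 0" using minor_eq_0_if_rows_repeat[of k p l K b J] by simp
    qed
  qed (simp add: finite_PiE)
  also have "\<dots> = (\<Sum>\<sigma>\<in>?P. ?f (restrict \<sigma> {..<p}))"
  proof -
    have inj: "inj_on (\<lambda>\<sigma>. restrict \<sigma> {..<p}) ?P"
    proof (rule inj_onI)
      fix \<sigma> \<tau> assume st: "\<sigma> \<in> ?P" "\<tau> \<in> ?P" and eq: "restrict \<sigma> {..<p} = restrict \<tau> {..<p}"
      show "\<sigma> = \<tau>"
      proof
        fix k show "\<sigma> k = \<tau> k"
        proof (cases "k < p")
          case True
          then show ?thesis using fun_cong[OF eq, of k] by simp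
        next
          case False
          then have "\<sigma> k = k" "\<tau> k = k" using st by (auto intro: permutes_not_in)
          then show ?thesis by simp
        qed
      qed
    qed
    show ?thesis unfolding sum.reindex[OF inj] o_def ..
  qed
  also have "\<dots> = (\<Sum>\<sigma>\<in>?P. (\<Prod>k<p. a (I k) (id (\<sigma> k))) * (of_int (sign \<sigma>) * minor p b id J))"
  proof (intro sum.cong refl arg_cong2[where f="(*)"] prod.cong)
    fix \<sigma> assume "\<sigma> \<in> ?P"
    then have \<sigma>: "\<sigma> permutes {..<p}" by simp
    have "minor p b (restrict \<sigma> {..<p}) J = minor p b (id \<circ> \<sigma>) J" by (rule minor_cong) auto
    then show "minor p b (restrict \<sigma> {..<p}) J = of_int (sign \<sigma>) * minor p b id J"
      by (simp only: minor_permute_rows[OF \<sigma>])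
  qed auto
  also have "\<dots> = minor p a I id * minor p b id J"
    unfolding minor_def[of p a] sum_distrib_right by (simp add: mult_ac)
  finally show ?thesis .
qed

lemma permutes_lessThan_Suc_fixing:
  "{\<sigma>. \<sigma> permutes {..<Suc p} \<and> \<sigma> p = p} = {\<sigma>. \<sigma> permutes {..<p}}"
proof -
  have "\<sigma> permutes {..<p}" if s: "\<sigma> permutes {..<Suc p}" "\<sigma> p = p" for \<sigma>
  proof (rule permutes_superset[OF s(1)])
    show "\<sigma> x = x" if "x \<in> {..<Suc p} - {..<p}" for x
    proof -
      have "x = p" using that by auto
      then show ?thesis using s by simp
    qed
  qed
  moreover have "\<sigma> permutes {..<Suc p} \<and> \<sigma> p = p" if s: "\<sigma> permutes {..<p}" for \<sigma>
    using permutes_subset[OF s, of "{..<Suc p}"] permutes_not_in[OF s, of p] by simp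
  ultimately show ?thesis by blast
qed

text \<open>Laplace expansion along the last row; the column left out is replaced by the last one,
  which accounts for the sign.\<close>

lemma minor_Suc_expand:
  "minor (Suc p) a I J = a (I p) (J p) * minor p a I J
     - (\<Sum>m<p. a (I p) (J m) * minor p a I (J(m := J p)))"
proof -
  let ?P = "{\<sigma>. \<sigma> permutes {..<Suc p}}"
  let ?g = "\<lambda>J \<sigma>. of_int (sign \<sigma>) * (\<Prod>k<p. a (I k) (J (\<sigma> k)))"
  define E where "E J m = (\<Sum>\<sigma> | \<sigma> permutes {..<Suc p} \<and> \<sigma> p = m. ?g J \<sigma>)" for J m
  have Ep: "E J p = minor p a I J" for J
    unfolding E_def permutes_lessThan_Suc_fixing minor_def ..
  have Em: "E J m = - minor p a I (J(m := J p))" if m: "m < p" for m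
  proof -
    let ?\<tau> = "Transposition.transpose m p"
    have \<tau>: "?\<tau> permutes {..<Suc p}" using m by (intro permutes_swap_id) auto
    have "E J m = (\<Sum>\<sigma>\<in>?P. if \<sigma> p = m then ?g J \<sigma> else 0)"
      unfolding E_def by (subst sum.inter_filter[symmetric]) (auto intro: finite_permutations)
    \<comment> \<open>Composing with the transposition turns \<open>\<sigma> p = m\<close> into
      \<open>\<sigma> p = p\<close>, at the price of a sign and of exchanging the columns
      \<open>m\<close> and \<open>p\<close> of \<open>J\<close>.\<close>
    also have "\<dots> = (\<Sum>\<sigma>\<in>?P. if (?\<tau> \<circ> \<sigma>) p = m then ?g J (?\<tau> \<circ> \<sigma>) else 0)"
      by (rule setum_permutations_compose_left[OF \<tau>])
    also have "\<dots> = (\<Sum>\<sigma>\<in>?P. if \<sigma> p = p then - ?g (J \<circ> ?\<tau>) \<sigma> else 0)"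
    proof (intro sum.cong refl if_cong)
      fix \<sigma> assume "\<sigma> \<in> ?P"
      then have "sign (?\<tau> \<circ> \<sigma>) = - sign \<sigma>"
        using \<tau> m by (simp add: sign_compose_perms sign_swap_id)
      then show "?g J (?\<tau> \<circ> \<sigma>) = - ?g (J \<circ> ?\<tau>) \<sigma>" by simp
      show "((?\<tau> \<circ> \<sigma>) p = m) = (\<sigma> p = p)"
        using m by (auto simp: Transposition.transpose_def)
    qed
    also have "\<dots> = - (\<Sum>\<sigma>\<in>?P. if \<sigma> p = p then ?g (J \<circ> ?\<tau>) \<sigma> else 0)"
      by (subst sum_negf[symmetric]) (auto intro: sum.cong)
    also have "\<dots> = - E (J \<circ> ?\<tau>) p"
      unfolding E_def by (subst sum.inter_filter[symmetric]) (auto intro: finite_permutations)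
    also have "E (J \<circ> ?\<tau>) p = minor p a I (J(m := J p))"
      unfolding Ep by (rule minor_cong) (auto simp: Transposition.transpose_def)
    finally show ?thesis .
  qed
  have "minor (Suc p) a I J = (\<Sum>\<sigma>\<in>?P. a (I p) (J (\<sigma> p)) * ?g J \<sigma>)"
    unfolding minor_def by (intro sum.cong refl) (simp add: mult_ac)
  also have "\<dots> = (\<Sum>\<sigma>\<in>?P. \<Sum>m<Suc p. if \<sigma> p = m then a (I p) (J m) * ?g J \<sigma> else 0)"
  proof (intro sum.cong refl)
    fix \<sigma> assume "\<sigma> \<in> ?P"
    then have "\<sigma> p < Suc p" using permutes_in_image[of \<sigma> "{..<Suc p}" p] by auto
    then show "a (I p) (J (\<sigma> p)) * ?g J \<sigma> = (\<Sum>m<Suc p. if \<sigma> p = m then a (I p) (J m) * ?g J \<sigma> else 0)"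
      by (subst sum.delta') auto
  qed
  also have "\<dots> = (\<Sum>m<Suc p. \<Sum>\<sigma>\<in>?P. if \<sigma> p = m then a (I p) (J m) * ?g J \<sigma> else 0)"
    by (rule sum.swap)
  also have "\<dots> = (\<Sum>m<Suc p. a (I p) (J m) * E J m)"
    unfolding E_def sum_distrib_left
    by (subst sum.inter_filter[symmetric]) (auto intro: finite_permutations)
  also have "\<dots> = a (I p) (J p) * minor p a I J - (\<Sum>m<p. a (I p) (J m) * minor p a I (J(m := J p)))"
    by (simp add: Ep Em sum_negf)
  finally show ?thesis .
qed

section \<open>Norms of compound matrices\<close>

lemma bounded_linear_matrix_vector_mul: "bounded_linear (\<lambda>v :: complex^'n. A *v v)"
  by (rule linear_conv_bounded_linear[THEN iffD1])
     (auto intro!: linearI simp: matrix_vector_right_distrib vec_eq_iff matrix_vector_mult_def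
       scaleR_sum_right distrib_left sum.distrib)

lemma norm_matrix_vector_mul_le: "norm (A *v v) \<le> op_norm A * norm (v :: complex^'n)"
  unfolding op_norm_def by (rule onorm[OF bounded_linear_matrix_vector_mul])

lemma op_norm_nonneg: "op_norm A \<ge> 0"
  unfolding op_norm_def by (rule onorm_pos_le[OF bounded_linear_matrix_vector_mul])

lemma op_norm_mult: "op_norm (A ** B) \<le> op_norm A * op_norm B"
  using onorm_compose[OF bounded_linear_matrix_vector_mul[of A] bounded_linear_matrix_vector_mul[of B]]
  by (simp add: op_norm_def o_def matrix_vector_mul_assoc)

lemma op_norm_mat_1: "op_norm (mat 1 :: complex^'n^'n) = 1"
proof -
  have "(\<lambda>v :: complex^'n. mat 1 *v v) = (\<lambda>v. v)" by (simp add: fun_eq_iff)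
  then show ?thesis
    unfolding op_norm_def by (simp only: onorm_id)
qed

lemma norm_axis_one: "norm (axis j (1::complex) :: complex^'n) = 1"
proof -
  have "(norm (axis j (1::complex) $ i))\<^sup>2 = (if i = j then 1 else 0)" for i :: 'n
    by (simp add: axis_def)
  then show ?thesis by (simp add: norm_vec_def L2_set_def)
qed

lemma entry_le_op_norm: "cmod (A $ i $ j) \<le> op_norm (A :: complex^'n^'n)"
proof -
  have "(A *v axis j 1) $ i = A $ i $ j"
    by (simp add: matrix_vector_mult_def axis_def if_distrib cong: if_cong)
  then have "cmod (A $ i $ j) \<le> norm (A *v axis j 1)"
    using Finite_Cartesian_Product.norm_nth_le[of "A *v axis j 1" i] by simp
  also have "\<dots> \<le> op_norm A"
    using norm_matrix_vector_mul_le[of A "axis j 1"] by (simp add: norm_axis_one)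
  finally show ?thesis .
qed

lemma op_norm_le_sum: "op_norm (A :: complex^'n^'n) \<le> (\<Sum>i\<in>UNIV. \<Sum>j\<in>UNIV. cmod (A $ i $ j))"
  unfolding op_norm_def
proof (rule onorm_bound)
  show "0 \<le> (\<Sum>i\<in>UNIV. \<Sum>j\<in>UNIV. cmod (A $ i $ j))" by (intro sum_nonneg) auto
  fix v :: "complex^'n"
  have "norm (A *v v) \<le> (\<Sum>i\<in>UNIV. norm ((A *v v) $ i))"
    unfolding norm_vec_def by (intro L2_set_le_sum) auto
  also have "\<dots> \<le> (\<Sum>i\<in>UNIV. \<Sum>j\<in>UNIV. cmod (A $ i $ j) * norm v)"
  proof (rule sum_mono)
    fix i
    have "norm ((A *v v) $ i) \<le> (\<Sum>j\<in>UNIV. norm (A $ i $ j * v $ j))"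
      unfolding matrix_vector_mult_def by (simp add: norm_sum)
    also have "\<dots> \<le> (\<Sum>j\<in>UNIV. cmod (A $ i $ j) * norm v)"
      by (intro sum_mono) (auto simp: norm_mult intro!: mult_left_mono Finite_Cartesian_Product.norm_nth_le)
    finally show "norm ((A *v v) $ i) \<le> (\<Sum>j\<in>UNIV. cmod (A $ i $ j) * norm v)" .
  qed
  finally show "norm (A *v v) \<le> (\<Sum>i\<in>UNIV. \<Sum>j\<in>UNIV. cmod (A $ i $ j)) * norm v"
    by (simp add: sum_distrib_right)
qed

section \<open>Size and submultiplicativity of compounds\<close>

abbreviation mminor :: "nat \<Rightarrow> complex^'n^'n \<Rightarrow> (nat \<Rightarrow> 'n) \<Rightarrow> (nat \<Rightarrow> 'n) \<Rightarrow> complex"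
  where "mminor p A \<equiv> minor p (\<lambda>i j. A $ i $ j)"

text \<open>The entrywise sum norm of the compound. Dividing by \<open>p!\<close> absorbs the
  factorial of \<open>cauchy_binet\<close>, so that the norm is submultiplicative with constant one
  and its logarithm is subadditive along products.\<close>

definition minor_norm :: "nat \<Rightarrow> complex^'n^'n \<Rightarrow> real"
  where "minor_norm p A =
    (\<Sum>I\<in>tuples p UNIV. \<Sum>J\<in>tuples p UNIV. cmod (mminor p A I J)) / fact p"

lemma finite_tuples [simp]: "finite (tuples p (UNIV :: 'n::finite set))"
  by (simp add: finite_PiE)

lemma card_tuples [simp]: "card (tuples p (UNIV :: 'n::finite set)) = CARD('n) ^ p"
  by (simp add: card_PiE)

lemma minor_norm_nonneg: "minor_norm p A \<ge> 0"
  unfolding minor_norm_def by (intro divide_nonneg_nonneg sum_nonneg) auto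

lemma mminor_le_minor_norm: "cmod (mminor p A I J) \<le> fact p * minor_norm p A"
proof -
  let ?I = "restrict I {..<p}" and ?J = "restrict J {..<p}"
  have mem: "?I \<in> tuples p UNIV" "?J \<in> tuples p UNIV" by auto
  have "mminor p A I J = mminor p A ?I ?J" by (rule minor_cong) auto
  then have "cmod (mminor p A I J) = cmod (mminor p A ?I ?J)" by (rule arg_cong)
  moreover have "cmod (mminor p A ?I ?J) \<le> (\<Sum>J\<in>tuples p UNIV. cmod (mminor p A ?I J))"
    by (rule member_le_sum[OF mem(2), where f="\<lambda>J. cmod (mminor p A ?I J)"]) simp_all
  moreover have "\<dots> \<le> (\<Sum>I\<in>tuples p UNIV. \<Sum>J\<in>tuples p UNIV. cmod (mminor p A I J))"
    by (rule member_le_sum[OF mem(1), where f="\<lambda>I. \<Sum>J\<in>tuples p UNIV. cmod (mminor p A I J)"])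
       (simp_all add: sum_nonneg)
  ultimately have "cmod (mminor p A I J) \<le> (\<Sum>I\<in>tuples p UNIV. \<Sum>J\<in>tuples p UNIV. cmod (mminor p A I J))"
    by linarith
  then show ?thesis by (simp add: minor_norm_def)
qed

lemma cauchy_binet_matrix:
  "of_nat (fact p) * mminor p (A ** B) I J = (\<Sum>K\<in>tuples p UNIV. mminor p A I K * mminor p B K J)"
  by (rule cauchy_binet) (auto simp: matrix_matrix_mult_def)

lemma minor_norm_mult: "minor_norm p (A ** B) \<le> minor_norm p A * minor_norm p B"
proof -
  let ?t = "tuples p UNIV :: (nat \<Rightarrow> 'a) set"
  let ?a = "\<lambda>I K. cmod (mminor p A I K)" and ?b = "\<lambda>I K. cmod (mminor p B I K)"
  have "fact p * cmod (mminor p (A ** B) I J) \<le> (\<Sum>K\<in>?t. ?a I K * ?b K J)" for I J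
  proof -
    have "fact p * cmod (mminor p (A ** B) I J) = cmod (of_nat (fact p) * mminor p (A ** B) I J)"
      by (simp add: norm_mult)
    also have "\<dots> \<le> (\<Sum>K\<in>?t. cmod (mminor p A I K * mminor p B K J))"
      unfolding cauchy_binet_matrix by (rule norm_sum)
    finally show ?thesis by (simp add: norm_mult)
  qed
  then have "(\<Sum>I\<in>?t. \<Sum>J\<in>?t. fact p * cmod (mminor p (A ** B) I J)) \<le> (\<Sum>I\<in>?t. \<Sum>J\<in>?t. \<Sum>K\<in>?t. ?a I K * ?b K J)"
    by (intro sum_mono) auto
  also have "\<dots> = (\<Sum>I\<in>?t. \<Sum>K\<in>?t. \<Sum>J\<in>?t. ?a I K * ?b K J)"
    by (intro sum.cong refl sum.swap)
  also have "\<dots> = (\<Sum>I\<in>?t. \<Sum>K\<in>?t. ?a I K * (\<Sum>J\<in>?t. ?b K J))"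
    by (simp add: sum_distrib_left)
  also have "\<dots> \<le> (\<Sum>I\<in>?t. \<Sum>K\<in>?t. ?a I K * (\<Sum>K\<in>?t. \<Sum>J\<in>?t. ?b K J))"
    by (intro sum_mono mult_left_mono member_le_sum[where f="\<lambda>K. \<Sum>J\<in>?t. ?b K J"])
       (simp_all add: sum_nonneg)
  also have "\<dots> = (\<Sum>I\<in>?t. \<Sum>K\<in>?t. ?a I K) * (\<Sum>K\<in>?t. \<Sum>J\<in>?t. ?b K J)"
    by (simp add: sum_distrib_right)
  finally have "fact p * (\<Sum>I\<in>?t. \<Sum>J\<in>?t. cmod (mminor p (A ** B) I J))
      \<le> (\<Sum>I\<in>?t. \<Sum>K\<in>?t. ?a I K) * (\<Sum>K\<in>?t. \<Sum>J\<in>?t. ?b K J)"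
    by (simp add: sum_distrib_left)
  then show ?thesis by (simp add: minor_norm_def field_simps)
qed

lemma norm_minor_le:
  assumes "\<And>i j. cmod (a i j) \<le> c"
  shows "cmod (minor p a I J) \<le> fact p * c ^ p"
proof -
  have "cmod (minor p a I J) \<le> (\<Sum>\<sigma> | \<sigma> permutes {..<p}. cmod (of_int (sign \<sigma>) * (\<Prod>k<p. a (I k) (J (\<sigma> k)))))"
    unfolding minor_def by (rule norm_sum)
  also have "\<dots> \<le> (\<Sum>\<sigma> | \<sigma> permutes {..<p}. c ^ p)"
  proof (rule sum_mono)
    fix \<sigma> :: "nat \<Rightarrow> nat"
    have "cmod (of_int (sign \<sigma>)) = 1" by (simp add: sign_def)
    moreover have "(\<Prod>k<p. cmod (a (I k) (J (\<sigma> k)))) \<le> (\<Prod>k<p. c)"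
      by (intro prod_mono) (use assms in auto)
    ultimately show "cmod (of_int (sign \<sigma>) * (\<Prod>k<p. a (I k) (J (\<sigma> k)))) \<le> c ^ p"
      by (simp add: norm_mult prod_norm)
  qed
  also have "\<dots> = fact p * c ^ p" using card_permutations[of "{..<p}" p] by simp
  finally show ?thesis .
qed

lemma minor_norm_le_op_norm:
  "minor_norm p (A :: complex^'n^'n) \<le> real (CARD('n) ^ p * CARD('n) ^ p) * op_norm A ^ p"
proof -
  have "(\<Sum>I\<in>tuples p UNIV. \<Sum>J\<in>tuples p UNIV. cmod (mminor p A I J))
      \<le> (\<Sum>I\<in>(tuples p UNIV :: (nat \<Rightarrow> 'n) set). \<Sum>J\<in>(tuples p UNIV :: (nat \<Rightarrow> 'n) set). fact p * op_norm A ^ p)"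
    by (intro sum_mono norm_minor_le entry_le_op_norm)
  then show ?thesis by (simp add: minor_norm_def field_simps)
qed

text \<open>The 1-minors are the entries. Together with \<open>minor_norm_le_op_norm\<close> at
  \<open>p = 1\<close> this makes the growth rates of the two norms agree.\<close>

lemma op_norm_le_minor_norm_1:
  "op_norm (A :: complex^'n^'n) \<le> real (CARD('n) * CARD('n)) * minor_norm 1 A"
proof -
  have "cmod (A $ i $ j) \<le> minor_norm 1 A" for i j
  proof -
    have "{\<sigma>. \<sigma> permutes {..<1::nat}} = {id}" by (auto simp: lessThan_Suc)
    then have "mminor 1 A (\<lambda>_. i) (\<lambda>_. j) = A $ i $ j" unfolding minor_def by simp
    then show ?thesis using mminor_le_minor_norm[of 1 A "\<lambda>_. i" "\<lambda>_. j"] by simp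
  qed
  then have "(\<Sum>i\<in>UNIV. \<Sum>j\<in>UNIV. cmod (A $ i $ j)) \<le> (\<Sum>i\<in>(UNIV::'n set). \<Sum>j\<in>(UNIV::'n set). minor_norm 1 A)"
    by (intro sum_mono)
  then show ?thesis using op_norm_le_sum[of A] by simp
qed

text \<open>It suffices that the norm is nonzero, which the principal minor on \<open>p\<close>
  distinct indices shows; submultiplicativity applied to \<open>mat 1 ** mat 1\<close> then forces
  at least one.\<close>

lemma minor_norm_mat_1:
  assumes p: "p \<le> CARD('n)"
  shows "minor_norm p (mat 1 :: complex^'n^'n) \<ge> 1"
proof -
  let ?E = "mat 1 :: complex^'n^'n"
  obtain f :: "nat \<Rightarrow> 'n" where f: "bij_betw f {..<CARD('n)} UNIV"
    using ex_bij_betw_nat_finite[of "UNIV :: 'n set"] by (auto simp: atLeast0LessThan)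
  have inj: "f k = f l \<longleftrightarrow> k = l" if "k < p" "l < p" for k l
    using f that p by (auto simp: bij_betw_def inj_on_def)
  have "mminor p ?E f f = (\<Sum>\<sigma>\<in>{id}. of_int (sign \<sigma>) * (\<Prod>k<p. ?E $ f k $ f (\<sigma> k)))"
    unfolding minor_def
  proof (rule sum.mono_neutral_right)
    show "\<forall>\<sigma>\<in>{\<sigma>. \<sigma> permutes {..<p}} - {id}. of_int (sign \<sigma>) * (\<Prod>k<p. ?E $ f k $ f (\<sigma> k)) = 0"
    proof
      fix \<sigma> assume s: "\<sigma> \<in> {\<sigma>. \<sigma> permutes {..<p}} - {id}"
      then have \<sigma>: "\<sigma> permutes {..<p}" and "\<sigma> \<noteq> id" by auto
      then obtain k where k: "\<sigma> k \<noteq> k" by (auto simp: fun_eq_iff)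
      then have "k < p" using permutes_not_in[OF \<sigma>, of k] by auto
      moreover have "\<sigma> k < p" using permutes_in_image[OF \<sigma>, of k] \<open>k < p\<close> by auto
      ultimately have "?E $ f k $ f (\<sigma> k) = 0" using k inj[of k "\<sigma> k"] by (simp add: mat_def)
      then have "(\<Prod>k<p. ?E $ f k $ f (\<sigma> k)) = 0" using \<open>k < p\<close> by (intro prod_zero) auto
      then show "of_int (sign \<sigma>) * (\<Prod>k<p. ?E $ f k $ f (\<sigma> k)) = 0" by simp
    qed
  qed (auto simp: finite_perms permutes_id)
  then have "mminor p ?E f f = 1" by (simp add: mat_def)
  then have "minor_norm p ?E \<noteq> 0"
    using mminor_le_minor_norm[of p ?E f f] by auto
  then have "minor_norm p ?E > 0" using minor_norm_nonneg[of p ?E] by simp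
  moreover have "minor_norm p ?E \<le> minor_norm p ?E * minor_norm p ?E"
    using minor_norm_mult[of p ?E ?E] by simp
  ultimately show ?thesis by simp
qed

text \<open>By pigeonhole a row repeats. This settles a top exponent of full multiplicity, where
  there is no next exponent to provide a gap.\<close>

lemma minor_norm_eq_0:
  assumes p: "p > CARD('n)"
  shows "minor_norm p (A :: complex^'n^'n) = 0"
proof -
  have "mminor p A I J = 0" for I J
  proof -
    have "\<not> inj_on I {..<p}"
    proof
      assume "inj_on I {..<p}"
      then have "card {..<p} \<le> CARD('n)" by (intro card_inj_on_le) auto
      then show False using p by simp
    qed
    then obtain k l where "k < p" "l < p" "k \<noteq> l" "I k = I l"
      unfolding inj_on_def by auto
    then show ?thesis by (rule minor_eq_0_if_rows_repeat)
  qed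
  then show ?thesis by (simp add: minor_norm_def)
qed

section \<open>Perturbation of minors\<close>

lemma norm_prod_diff_le:
  fixes x y :: "nat \<Rightarrow> complex"
  assumes "\<And>k. k < n \<Longrightarrow> cmod (x k) \<le> c" "\<And>k. k < n \<Longrightarrow> cmod (y k) \<le> c"
    and "\<And>k. k < n \<Longrightarrow> cmod (x k - y k) \<le> r" and c: "c \<ge> 0"
  shows "cmod ((\<Prod>k<n. x k) - (\<Prod>k<n. y k)) \<le> real n * c ^ (n - 1) * r"
  using assms(1-3)
proof (induction n)
  case 0
  show ?case by simp
next
  case (Suc n)
  have r: "r \<ge> 0" using Suc.prems(3)[of n] norm_ge_zero by (rule order_trans[rotated]) simp
  have py: "cmod (\<Prod>k<n. y k) \<le> c ^ n"
  proof -
    have "(\<Prod>k<n. cmod (y k)) \<le> (\<Prod>k<n. c)" by (intro prod_mono) (use Suc.prems in auto)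
    then show ?thesis by (simp add: prod_norm)
  qed
  \<comment> \<open>One factor is exchanged at a time.\<close>
  have "(\<Prod>k<Suc n. x k) - (\<Prod>k<Suc n. y k)
      = ((\<Prod>k<n. x k) - (\<Prod>k<n. y k)) * x n + (\<Prod>k<n. y k) * (x n - y n)"
    by (simp add: algebra_simps)
  then have "cmod ((\<Prod>k<Suc n. x k) - (\<Prod>k<Suc n. y k))
      \<le> cmod ((\<Prod>k<n. x k) - (\<Prod>k<n. y k)) * cmod (x n) + cmod (\<Prod>k<n. y k) * cmod (x n - y n)"
    by (metis norm_mult norm_triangle_ineq)
  also have "\<dots> \<le> (real n * c ^ (n - 1) * r) * c + c ^ n * r"
    using Suc c r py by (intro add_mono mult_mono Suc.IH) auto
  also have "\<dots> = real (Suc n) * c ^ n * r"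
    by (cases n) (auto simp: algebra_simps)
  finally show ?case by simp
qed

lemma norm_minor_diff_le:
  assumes "\<And>i j. cmod (a i j) \<le> c" "\<And>i j. cmod (b i j) \<le> c"
    and "\<And>i j. cmod (a i j - b i j) \<le> r"
  shows "cmod (minor p a I J - minor p b I J) \<le> fact p * (real p * c ^ (p - 1) * r)"
proof -
  have c: "c \<ge> 0" using assms(1) norm_ge_zero order_trans by blast
  have "minor p a I J - minor p b I J = (\<Sum>\<sigma> | \<sigma> permutes {..<p}. of_int (sign \<sigma>)
      * ((\<Prod>k<p. a (I k) (J (\<sigma> k))) - (\<Prod>k<p. b (I k) (J (\<sigma> k)))))"
    by (simp add: minor_def sum_subtractf algebra_simps)
  also have "cmod \<dots> \<le> (\<Sum>\<sigma> | \<sigma> permutes {..<p}. real p * c ^ (p - 1) * r)"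
  proof (rule order_trans[OF norm_sum sum_mono])
    fix \<sigma> :: "nat \<Rightarrow> nat"
    have "cmod (of_int (sign \<sigma>)) = 1" by (simp add: sign_def)
    then show "cmod (of_int (sign \<sigma>) * ((\<Prod>k<p. a (I k) (J (\<sigma> k))) - (\<Prod>k<p. b (I k) (J (\<sigma> k)))))
        \<le> real p * c ^ (p - 1) * r"
      using norm_prod_diff_le[of p "\<lambda>k. a (I k) (J (\<sigma> k))" c "\<lambda>k. b (I k) (J (\<sigma> k))" r] assms c
      by (simp add: norm_mult)
  qed
  also have "\<dots> = fact p * (real p * c ^ (p - 1) * r)"
    using card_permutations[of "{..<p}" p] by simp
  finally show ?thesis .
qed

lemma max_minor_exists:
  obtains I0 J0 where "\<And>I J. cmod (mminor p A I J) \<le> cmod (mminor p A I0 J0)"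
proof -
  let ?t = "tuples p UNIV :: (nat \<Rightarrow> 'a) set"
  define S where "S = (\<lambda>(I, J). cmod (mminor p A I J)) ` (?t \<times> ?t)"
  have fin: "finite S" unfolding S_def by simp
  have mem: "cmod (mminor p A I J) \<in> S" for I J
  proof -
    have "mminor p A I J = mminor p A (restrict I {..<p}) (restrict J {..<p})"
      by (rule minor_cong) auto
    then show ?thesis unfolding S_def
      by (intro image_eqI[of _ _ "(restrict I {..<p}, restrict J {..<p})"]) auto
  qed
  then have "Max S \<in> S" using fin by (intro Max_in) auto
  then obtain I0 J0 where "Max S = cmod (mminor p A I0 J0)" unfolding S_def by auto
  moreover have "cmod (mminor p A I J) \<le> Max S" for I J by (rule Max_ge[OF fin mem])
  ultimately show ?thesis using that by metis
qed

lemma minor_norm_le_max_minor: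
  fixes A :: "complex^'n^'n"
  assumes "\<And>I J. cmod (mminor p A I J) \<le> c"
  shows "minor_norm p A \<le> real (CARD('n) ^ p * CARD('n) ^ p) * c"
proof -
  have c: "c \<ge> 0" using assms norm_ge_zero order_trans by blast
  have "(\<Sum>I\<in>tuples p UNIV. \<Sum>J\<in>tuples p UNIV. cmod (mminor p A I J))
      \<le> (\<Sum>I\<in>(tuples p UNIV :: (nat \<Rightarrow> 'n) set). \<Sum>J\<in>(tuples p UNIV :: (nat \<Rightarrow> 'n) set). c)"
    by (intro sum_mono assms)
  also have "\<dots> = real (CARD('n) ^ p * CARD('n) ^ p) * c" by simp
  finally have *: "(\<Sum>I\<in>tuples p UNIV. \<Sum>J\<in>tuples p UNIV. cmod (mminor p A I J)) \<le> real (CARD('n) ^ p * CARD('n) ^ p) * c" .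
  have "minor_norm p A \<le> (real (CARD('n) ^ p * CARD('n) ^ p) * c) / fact p"
    unfolding minor_norm_def using * by (rule divide_right_mono) simp
  also have "\<dots> \<le> real (CARD('n) ^ p * CARD('n) ^ p) * c / 1"
    using c by (intro divide_left_mono) auto
  finally show ?thesis by simp
qed

text \<open>A \<open>2 x 2\<close> determinant whose entries are close to those of a vanishing one.
  If \<open>e\<close> is at least \<open>m\<close>, the trivial bound \<open>2 m^2\<close> suffices;
  otherwise the entries \<open>b\<close> are at most \<open>2 m\<close> and each product changes by
  at most \<open>3 m e\<close>. The bound is linear in \<open>e\<close> either way.\<close>

lemma norm_diff_products_le:
  fixes a1 a2 a3 a4 b1 b2 b3 b4 :: complex
  assumes a: "cmod a1 \<le> m" "cmod a2 \<le> m" "cmod a3 \<le> m" "cmod a4 \<le> m"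
    and e: "cmod (a1 - b1) \<le> e" "cmod (a2 - b2) \<le> e" "cmod (a3 - b3) \<le> e" "cmod (a4 - b4) \<le> e"
    and b: "b1 * b2 = b3 * b4"
  shows "cmod (a1 * a2 - a3 * a4) \<le> 6 * (m * e)"
proof -
  have m: "m \<ge> 0" and e0: "e \<ge> 0" using a(1) e(1) norm_ge_zero order_trans by blast+
  show ?thesis
  proof (cases "m \<le> e")
    case True
    have "cmod (a1 * a2 - a3 * a4) \<le> cmod a1 * cmod a2 + cmod a3 * cmod a4"
      by (metis norm_mult norm_triangle_ineq4)
    also have "\<dots> \<le> m * m + m * m" using a m by (intro add_mono mult_mono) auto
    also have "\<dots> \<le> m * e + m * e" using True m by (intro add_mono mult_left_mono) auto
    also have "\<dots> \<le> 6 * (m * e)" using mult_nonneg_nonneg[OF m e0] by linarith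
    finally show ?thesis .
  next
    case False
    have step: "cmod (x * y - x' * y') \<le> 3 * (m * e)"
      if "cmod y \<le> m" "cmod x \<le> m" "cmod (x - x') \<le> e" "cmod (y - y') \<le> e" for x y x' y'
    proof -
      have x': "cmod x' \<le> 2 * m"
        using norm_triangle_ineq2[of x' x] that False by (simp add: norm_minus_commute)
      have "x * y - x' * y' = (x - x') * y + x' * (y - y')" by (simp add: algebra_simps)
      then have "cmod (x * y - x' * y') \<le> cmod (x - x') * cmod y + cmod x' * cmod (y - y')"
        by (metis norm_mult norm_triangle_ineq)
      also have "\<dots> \<le> e * m + 2 * m * e" using that x' m e0 by (intro add_mono mult_mono) auto
      finally show ?thesis by (simp add: algebra_simps)
    qed
    have "a1 * a2 - a3 * a4 = (a1 * a2 - b1 * b2) - (a3 * a4 - b3 * b4)" using b by simp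
    then have "cmod (a1 * a2 - a3 * a4) \<le> cmod (a1 * a2 - b1 * b2) + cmod (a3 * a4 - b3 * b4)"
      by (metis norm_triangle_ineq4)
    also have "\<dots> \<le> 3 * (m * e) + 3 * (m * e)" by (intro add_mono step a e)
    also have "\<dots> = 6 * (m * e)" by simp
    finally show ?thesis .
  qed
qed

text \<open>Let \<open>I0, J0\<close> be a maximal \<open>p\<close>-minor. Expanding the \<open>(p+1)\<close>-minors containing it shows
  that \<open>A\<close> is the sum of a matrix of rank \<open>p\<close>, whose \<open>p\<close>-th compound has rank one, and of a
  remainder bounded by the ratio of the \<open>(p+1)\<close>-minors to the maximal \<open>p\<close>-minor.\<close>

lemma compound_rank_one_defect:
  fixes A :: "complex^'n^'n"
  assumes p: "p \<ge> 1"
  shows "cmod (mminor p A I J * mminor p A K L - mminor p A I L * mminor p A K J)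
    \<le> 6 * (fact p * real p * real p ^ (p - 1) * fact (Suc p)) * (op_norm A ^ (p - 1) * minor_norm (Suc p) A)"
    (is "?lhs \<le> ?rhs")
proof -
  obtain I0 J0 where max: "\<And>I J. cmod (mminor p A I J) \<le> cmod (mminor p A I0 J0)"
    using max_minor_exists[of p A] by blast
  define m0 where "m0 = mminor p A I0 J0"
  define M where "M = cmod m0"
  have max: "cmod (mminor p A I J) \<le> M" for I J using max by (simp add: M_def m0_def)
  have rhs0: "?rhs \<ge> 0"
    using op_norm_nonneg[of A] minor_norm_nonneg[of "Suc p" A] by simp
  show ?thesis
  proof (cases "M = 0")
    case True
    then have "mminor p A I J = 0" for I J using max[of I J] by simp
    then show ?thesis using rhs0 by simp
  next
    case False
    then have M: "M > 0" and m0: "m0 \<noteq> 0" by (auto simp: M_def)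
    \<comment> \<open>Cramer's rule: \<open>W m l\<close> is the coefficient of column
      \<open>J0 m\<close> in the approximation of column \<open>l\<close>, and maximality of the
      minor bounds it by one.\<close>
    define W where "W m l = mminor p A I0 (J0(m := l)) / m0" for m l
    define b where "b k l = (\<Sum>m<p. A $ k $ (J0 m) * W m l)" for k l
    define r where "r = fact (Suc p) * minor_norm (Suc p) A / M"
    \<comment> \<open>A common bound for the entries of \<open>A\<close> and of \<open>b\<close>,
      the latter being sums of \<open>p\<close> terms with coefficients at most one.\<close>
    define c where "c = real p * op_norm A"
    \<comment> \<open>The error is the minor with row \<open>k\<close> and column \<open>l\<close>
      appended, divided by \<open>m0\<close>: this is the Laplace expansion along the appended
      row.\<close>
    have diff: "A $ k $ l - b k l = mminor (Suc p) A (I0(p := k)) (J0(p := l)) / m0" for k l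
    proof -
      have "mminor (Suc p) A (I0(p := k)) (J0(p := l))
          = A $ k $ l * mminor p A (I0(p := k)) (J0(p := l))
            - (\<Sum>m<p. A $ k $ ((J0(p := l)) m) * mminor p A (I0(p := k)) ((J0(p := l))(m := l)))"
        by (subst minor_Suc_expand) simp
      also have "mminor p A (I0(p := k)) (J0(p := l)) = m0"
        unfolding m0_def by (rule minor_cong) auto
      also have "(\<Sum>m<p. A $ k $ ((J0(p := l)) m) * mminor p A (I0(p := k)) ((J0(p := l))(m := l)))
          = (\<Sum>m<p. A $ k $ (J0 m) * (m0 * W m l))"
      proof (intro sum.cong refl arg_cong2[where f="(*)"])
        fix m assume "m \<in> {..<p}"
        then show "A $ k $ ((J0(p := l)) m) = A $ k $ (J0 m)" by simp
        have "mminor p A (I0(p := k)) ((J0(p := l))(m := l)) = mminor p A I0 (J0(m := l))"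
          by (rule minor_cong) auto
        then show "mminor p A (I0(p := k)) ((J0(p := l))(m := l)) = m0 * W m l"
          using m0 by (simp add: W_def)
      qed
      also have "\<dots> = m0 * b k l" by (simp add: b_def sum_distrib_left mult_ac)
      finally have eq: "mminor (Suc p) A (I0(p := k)) (J0(p := l)) = A $ k $ l * m0 - m0 * b k l" .
      show ?thesis
        unfolding eq diff_divide_distrib nonzero_mult_div_cancel_left[OF m0] nonzero_mult_div_cancel_right[OF m0] ..
    qed
    have dA: "cmod (A $ k $ l - b k l) \<le> r" for k l
      unfolding diff norm_divide r_def M_def
      by (intro divide_right_mono mminor_le_minor_norm) auto
    have W: "cmod (W m l) \<le> 1" for m l
      using max[of I0 "J0(m := l)"] M by (simp add: W_def norm_divide M_def)
    have cA: "cmod (A $ k $ l) \<le> c" for k l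
    proof -
      have "1 * op_norm A \<le> real p * op_norm A"
        using p op_norm_nonneg[of A] by (intro mult_right_mono) auto
      then show ?thesis using entry_le_op_norm[of A k l] by (simp add: c_def)
    qed
    have cb: "cmod (b k l) \<le> c" for k l
    proof -
      have "cmod (b k l) \<le> (\<Sum>m<p. cmod (A $ k $ (J0 m)) * cmod (W m l))"
        unfolding b_def norm_mult[symmetric] by (rule norm_sum)
      also have "\<dots> \<le> (\<Sum>m<p. op_norm A * 1)"
        using W op_norm_nonneg[of A] by (intro sum_mono mult_mono entry_le_op_norm) auto
      finally show ?thesis by (simp add: c_def)
    qed
    define E where "E = fact p * (real p * c ^ (p - 1) * r)"
    have E: "cmod (mminor p A I J - minor p b I J) \<le> E" for I J
      unfolding E_def by (rule norm_minor_diff_le) (rule cA cb dA)+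
    have "minor p b I J = minor p (\<lambda>k m. A $ k $ (J0 m)) I id * minor p W id J" for I J
      by (rule minor_factor) (simp add: b_def)
    then have "minor p b I J * minor p b K L = minor p b I L * minor p b K J"
      by simp
    then have "?lhs \<le> 6 * (M * E)"
      by (intro norm_diff_products_le[OF max max max max E E E E])
    \<comment> \<open>\<open>M\<close> cancels against the denominator of \<open>r\<close>, so no
      lower bound on the maximal minor is required.\<close>
    also have "6 * (M * E) = ?rhs"
      using M by (simp add: E_def r_def c_def power_mult_distrib)
    finally show ?thesis .
  qed
qed

text \<open>Each principal minor occurs once for every ordering of its indices, always with the same
  sign, so this is \<open>p!\<close> times the \<open>p\<close>-th elementary symmetric polynomial
  of the eigenvalues.\<close>

definition minor_trace :: "nat \<Rightarrow> complex^'n^'n \<Rightarrow> complex"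
  where "minor_trace p A = (\<Sum>I\<in>tuples p UNIV. mminor p A I I)"

text \<open>If the \<open>p\<close>-th compounds \<open>a\<close>, \<open>b\<close> of \<open>A\<close>, \<open>B\<close> had rank one then the product of an entry
  of \<open>a b\<close> and an entry of \<open>b a\<close> would be an entry of \<open>a\<close> times an entry of \<open>b\<close> times the trace
  of \<open>a b\<close>.\<close>

lemma minor_products_le_trace:
  fixes A B :: "complex^'n^'n"
  assumes dA: "\<And>I J K L. cmod (mminor p A I J * mminor p A K L - mminor p A I L * mminor p A K J) \<le> DA"
    and dB: "\<And>I J K L. cmod (mminor p B I J * mminor p B K L - mminor p B I L * mminor p B K J) \<le> DB"
  shows "cmod (mminor p (A ** B) I J) * cmod (mminor p (B ** A) K L)
    \<le> fact p * (minor_norm p A * minor_norm p B * cmod (minor_trace p (A ** B)))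
      + real (CARD('n) ^ p * CARD('n) ^ p) * (DA * (minor_norm p B)\<^sup>2 + (minor_norm p A)\<^sup>2 * DB)"
proof -
  let ?t = "tuples p UNIV :: (nat \<Rightarrow> 'n) set"
  let ?a = "mminor p A" and ?b = "mminor p B"
  define f where "f = (of_nat (fact p) :: complex)"
  define F where "F = (fact p :: real)"
  have fF: "cmod f = F" and F1: "F > 0" by (auto simp: f_def F_def)
  have ab: "f * mminor p (A ** B) I J = (\<Sum>s\<in>?t. ?a I s * ?b s J)" for I J
    unfolding f_def by (rule cauchy_binet_matrix)
  have ba: "f * mminor p (B ** A) I J = (\<Sum>s\<in>?t. ?b I s * ?a s J)" for I J
    unfolding f_def by (rule cauchy_binet_matrix)
  have tr: "f * minor_trace p (A ** B) = (\<Sum>s\<in>?t. \<Sum>u\<in>?t. ?a u s * ?b s u)"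
  proof -
    have "f * minor_trace p (A ** B) = (\<Sum>u\<in>?t. \<Sum>s\<in>?t. ?a u s * ?b s u)"
      unfolding minor_trace_def sum_distrib_left ab ..
    also have "\<dots> = (\<Sum>s\<in>?t. \<Sum>u\<in>?t. ?a u s * ?b s u)" by (rule sum.swap)
    finally show ?thesis .
  qed
  let ?X = "mminor p (A ** B) I J" and ?Y = "mminor p (B ** A) K L" and ?T = "minor_trace p (A ** B)"
  have "f * ?X * (f * ?Y) - ?a I L * ?b K J * (f * ?T)
    = (\<Sum>s\<in>?t. \<Sum>u\<in>?t. ?a I s * ?b s J * (?b K u * ?a u L)) - (\<Sum>s\<in>?t. \<Sum>u\<in>?t. ?a I L * ?b K J * (?a u s * ?b s u))"
    unfolding ab ba tr sum_product by (simp add: sum_distrib_left)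
  \<comment> \<open>Two exchanges of indices, first in the compound of \<open>A\<close>, then in
    that of \<open>B\<close>. Each would be exact for rank one, and what remains is an entry times
    an entry times the trace.\<close>
  also have "\<dots> = (\<Sum>s\<in>?t. \<Sum>u\<in>?t. (?a I s * ?a u L - ?a I L * ?a u s) * (?b s J * ?b K u)
        + ?a I L * ?a u s * (?b s J * ?b K u - ?b s u * ?b K J))"
    unfolding sum_subtractf[symmetric] by (intro sum.cong refl) (simp add: algebra_simps)
  finally have expand: "f * ?X * (f * ?Y) - ?a I L * ?b K J * (f * ?T) = \<dots>" .
  have "cmod (f * ?X * (f * ?Y) - ?a I L * ?b K J * (f * ?T))
    \<le> (\<Sum>s\<in>?t. \<Sum>u\<in>?t. DA * ((F * minor_norm p B) * (F * minor_norm p B))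
        + (F * minor_norm p A) * (F * minor_norm p A) * DB)"
    unfolding expand
  proof (intro order_trans[OF norm_sum sum_mono] order_trans[OF norm_triangle_ineq add_mono])
    fix s u
    have DA0: "DA \<ge> 0" using dA norm_ge_zero order_trans by blast
    have nn: "F * minor_norm p B \<ge> 0" "F * minor_norm p A \<ge> 0"
      by (simp_all add: F_def minor_norm_nonneg)
    have le: "cmod (?a I J) \<le> F * minor_norm p A" "cmod (?b I J) \<le> F * minor_norm p B" for I J
      unfolding F_def by (rule mminor_le_minor_norm)+
    show "cmod ((?a I s * ?a u L - ?a I L * ?a u s) * (?b s J * ?b K u)) \<le> DA * ((F * minor_norm p B) * (F * minor_norm p B))"
      unfolding norm_mult using DA0 nn by (intro mult_mono dA[unfolded norm_mult] le) auto
    show "cmod (?a I L * ?a u s * (?b s J * ?b K u - ?b s u * ?b K J)) \<le> (F * minor_norm p A) * (F * minor_norm p A) * DB"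
      unfolding norm_mult using nn by (intro mult_mono dB[unfolded norm_mult] le) auto
  qed
  also have "\<dots> = F\<^sup>2 * (real (CARD('n) ^ p * CARD('n) ^ p) * (DA * (minor_norm p B)\<^sup>2 + (minor_norm p A)\<^sup>2 * DB))"
  proof -
    have "t * (t * (DA * (F * y * (F * y)) + F * x * (F * x) * DB)) = F\<^sup>2 * (t * t * (DA * y\<^sup>2 + x\<^sup>2 * DB))" for t x y
      by (simp add: power2_eq_square algebra_simps)
    then show ?thesis by (simp only: sum_constant card_tuples of_nat_mult)
  qed
  finally have 1: "cmod (f * ?X * (f * ?Y) - ?a I L * ?b K J * (f * ?T)) \<le> \<dots>" .
  have 2: "cmod (?a I L * ?b K J * (f * ?T)) \<le> F\<^sup>2 * (F * (minor_norm p A * minor_norm p B * cmod ?T))"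
  proof -
    have "cmod (?a I L) * cmod (?b K J) \<le> (F * minor_norm p A) * (F * minor_norm p B)"
      unfolding F_def by (intro mult_mono mminor_le_minor_norm) (simp_all add: minor_norm_nonneg)
    then have "cmod (?a I L) * cmod (?b K J) * (F * cmod ?T) \<le> (F * minor_norm p A) * (F * minor_norm p B) * (F * cmod ?T)"
      using F1 by (intro mult_right_mono) auto
    then show ?thesis by (simp add: norm_mult fF power2_eq_square mult_ac)
  qed
  have "F\<^sup>2 * (cmod ?X * cmod ?Y) = cmod (f * ?X * (f * ?Y))"
    by (simp add: norm_mult fF power2_eq_square mult_ac)
  also have "\<dots> \<le> cmod (?a I L * ?b K J * (f * ?T)) + cmod (f * ?X * (f * ?Y) - ?a I L * ?b K J * (f * ?T))"
    by (rule norm_triangle_sub)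
  also have "\<dots> \<le> F\<^sup>2 * (F * (minor_norm p A * minor_norm p B * cmod ?T)
      + real (CARD('n) ^ p * CARD('n) ^ p) * (DA * (minor_norm p B)\<^sup>2 + (minor_norm p A)\<^sup>2 * DB))"
    unfolding distrib_left[of "F\<^sup>2"] by (intro add_mono 1 2)
  finally show ?thesis using F1 by (simp add: F_def)
qed

text \<open>This is \<open>minor_products_le_trace\<close> at the largest minors of
  \<open>A ** B\<close> and \<open>B ** A\<close>, which control the whole compounds. The constant
  depends only on \<open>p\<close> and the dimension, hence serves all lengths of products at
  once.\<close>

lemma minor_norm_products_le:
  assumes p: "p \<ge> 1"
  obtains C where "C > 0" and "\<And>A B :: complex^'n^'n. minor_norm p (A ** B) * minor_norm p (B ** A)
    \<le> C * (minor_norm p A * minor_norm p B * cmod (minor_trace p (A ** B))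
      + op_norm A ^ (p - 1) * minor_norm (Suc p) A * (minor_norm p B)\<^sup>2
      + (minor_norm p A)\<^sup>2 * (op_norm B ^ (p - 1) * minor_norm (Suc p) B))"
proof -
  define T where "T = real (CARD('n) ^ p * CARD('n) ^ p)"
  define D where "D = 6 * (fact p * real p * real p ^ (p - 1) * fact (Suc p))"
  define C where "C = T * T * (fact p + T * D)"
  have T: "T > 0" by (simp add: T_def)
  have D: "D \<ge> 0" by (simp add: D_def)
  have C: "C > 0" unfolding C_def using T D by (intro mult_pos_pos add_pos_nonneg) auto
  show ?thesis
  proof (rule that[OF C])
    fix A B :: "complex^'n^'n"
    define x where "x = minor_norm p A * minor_norm p B * cmod (minor_trace p (A ** B))"
    define y where "y = op_norm A ^ (p - 1) * minor_norm (Suc p) A * (minor_norm p B)\<^sup>2"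
    define z where "z = (minor_norm p A)\<^sup>2 * (op_norm B ^ (p - 1) * minor_norm (Suc p) B)"
    have xyz: "x \<ge> 0" "y \<ge> 0" "z \<ge> 0"
      unfolding x_def y_def z_def by (simp_all add: minor_norm_nonneg op_norm_nonneg)
    obtain I J where IJ: "\<And>I' J'. cmod (mminor p (A ** B) I' J') \<le> cmod (mminor p (A ** B) I J)"
      using max_minor_exists[of p "A ** B"] by blast
    obtain K L where KL: "\<And>I' J'. cmod (mminor p (B ** A) I' J') \<le> cmod (mminor p (B ** A) K L)"
      using max_minor_exists[of p "B ** A"] by blast
    have "minor_norm p (A ** B) * minor_norm p (B ** A)
        \<le> (T * cmod (mminor p (A ** B) I J)) * (T * cmod (mminor p (B ** A) K L))"
      unfolding T_def by (intro mult_mono minor_norm_le_max_minor IJ KL minor_norm_nonneg) auto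
    also have "\<dots> = T * T * (cmod (mminor p (A ** B) I J) * cmod (mminor p (B ** A) K L))" by simp
    also have "\<dots> \<le> T * T * (fact p * x + T * D * (y + z))"
    proof (rule mult_left_mono)
      have "cmod (mminor p (A ** B) I J) * cmod (mminor p (B ** A) K L)
          \<le> fact p * x + T * (D * (op_norm A ^ (p - 1) * minor_norm (Suc p) A) * (minor_norm p B)\<^sup>2
             + (minor_norm p A)\<^sup>2 * (D * (op_norm B ^ (p - 1) * minor_norm (Suc p) B)))"
        unfolding x_def T_def D_def
        by (rule minor_products_le_trace) (rule compound_rank_one_defect[OF p])+
      then show "cmod (mminor p (A ** B) I J) * cmod (mminor p (B ** A) K L) \<le> fact p * x + T * D * (y + z)"
        by (simp add: y_def z_def algebra_simps)
    qed (use T in simp)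
    also have "\<dots> \<le> T * T * ((fact p + T * D) * (x + y + z))"
    proof (rule mult_left_mono)
      have "fact p * x \<le> fact p * (x + y + z)" "T * D * (y + z) \<le> T * D * (x + y + z)"
        using xyz T D by (auto intro!: mult_left_mono)
      then show "fact p * x + T * D * (y + z) \<le> (fact p + T * D) * (x + y + z)"
        by (simp only: distrib_right)
    qed (use T in simp)
    also have "\<dots> = C * (x + y + z)" by (simp add: C_def mult.assoc)
    finally show "minor_norm p (A ** B) * minor_norm p (B ** A) \<le> C * (x + y + z)" .
  qed
qed

section \<open>The spectral radius\<close>

definition mat_entry :: "nat \<Rightarrow> complex Matrix.mat \<Rightarrow> nat \<Rightarrow> nat \<Rightarrow> complex"
  where "mat_entry d X i j = (if i < d \<and> j < d then X $$ (i, j) else 0)"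

text \<open>Extension by zero makes the formula valid for all indices, the form in which
  \<open>cauchy_binet\<close> takes it.\<close>

lemma mat_entry_mult:
  assumes "X \<in> carrier_mat d d" "Y \<in> carrier_mat d d"
  shows "mat_entry d (X * Y) i j = (\<Sum>s\<in>{..<d}. mat_entry d X i s * mat_entry d Y s j)"
  using assms by (auto simp: mat_entry_def scalar_prod_def atLeast0LessThan intro!: sum.cong)

definition compound_trace :: "nat \<Rightarrow> nat \<Rightarrow> complex Matrix.mat \<Rightarrow> complex"
  where "compound_trace d p X = (\<Sum>I\<in>tuples p {..<d}. minor p (mat_entry d X) I I)"

text \<open>By Cauchy-Binet this is tr(x y) = tr(y x) for the compounds; it gives invariance under
  similarity.\<close>

lemma compound_trace_mult_commute:
  assumes X: "X \<in> carrier_mat d d" and Y: "Y \<in> carrier_mat d d"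
  shows "compound_trace d p (X * Y) = compound_trace d p (Y * X)"
proof -
  let ?t = "tuples p {..<d}"
  have "of_nat (fact p) * compound_trace d p (X * Y)
      = (\<Sum>I\<in>?t. \<Sum>K\<in>?t. minor p (mat_entry d X) I K * minor p (mat_entry d Y) K I)"
    unfolding compound_trace_def sum_distrib_left
    by (intro sum.cong refl cauchy_binet mat_entry_mult[OF X Y]) simp
  also have "\<dots> = (\<Sum>K\<in>?t. \<Sum>I\<in>?t. minor p (mat_entry d X) I K * minor p (mat_entry d Y) K I)"
    by (rule sum.swap)
  also have "\<dots> = (\<Sum>K\<in>?t. \<Sum>I\<in>?t. minor p (mat_entry d Y) K I * minor p (mat_entry d X) I K)"
    by (intro sum.cong refl mult.commute)
  also have "\<dots> = of_nat (fact p) * compound_trace d p (Y * X)"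
    unfolding compound_trace_def sum_distrib_left
    by (intro sum.cong refl cauchy_binet[symmetric] mat_entry_mult[OF Y X]) simp
  finally show ?thesis by simp
qed

text \<open>A permutation can contribute only if \<open>I k \<le> I (\<sigma> k)\<close> for every
  \<open>k\<close>. Both sides have the same sum over \<open>k\<close>, so equality holds throughout
  and only diagonal entries are left.\<close>

lemma compound_trace_upper_triangular:
  assumes B: "B \<in> carrier_mat d d" "upper_triangular B"
    and r: "\<And>i. i < d \<Longrightarrow> cmod (B $$ (i, i)) \<le> r"
  shows "cmod (compound_trace d p B) \<le> real (d ^ p) * (fact p * r ^ p)"
proof -
  have "cmod (minor p (mat_entry d B) I I) \<le> fact p * r ^ p" if I: "I \<in> tuples p {..<d}" for I
  proof -
    have Id: "I k < d" if "k < p" for k using I that by auto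
    have "cmod (minor p (mat_entry d B) I I)
        \<le> (\<Sum>\<sigma> | \<sigma> permutes {..<p}. cmod (of_int (sign \<sigma>) * (\<Prod>k<p. mat_entry d B (I k) (I (\<sigma> k)))))"
      unfolding minor_def by (rule norm_sum)
    also have "\<dots> \<le> (\<Sum>\<sigma> | \<sigma> permutes {..<p}. r ^ p)"
    proof (rule sum_mono)
      fix \<sigma> assume "\<sigma> \<in> {\<sigma>. \<sigma> permutes {..<p}}"
      then have \<sigma>: "\<sigma> permutes {..<p}" by simp
      have \<sigma>p: "\<sigma> k < p" if "k < p" for k using permutes_in_image[OF \<sigma>, of k] that by simp
      have "cmod (of_int (sign \<sigma>)) = 1" by (simp add: sign_def)
      then have eq: "cmod (of_int (sign \<sigma>) * (\<Prod>k<p. mat_entry d B (I k) (I (\<sigma> k))))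
          = (\<Prod>k<p. cmod (mat_entry d B (I k) (I (\<sigma> k))))"
        by (simp add: norm_mult prod_norm)
      have r0: "r ^ p \<ge> 0"
      proof (cases "p = 0")
        case False
        then have "r \<ge> 0" using r[OF Id[of 0]] norm_ge_zero order_trans by blast
        then show ?thesis by simp
      qed simp
      show "cmod (of_int (sign \<sigma>) * (\<Prod>k<p. mat_entry d B (I k) (I (\<sigma> k)))) \<le> r ^ p"
      proof (cases "\<exists>k<p. I (\<sigma> k) < I k")
        case True
        then obtain k where k: "k < p" "I (\<sigma> k) < I k" by auto
        then have "mat_entry d B (I k) (I (\<sigma> k)) = 0"
          using B Id[of k] by (auto simp: mat_entry_def upper_triangular_def)
        then have zero: "(\<Prod>k<p. cmod (mat_entry d B (I k) (I (\<sigma> k)))) = 0"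
          using k by (intro prod_zero) auto
        show ?thesis unfolding eq zero by (rule r0)
      next
        case False
        then have le: "I k \<le> I (\<sigma> k)" if "k < p" for k using that by (meson leI)
        have sum: "(\<Sum>k<p. I (\<sigma> k)) = (\<Sum>k<p. I k)"
          by (rule sum.reindex_bij_betw[OF permutes_imp_bij[OF \<sigma>]])
        have "I (\<sigma> k) = I k" if k: "k < p" for k
        proof (rule ccontr)
          assume "I (\<sigma> k) \<noteq> I k"
          then have "I k < I (\<sigma> k)" using le[OF k] by simp
          then have "(\<Sum>k<p. I k) < (\<Sum>k<p. I (\<sigma> k))"
            using k le by (intro sum_strict_mono_ex1) auto
          then show False using sum by simp
        qed
        then have "(\<Prod>k<p. cmod (mat_entry d B (I k) (I (\<sigma> k)))) \<le> (\<Prod>k<p. r)"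
          using Id r by (intro prod_mono) (auto simp: mat_entry_def)
        then show ?thesis unfolding eq by simp
      qed
    qed
    also have "\<dots> = fact p * r ^ p" using card_permutations[of "{..<p}" p] by simp
    finally show ?thesis .
  qed
  then have "cmod (compound_trace d p B) \<le> (\<Sum>I\<in>tuples p {..<d}. fact p * r ^ p)"
    unfolding compound_trace_def by (intro order_trans[OF norm_sum sum_mono])
  also have "\<dots> = real (d ^ p) * (fact p * r ^ p)" by (simp add: card_PiE)
  finally show ?thesis .
qed

section \<open>Schur triangular form over a numbered index set\<close>

locale enumerated_matrix =
  fixes f :: "nat \<Rightarrow> 'n::finite" and g :: "complex^'n^'n"
  assumes bij: "bij_betw f {..<CARD('n)} UNIV"
begin

definition jmat :: "complex Matrix.mat"
  where "jmat = Matrix.mat CARD('n) CARD('n) (\<lambda>(i, j). g $ f i $ f j)"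

lemma jmat_carrier: "jmat \<in> carrier_mat CARD('n) CARD('n)"
  by (simp add: jmat_def)

definition pos :: "'n \<Rightarrow> nat" where "pos = inv_into {..<CARD('n)} f"

lemma f_pos: "f (pos i) = i" and pos_less: "pos i < CARD('n)"
  using bij_betw_inv_into_right[OF bij, of i] bij_betw_apply[OF bij_betw_inv_into[OF bij], of i]
  by (auto simp: pos_def)

lemma pos_f: "k < CARD('n) \<Longrightarrow> pos (f k) = k"
  using bij_betw_inv_into_left[OF bij, of k] by (simp add: pos_def)

lemma sum_f: "(\<Sum>j\<in>UNIV. h j) = (\<Sum>k\<in>{0..<CARD('n)}. h (f k))"
  using sum.reindex_bij_betw[OF bij, of h] by (simp add: atLeast0LessThan)

lemma eigenvalue_jmat: "Char_Poly.eigenvalue jmat c \<longleftrightarrow> Defs.eigenvalue g c"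
proof
  assume "Char_Poly.eigenvalue jmat c"
  then obtain v where v: "v \<in> carrier_vec CARD('n)" "v \<noteq> 0\<^sub>v CARD('n)" "jmat *\<^sub>v v = c \<cdot>\<^sub>v v"
    unfolding Char_Poly.eigenvalue_def eigenvector_def using jmat_carrier by auto
  define w where "w = (\<chi> i. vec_index v (pos i))"
  have "g *v w = c *s w"
  proof (simp add: vec_eq_iff, intro allI)
    fix i
    have "(g *v w) $ i = (\<Sum>k\<in>{0..<CARD('n)}. g $ i $ f k * vec_index v k)"
      unfolding matrix_vector_mult_def by (simp add: sum_f w_def pos_f)
    also have "\<dots> = vec_index (jmat *\<^sub>v v) (pos i)"
      using v(1) pos_less[of i] by (auto simp: jmat_def scalar_prod_def f_pos intro!: sum.cong)
    also have "\<dots> = c * w $ i" using v(1) pos_less[of i] unfolding v(3) by (simp add: w_def)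
    finally show "(g *v w) $ i = c * w $ i" .
  qed
  moreover have "w \<noteq> 0"
  proof
    assume "w = 0"
    then have "vec_index v k = 0" if "k < CARD('n)" for k
      using pos_f[OF that] by (metis vec_lambda_beta w_def zero_index)
    then have "v = 0\<^sub>v CARD('n)" using v(1) by auto
    then show False using v(2) by simp
  qed
  ultimately show "Defs.eigenvalue g c" unfolding Defs.eigenvalue_def by blast
next
  assume "Defs.eigenvalue g c"
  then obtain w where w: "w \<noteq> 0" "g *v w = c *s w" unfolding Defs.eigenvalue_def by auto
  define v where "v = Matrix.vec CARD('n) (\<lambda>k. w $ f k)"
  have "jmat *\<^sub>v v = c \<cdot>\<^sub>v v"
  proof
    fix k assume "k < dim_vec (c \<cdot>\<^sub>v v)"
    then have k: "k < CARD('n)" by (simp add: v_def)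
    then have "vec_index (jmat *\<^sub>v v) k = (\<Sum>l\<in>{0..<CARD('n)}. g $ f k $ f l * w $ f l)"
      by (auto simp: jmat_def v_def scalar_prod_def intro!: sum.cong)
    also have "\<dots> = (g *v w) $ f k"
      unfolding matrix_vector_mult_def by (simp add: sum_f)
    finally show "vec_index (jmat *\<^sub>v v) k = vec_index (c \<cdot>\<^sub>v v) k"
      unfolding w(2) using k by (simp add: v_def)
  qed (simp add: jmat_def v_def)
  moreover have "v \<noteq> 0\<^sub>v CARD('n)"
  proof
    assume "v = 0\<^sub>v CARD('n)"
    then have "w $ f k = 0" if "k < CARD('n)" for k
      using that unfolding v_def by (metis index_vec index_zero_vec(1))
    then have "w $ i = 0" for i using f_pos[of i] pos_less[of i] by metis
    then show False using w(1) by (simp add: vec_eq_iff)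
  qed
  ultimately show "Char_Poly.eigenvalue jmat c"
    unfolding Char_Poly.eigenvalue_def eigenvector_def
    by (intro exI[of _ v]) (simp add: v_def jmat_def)
qed

lemma minor_trace_jmat: "minor_trace p g = compound_trace CARD('n) p jmat"
proof -
  let ?d = "CARD('n)"
  have "minor_trace p g = (\<Sum>I\<in>tuples p {..<?d}. mminor p g (restrict (f \<circ> I) {..<p}) (restrict (f \<circ> I) {..<p}))"
    unfolding minor_trace_def
  proof (rule sum.reindex_bij_witness[where i="\<lambda>I. restrict (f \<circ> I) {..<p}" and j="\<lambda>I. restrict (pos \<circ> I) {..<p}"])
    fix I assume "I \<in> tuples p (UNIV :: 'n set)"
    then show eq: "restrict (f \<circ> restrict (pos \<circ> I) {..<p}) {..<p} = I"
      by (auto simp: fun_eq_iff f_pos PiE_def extensional_def)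
    show "restrict (pos \<circ> I) {..<p} \<in> tuples p {..<?d}"
      by (simp add: restrict_PiE_iff pos_less)
    show "mminor p g (restrict (f \<circ> restrict (pos \<circ> I) {..<p}) {..<p}) (restrict (f \<circ> restrict (pos \<circ> I) {..<p}) {..<p}) = mminor p g I I"
      unfolding eq ..
  next
    fix I assume "I \<in> tuples p {..<?d}"
    then show "restrict (pos \<circ> restrict (f \<circ> I) {..<p}) {..<p} = I"
      by (auto simp: fun_eq_iff pos_f PiE_def extensional_def Pi_def)
    show "restrict (f \<circ> I) {..<p} \<in> tuples p UNIV" by simp
  qed
  also have "\<dots> = compound_trace ?d p jmat"
    unfolding compound_trace_def
  proof (rule sum.cong[OF refl])
    fix I assume "I \<in> tuples p {..<?d}"
    then have "I k < ?d" if "k < p" for k using that by auto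
    then show "mminor p g (restrict (f \<circ> I) {..<p}) (restrict (f \<circ> I) {..<p}) = minor p (mat_entry ?d jmat) I I"
      by (intro minor_cong) (simp add: mat_entry_def jmat_def)
  qed
  finally show ?thesis .
qed

text \<open>Over the complex numbers the characteristic polynomial splits, so Schur's theorem
  applies; the diagonal consists of its roots, and compound traces survive the similarity.\<close>

lemma triangular_form:
  obtains B where "B \<in> carrier_mat CARD('n) CARD('n)" "upper_triangular B"
    and "\<And>i. i < CARD('n) \<Longrightarrow> Defs.eigenvalue g (B $$ (i, i))"
    and "\<And>p. minor_trace p g = compound_trace CARD('n) p B"
proof -
  let ?d = "CARD('n)"
  obtain es where es: "char_poly jmat = (\<Prod>a\<leftarrow>es. [:- a, 1:])"
    using char_poly_factorized[OF jmat_carrier] by blast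
  obtain B where B: "B \<in> carrier_mat ?d ?d" "upper_triangular B" "similar_mat jmat B"
    using schur_decomposition_exists[OF jmat_carrier es] by blast
  have "Defs.eigenvalue g (B $$ (i, i))" if i: "i < ?d" for i
  proof -
    have "B $$ (i, i) \<in> set (diag_mat B)" using i B(1) by (auto simp: diag_mat_def)
    then have "poly (char_poly B) (B $$ (i, i)) = 0"
      unfolding char_poly_upper_triangular[OF B(1,2)] by (simp add: poly_prod_list_zero_iff)
    then have "Char_Poly.eigenvalue jmat (B $$ (i, i))"
      unfolding eigenvalue_root_char_poly[OF jmat_carrier] char_poly_similar[OF B(3)] .
    then show ?thesis by (simp add: eigenvalue_jmat)
  qed
  moreover have "minor_trace p g = compound_trace ?d p B" for p
  proof -
    obtain P Q where "similar_mat_wit jmat B P Q" using B(3) unfolding similar_mat_def by blast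
    from similar_mat_witD2[OF jmat_carrier this]
    have PQ: "P \<in> carrier_mat ?d ?d" "Q \<in> carrier_mat ?d ?d" "Q * P = 1\<^sub>m ?d" "jmat = P * B * Q" by auto
    have "compound_trace ?d p jmat = compound_trace ?d p (P * (B * Q))"
      using PQ B(1) by (simp add: assoc_mult_mat[of P ?d ?d B ?d Q ?d])
    also have "\<dots> = compound_trace ?d p (B * Q * P)"
      using PQ B(1) by (intro compound_trace_mult_commute) auto
    also have "B * Q * P = B * (Q * P)" using PQ B(1) by (intro assoc_mult_mat) auto
    also have "\<dots> = B" using PQ B(1) by simp
    finally show ?thesis by (simp add: minor_trace_jmat)
  qed
  ultimately show ?thesis using that B by blast
qed

lemma finite_eigenvalues: "finite {c. Defs.eigenvalue g c}"
proof -
  have "char_poly jmat \<noteq> 0" using degree_monic_char_poly[OF jmat_carrier] by auto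
  then have "finite {c. poly (char_poly jmat) c = 0}" by (rule poly_roots_finite)
  then show ?thesis
    by (simp add: eigenvalue_root_char_poly[OF jmat_carrier, symmetric] eigenvalue_jmat)
qed

end

section \<open>The spectral radius: attainment, bounds and measurability\<close>

lemma enumeration_exists:
  obtains f :: "nat \<Rightarrow> 'n::finite" where "enumerated_matrix f"
proof -
  obtain f :: "nat \<Rightarrow> 'n" where "bij_betw f {..<CARD('n)} UNIV"
    using ex_bij_betw_nat_finite[of "UNIV :: 'n set"] by (auto simp: atLeast0LessThan)
  then show ?thesis using that by (simp add: enumerated_matrix_def)
qed

lemma eigenvalue_moduli:
  fixes g :: "complex^'n^'n"
  shows "finite {cmod c | c. Defs.eigenvalue g c}" "{cmod c | c. Defs.eigenvalue g c} \<noteq> {}"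
proof -
  obtain f :: "nat \<Rightarrow> 'n" where "enumerated_matrix f" by (rule enumeration_exists)
  then interpret enumerated_matrix f g .
  have "{cmod c | c. Defs.eigenvalue g c} = cmod ` {c. Defs.eigenvalue g c}" by auto
  then show "finite {cmod c | c. Defs.eigenvalue g c}" using finite_eigenvalues by simp
  \<comment> \<open>A diagonal entry of the triangular form is an eigenvalue, and the dimension is
    positive.\<close>
  show "{cmod c | c. Defs.eigenvalue g c} \<noteq> {}"
    by (rule triangular_form) (use zero_less_card_finite[where 'a='n] in blast)
qed

lemma eigenvalue_le_spectral_radius: "Defs.eigenvalue g c \<Longrightarrow> cmod c \<le> spectral_radius g"
  unfolding spectral_radius_def by (rule Max_ge[OF eigenvalue_moduli(1)]) auto

lemma spectral_radius_attained:
  obtains c where "Defs.eigenvalue g c" "cmod c = spectral_radius g"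
  using Max_in[OF eigenvalue_moduli, of g] unfolding spectral_radius_def by auto

lemma minor_trace_le_spectral_radius:
  fixes g :: "complex^'n^'n"
  shows "cmod (minor_trace p g) \<le> real (CARD('n) ^ p) * (fact p * spectral_radius g ^ p)"
proof -
  obtain f :: "nat \<Rightarrow> 'n" where "enumerated_matrix f" by (rule enumeration_exists)
  then interpret enumerated_matrix f g .
  obtain B where B: "B \<in> carrier_mat CARD('n) CARD('n)" "upper_triangular B"
    "\<And>i. i < CARD('n) \<Longrightarrow> Defs.eigenvalue g (B $$ (i, i))"
    "\<And>p. minor_trace p g = compound_trace CARD('n) p B"
    by (rule triangular_form) blast
  show ?thesis
    unfolding B(4) by (rule compound_trace_upper_triangular[OF B(1,2)]) (intro eigenvalue_le_spectral_radius B(3))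
qed

lemma norm_vector_smult: "norm (c *s v) = cmod c * norm (v :: complex^'n)"
  by (simp add: norm_vec_def norm_mult L2_set_right_distrib)

lemma norm_eigenvalue_le_op_norm:
  assumes "Defs.eigenvalue g c"
  shows "cmod c \<le> op_norm g"
proof -
  obtain v where v: "v \<noteq> 0" "g *v v = c *s v" using assms unfolding Defs.eigenvalue_def by auto
  have "cmod c * norm v \<le> op_norm g * norm v"
    using norm_matrix_vector_mul_le[of g v] by (simp add: v(2) norm_vector_smult)
  then show ?thesis using v(1) by simp
qed

lemma spectral_radius_le_op_norm: "spectral_radius g \<le> op_norm g"
  by (metis spectral_radius_attained norm_eigenvalue_le_op_norm)

lemma matrix_inv_mult_left: "invertible g \<Longrightarrow> matrix_inv g ** g = mat 1"
  unfolding invertible_def matrix_inv_def by (rule someI2_ex) auto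

text \<open>\<open>R\<close> undoes \<open>g\<close> on an eigenvector for an eigenvalue of maximal
  modulus. This bounds the spectral radius of an invertible product from below, which integrability
  of its logarithm requires.\<close>

lemma spectral_radius_op_norm_left_inverse:
  assumes R: "R ** g = mat 1"
  shows "1 \<le> spectral_radius g * op_norm R"
proof -
  obtain c where c: "Defs.eigenvalue g c" "cmod c = spectral_radius g" by (rule spectral_radius_attained)
  then obtain v where v: "v \<noteq> 0" "g *v v = c *s v" unfolding Defs.eigenvalue_def by auto
  have "v = R *v (g *v v)"
    by (simp add: matrix_vector_mul_assoc R)
  also have "\<dots> = c *s (R *v v)"
    unfolding v(2) by (simp add: vec_eq_iff matrix_vector_mult_def sum_distrib_left mult_ac)
  finally have "norm v = cmod c * norm (R *v v)" by (metis norm_vector_smult)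
  also have "\<dots> \<le> cmod c * (op_norm R * norm v)"
    by (intro mult_left_mono norm_matrix_vector_mul_le) auto
  finally have "1 * norm v \<le> (spectral_radius g * op_norm R) * norm v"
    by (simp add: c(2) mult.assoc)
  then show ?thesis using v(1) by simp
qed

lemma unit_eigenvector:
  assumes "Defs.eigenvalue g c"
  obtains v where "norm v = 1" "g *v v = c *s v"
proof -
  obtain w where w: "w \<noteq> 0" "g *v w = c *s w" using assms unfolding Defs.eigenvalue_def by auto
  define a where "a = complex_of_real (inverse (norm w))"
  have "norm (a *s w) = 1" using w(1) by (simp add: norm_vector_smult a_def norm_inverse)
  moreover have "g *v (a *s w) = c *s (a *s w)"
  proof -
    have "g *v (a *s w) = a *s (g *v w)"
      by (simp add: vec_eq_iff matrix_vector_mult_def sum_distrib_left mult_ac)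
    then show ?thesis by (simp add: w(2) vec_eq_iff mult_ac)
  qed
  ultimately show ?thesis using that by blast
qed

text \<open>The spectral radius is upper semicontinuous, by compactness of the unit sphere.\<close>

lemma closed_spectral_radius_ge: "closed {g :: complex^'n^'n. r \<le> spectral_radius g}"
proof (unfold closed_sequential_limits, intro allI impI, elim conjE)
  fix G :: "nat \<Rightarrow> complex^'n^'n" and g
  assume G: "\<forall>n. G n \<in> {g. r \<le> spectral_radius g}" and lim: "G \<longlonglongrightarrow> g"
  have "\<exists>c v. norm v = 1 \<and> G n *v v = c *s v \<and> r \<le> cmod c" for n
  proof -
    obtain c where "Defs.eigenvalue (G n) c" "cmod c = spectral_radius (G n)"
      by (rule spectral_radius_attained)
    then show ?thesis using G unit_eigenvector by (metis mem_Collect_eq)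
  qed
  then obtain c v where cv: "\<And>n. norm (v n) = 1" "\<And>n. G n *v v n = c n *s v n" "\<And>n. r \<le> cmod (c n)"
    by metis
  \<comment> \<open>Convergence bounds the entries, hence the norms and the eigenvalues. Eigenpairs
    with unit vectors thus stay in a compact set, and a subsequence tends to an eigenpair of the
    limit.\<close>
  have "(\<lambda>n. \<Sum>i\<in>UNIV. \<Sum>j\<in>UNIV. cmod (G n $ i $ j)) \<longlonglongrightarrow> (\<Sum>i\<in>UNIV. \<Sum>j\<in>UNIV. cmod (g $ i $ j))"
    by (intro tendsto_intros lim)
  then have "Bseq (\<lambda>n. \<Sum>i\<in>UNIV. \<Sum>j\<in>UNIV. cmod (G n $ i $ j))"
    by (intro convergent_imp_Bseq convergentI)
  then obtain K where K: "\<And>n. norm (\<Sum>i\<in>UNIV. \<Sum>j\<in>UNIV. cmod (G n $ i $ j)) \<le> K"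
    unfolding Bseq_def by blast
  have "cmod (c n) \<le> K" for n
  proof -
    have "v n \<noteq> 0" using cv(1)[of n] by auto
    then have "Defs.eigenvalue (G n) (c n)" using cv(2) unfolding Defs.eigenvalue_def by blast
    then have "cmod (c n) \<le> op_norm (G n)" by (rule norm_eigenvalue_le_op_norm)
    also have "\<dots> \<le> K" using op_norm_le_sum[of "G n"] K[of n] by simp
    finally show ?thesis .
  qed
  then have mem: "\<forall>n. (c n, v n) \<in> cball 0 K \<times> sphere 0 1" using cv(1) by auto
  have comp: "compact (cball (0::complex) K \<times> sphere (0 :: complex^'n) 1)"
    by (intro compact_Times compact_cball compact_sphere)
  obtain l s where s: "l \<in> cball 0 K \<times> sphere (0 :: complex^'n) 1" "strict_mono s"
      "((\<lambda>n. (c n, v n)) \<circ> s) \<longlonglongrightarrow> l"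
    by (rule seq_compactE[OF compact_imp_seq_compact[OF comp], of "\<lambda>n. (c n, v n)"]) (use mem in \<open>blast+\<close>)
  obtain c0 v0 where l: "l = (c0, v0)" by (cases l)
  have c0: "(\<lambda>n. c (s n)) \<longlonglongrightarrow> c0" and v0: "(\<lambda>n. v (s n)) \<longlonglongrightarrow> v0"
    using tendsto_fst[OF s(3)] tendsto_snd[OF s(3)] by (simp_all add: l o_def)
  have Gs: "(\<lambda>n. G (s n)) \<longlonglongrightarrow> g" using LIMSEQ_subseq_LIMSEQ[OF lim s(2)] by (simp add: o_def)
  have "g *v v0 = c0 *s v0"
  proof (simp add: vec_eq_iff, intro allI)
    fix i
    have "(\<lambda>n. (G (s n) *v v (s n)) $ i) \<longlonglongrightarrow> (g *v v0) $ i"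
      unfolding matrix_vector_mult_def vec_lambda_beta by (intro tendsto_intros Gs v0)
    moreover have "(\<lambda>n. (G (s n) *v v (s n)) $ i) \<longlonglongrightarrow> c0 * v0 $ i"
      unfolding cv(2) vector_smult_component by (intro tendsto_intros c0 v0)
    ultimately show "(g *v v0) $ i = c0 * v0 $ i" by (rule LIMSEQ_unique)
  qed
  moreover have "v0 \<noteq> 0" using s(1) by (auto simp: l)
  ultimately have "Defs.eigenvalue g c0" unfolding Defs.eigenvalue_def by blast
  then have "cmod c0 \<le> spectral_radius g" by (rule eigenvalue_le_spectral_radius)
  moreover have "r \<le> cmod c0"
    using tendsto_norm[OF c0] cv(3) by (intro LIMSEQ_le_const) auto
  ultimately show "g \<in> {g. r \<le> spectral_radius g}" by simp
qed

lemma borel_measurable_spectral_radius [measurable]: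
  "spectral_radius \<in> borel_measurable (borel :: (complex^'n^'n) measure)"
  unfolding borel_measurable_iff_ge by (simp add: borel_closed closed_spectral_radius_ge)

text \<open>The deterministic core, uniform in the matrices and in the cut. In
  \<open>minor_norm_products_le\<close> the left side has rate at least
  \<open>2 p l - 2 \<delta>\<close>. Each error term has rate at most
  \<open>2 p l - \<gamma> / 3 + (p + 1) \<delta>\<close>, since its half carries at least a third of
  the length; the first condition on \<open>\<delta>\<close> places it \<open>\<gamma> / 6\<close>
  below the left side. So the trace term dominates and \<open>\<rho> ^ p\<close> has rate at least
  \<open>p l - 3 \<delta>\<close>. The second condition leaves \<open>\<epsilon> / 2\<close> to
  absorb the constants.\<close>

lemma spectral_radius_lower_bound:
  fixes l \<gamma> \<delta> \<epsilon> K :: real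
  assumes p: "p \<ge> 1" and K: "K > 0" and \<gamma>: "\<gamma> > 0" and \<epsilon>: "\<epsilon> > 0" and \<delta>: "\<delta> > 0"
    and \<delta>\<gamma>: "\<delta> * (real p + 3) \<le> \<gamma> / 6" and \<delta>\<epsilon>: "3 * \<delta> \<le> \<epsilon> / 2"
  shows "eventually (\<lambda>n. \<forall>u v. \<forall>A B :: complex^'n^'n.
      u + v = n \<longrightarrow> n \<le> 3 * u \<longrightarrow> n \<le> 3 * v
      \<longrightarrow> minor_norm p A \<le> exp (real u * (real p * l + \<delta>))
      \<longrightarrow> minor_norm p B \<le> exp (real v * (real p * l + \<delta>))
      \<longrightarrow> exp (real n * (real p * l - \<delta>)) \<le> minor_norm p (A ** B)
      \<longrightarrow> exp (real n * (real p * l - \<delta>)) \<le> minor_norm p (B ** A)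
      \<longrightarrow> op_norm A \<le> K * exp (real u * (l + \<delta>))
      \<longrightarrow> op_norm B \<le> K * exp (real v * (l + \<delta>))
      \<longrightarrow> minor_norm (Suc p) A \<le> exp (real u * ((real p + 1) * l - \<gamma>))
      \<longrightarrow> minor_norm (Suc p) B \<le> exp (real v * ((real p + 1) * l - \<gamma>))
      \<longrightarrow> exp (real n * (l - \<epsilon>)) \<le> spectral_radius (A ** B)) sequentially"
proof -
  obtain C where C: "C > 0" and main: "\<And>A B :: complex^'n^'n. minor_norm p (A ** B) * minor_norm p (B ** A)
    \<le> C * (minor_norm p A * minor_norm p B * cmod (minor_trace p (A ** B))
      + op_norm A ^ (p - 1) * minor_norm (Suc p) A * (minor_norm p B)\<^sup>2
      + (minor_norm p A)\<^sup>2 * (op_norm B ^ (p - 1) * minor_norm (Suc p) B))"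
    using minor_norm_products_le[OF p] by blast
  define C' where "C' = real (CARD('n) ^ p) * fact p"
  have C': "C' > 0" by (simp add: C'_def)
  define X where "X = K ^ (p - 1)"
  have X: "X > 0" using K by (simp add: X_def)
  have lim: "(\<lambda>n. a * exp (- (real n * b))) \<longlonglongrightarrow> 0" if "b > 0" for a b :: real
    using that by real_asymp
  \<comment> \<open>This lets the two error terms together take at most half of \<open>E\<close>;
    the next threshold makes the remaining constant smaller than the margin of rate
    \<open>\<epsilon> / 2\<close>.\<close>
  have "eventually (\<lambda>n. 4 * C * X * exp (- (real n * (\<gamma> / 6))) < 1) sequentially"
    using \<gamma> by (intro order_tendstoD(2)[OF lim]) auto
  moreover have "eventually (\<lambda>n. 2 * C * C' * exp (- (real n * (\<epsilon> / 2))) < 1) sequentially"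
    using \<epsilon> by (intro order_tendstoD(2)[OF lim]) auto
  ultimately show ?thesis
  proof eventually_elim
    case (elim n)
    show ?case
    proof (intro allI impI)
      fix u v and A B :: "complex^'n^'n"
      assume uv: "u + v = n" "n \<le> 3 * u" "n \<le> 3 * v"
        and mA: "minor_norm p A \<le> exp (real u * (real p * l + \<delta>))"
        and mB: "minor_norm p B \<le> exp (real v * (real p * l + \<delta>))"
        and mAB: "exp (real n * (real p * l - \<delta>)) \<le> minor_norm p (A ** B)"
        and mBA: "exp (real n * (real p * l - \<delta>)) \<le> minor_norm p (B ** A)"
        and oA: "op_norm A \<le> K * exp (real u * (l + \<delta>))"
        and oB: "op_norm B \<le> K * exp (real v * (l + \<delta>))"
        and sA: "minor_norm (Suc p) A \<le> exp (real u * ((real p + 1) * l - \<gamma>))"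
        and sB: "minor_norm (Suc p) B \<le> exp (real v * ((real p + 1) * l - \<gamma>))"
      define \<rho> where "\<rho> = spectral_radius (A ** B)"
      have \<rho>0: "\<rho> \<ge> 0" unfolding \<rho>_def by (metis spectral_radius_attained norm_ge_zero)
      define E where "E = exp (real n * (2 * (real p * l) - 2 * \<delta>))"
      define q where "q = exp (- (real n * (\<gamma> / 6)))"
      have E0: "E > 0" by (simp add: E_def)
      have nuv: "real n = real u + real v" using uv by simp
      \<comment> \<open>Stated for a generic half, as it serves with \<open>A\<close> and with
        \<open>B\<close> in the role of \<open>G\<close>.\<close>
      have defect: "op_norm G ^ (p - 1) * minor_norm (Suc p) G * (minor_norm p H)\<^sup>2 \<le> X * (E * q)"
        if "a + b = n" "n \<le> 3 * a"
          and oG: "op_norm G \<le> K * exp (real a * (l + \<delta>))"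
          and sG: "minor_norm (Suc p) G \<le> exp (real a * ((real p + 1) * l - \<gamma>))"
          and mH: "minor_norm p H \<le> exp (real b * (real p * l + \<delta>))"
        for a b and G H :: "complex^'n^'n"
      proof -
        have "op_norm G ^ (p - 1) * minor_norm (Suc p) G * (minor_norm p H)\<^sup>2
          \<le> (K * exp (real a * (l + \<delta>))) ^ (p - 1) * exp (real a * ((real p + 1) * l - \<gamma>))
            * (exp (real b * (real p * l + \<delta>)))\<^sup>2"
          using K by (intro mult_mono power_mono oG sG mH)
             (simp_all add: op_norm_nonneg minor_norm_nonneg)
        also have "\<dots> = X * exp ((real p - 1) * (real a * (l + \<delta>)) + real a * ((real p + 1) * l - \<gamma>)
            + 2 * (real b * (real p * l + \<delta>)))"
          using p by (simp add: X_def power_mult_distrib exp_add exp_of_nat_mult[symmetric] of_nat_diff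
              exp_double[symmetric])
        also have "\<dots> \<le> X * exp (real n * (2 * (real p * l) - 2 * \<delta>) - real n * (\<gamma> / 6))"
        proof -
          have nab: "real n = real a + real b" using that(1) by simp
          have a3: "real n \<le> 3 * real a" using that(2) by linarith
          \<comment> \<open>The terms in \<open>l\<close> add up to \<open>2 p l n\<close> however
            the length is split, so the sign of \<open>l\<close> does not matter.\<close>
          have "(real p - 1) * (real a * (l + \<delta>)) + real a * ((real p + 1) * l - \<gamma>) + 2 * (real b * (real p * l + \<delta>))
            = 2 * (real p * l) * real n - \<gamma> * real a + \<delta> * ((real p - 1) * real a + 2 * real b)"
            unfolding nab by (simp add: algebra_simps)
          moreover have "\<gamma> * (real n / 3) \<le> \<gamma> * real a" using a3 \<gamma> by (intro mult_left_mono) auto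
          moreover have "\<delta> * ((real p - 1) * real a + 2 * real b) \<le> \<delta> * ((real p + 1) * real n)"
          proof (rule mult_left_mono)
            have "(real p - 1) * real a \<le> (real p - 1) * real n" using p nab by (intro mult_left_mono) auto
            moreover have "2 * real b \<le> 2 * real n" using nab by simp
            ultimately show "(real p - 1) * real a + 2 * real b \<le> (real p + 1) * real n"
              by (simp add: algebra_simps)
          qed (use \<delta> in simp)
          moreover have "\<delta> * (real p + 3) * real n \<le> \<gamma> / 6 * real n"
            by (intro mult_right_mono \<delta>\<gamma>) simp
          ultimately have "(real p - 1) * (real a * (l + \<delta>)) + real a * ((real p + 1) * l - \<gamma>) + 2 * (real b * (real p * l + \<delta>))
            \<le> real n * (2 * (real p * l) - 2 * \<delta>) - real n * (\<gamma> / 6)"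
            by (simp add: algebra_simps)
          then show ?thesis using X by simp
        qed
        also have "\<dots> = X * (E * q)" by (simp add: E_def q_def exp_add[symmetric])
        finally show ?thesis .
      qed
      have trace: "cmod (minor_trace p (A ** B)) \<le> C' * \<rho> ^ p"
        using minor_trace_le_spectral_radius[of p "A ** B"] by (simp add: C'_def \<rho>_def mult.assoc)
      have "E = exp (real n * (real p * l - \<delta>)) * exp (real n * (real p * l - \<delta>))"
        by (simp add: E_def exp_add[symmetric] algebra_simps)
      also have "\<dots> \<le> minor_norm p (A ** B) * minor_norm p (B ** A)"
        by (intro mult_mono mAB mBA) (simp_all add: minor_norm_nonneg)
      also have "\<dots> \<le> C * (minor_norm p A * minor_norm p B * cmod (minor_trace p (A ** B))
          + op_norm A ^ (p - 1) * minor_norm (Suc p) A * (minor_norm p B)\<^sup>2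
          + (minor_norm p A)\<^sup>2 * (op_norm B ^ (p - 1) * minor_norm (Suc p) B))"
        by (rule main)
      also have "\<dots> \<le> C * (exp (real u * (real p * l + \<delta>)) * exp (real v * (real p * l + \<delta>)) * (C' * \<rho> ^ p)
          + X * (E * q) + X * (E * q))"
      proof (intro mult_left_mono add_mono)
        show "minor_norm p A * minor_norm p B * cmod (minor_trace p (A ** B))
            \<le> exp (real u * (real p * l + \<delta>)) * exp (real v * (real p * l + \<delta>)) * (C' * \<rho> ^ p)"
          by (intro mult_mono mA mB trace) (simp_all add: minor_norm_nonneg)
        show "op_norm A ^ (p - 1) * minor_norm (Suc p) A * (minor_norm p B)\<^sup>2 \<le> X * (E * q)"
          by (rule defect[OF uv(1,2) oA sA mB])
        have "v + u = n" using uv by simp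
        from defect[OF this uv(3) oB sB mA]
        show "(minor_norm p A)\<^sup>2 * (op_norm B ^ (p - 1) * minor_norm (Suc p) B) \<le> X * (E * q)"
          by (simp add: mult_ac)
      qed (use C in simp)
      also have "\<dots> = C * C' * exp (real n * (real p * l + \<delta>)) * \<rho> ^ p + (2 * C * X * q) * E"
        unfolding nuv by (simp add: exp_add[symmetric] algebra_simps)
      also have "(2 * C * X * q) * E \<le> (1 / 2) * E"
        using elim(1) E0 by (intro mult_right_mono) (simp_all add: q_def)
      finally have half: "E \<le> 2 * C * C' * exp (real n * (real p * l + \<delta>)) * \<rho> ^ p" by simp
      show "exp (real n * (l - \<epsilon>)) \<le> spectral_radius (A ** B)"
      proof (rule ccontr)
        assume "\<not> ?thesis"
        then have "\<rho> < exp (real n * (l - \<epsilon>))" by (simp add: \<rho>_def)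
        then have "\<rho> ^ p \<le> exp (real n * (l - \<epsilon>)) ^ p" using \<rho>0 by (intro power_mono) auto
        also have "\<dots> = exp (real p * (real n * (l - \<epsilon>)))" by (rule exp_of_nat_mult[symmetric])
        finally have "2 * C * C' * exp (real n * (real p * l + \<delta>)) * \<rho> ^ p
            \<le> 2 * C * C' * exp (real n * (real p * l + \<delta>)) * exp (real p * (real n * (l - \<epsilon>)))"
          using C C' by (intro mult_left_mono) auto
        with half have "E \<le> 2 * C * C' * exp (real n * (real p * l + \<delta>)) * exp (real p * (real n * (l - \<epsilon>)))"
          by linarith
        also have "\<dots> = 2 * C * C' * exp (real n * (3 * \<delta> - real p * \<epsilon>)) * E"
          unfolding E_def mult.assoc exp_add[symmetric] by (simp add: algebra_simps)
        also have "\<dots> \<le> 2 * C * C' * exp (- (real n * (\<epsilon> / 2))) * E"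
        proof -
          have "\<epsilon> \<le> real p * \<epsilon>" using p \<epsilon> by simp
          then have "3 * \<delta> - real p * \<epsilon> \<le> - (\<epsilon> / 2)" using \<delta>\<epsilon> by linarith
          then have "real n * (3 * \<delta> - real p * \<epsilon>) \<le> real n * (- (\<epsilon> / 2))" by (rule mult_left_mono) simp
          then show ?thesis using C C' E0 by (intro mult_right_mono mult_left_mono) auto
        qed
        also have "\<dots> < 1 * E" using elim(2) E0 by (rule mult_strict_right_mono)
        finally show False by simp
      qed
    qed
  qed
qed

section \<open>Kingman's theorem for ergodic systems\<close>

text \<open>Rational thresholds reduce almost sure convergence to countably many null sets.\<close>

lemma tendsto_of_rational_bounds:
  fixes f :: "nat \<Rightarrow> real"
  assumes "\<And>q. q \<in> \<rat> \<Longrightarrow> q < s \<Longrightarrow> eventually (\<lambda>n. q * real n < f n) sequentially"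
    and "\<And>q. q \<in> \<rat> \<Longrightarrow> s < q \<Longrightarrow> eventually (\<lambda>n. f n < q * real n) sequentially"
  shows "(\<lambda>n. f n / real n) \<longlonglongrightarrow> s"
proof (rule order_tendstoI)
  fix a assume "a < s"
  then obtain q where q: "q \<in> \<rat>" "a < q" "q < s" using Rats_dense_in_real by blast
  show "eventually (\<lambda>n. a < f n / real n) sequentially"
    using assms(1)[OF q(1,3)] eventually_gt_at_top[of 0]
  proof eventually_elim
    case (elim n)
    then have "q < f n / real n" by (simp add: field_simps)
    with q show ?case by simp
  qed
next
  fix a assume "s < a"
  then obtain q where q: "q \<in> \<rat>" "s < q" "q < a" using Rats_dense_in_real by blast
  show "eventually (\<lambda>n. f n / real n < a) sequentially"
    using assms(2)[OF q(1,2)] eventually_gt_at_top[of 0]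
  proof eventually_elim
    case (elim n)
    then have "f n / real n < q" by (simp add: field_simps)
    with q show ?case by simp
  qed
qed

text \<open>\<open>zero_one\<close> asks for one inclusion instead of invariance: subadditivity is
  one-sided, and the exceptional event of \<open>subadditive_liminf\<close> is only seen to contain
  its preimage.\<close>

locale ergodic_system = prob_space M for M :: "'a measure" +
  fixes T :: "'a \<Rightarrow> 'a"
  assumes T_measurable [measurable]: "T \<in> measurable M M"
    and distr_T: "distr M M T = M"
    and zero_one: "\<And>E. E \<in> sets M \<Longrightarrow> (\<And>x. x \<in> space M \<Longrightarrow> T x \<in> E \<Longrightarrow> x \<in> E)
      \<Longrightarrow> prob E = 0 \<or> prob E = 1"
begin

lemma T_space: "x \<in> space M \<Longrightarrow> (T ^^ i) x \<in> space M"
  by (induction i) (auto intro: measurable_space[OF T_measurable])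

lemma T_pow_measurable [measurable]: "T ^^ i \<in> measurable M M"
  by (induction i) auto

lemma distr_T_pow: "distr M M (T ^^ i) = M"
proof (induction i)
  case 0
  show ?case by (simp add: distr_id2 id_def)
next
  case (Suc i)
  have "distr M M (T ^^ Suc i) = distr (distr M M (T ^^ i)) M T"
    unfolding funpow.simps by (rule distr_distr[symmetric]) auto
  then show ?case by (simp only: Suc distr_T)
qed

lemma integral_T_pow:
  fixes f :: "'a \<Rightarrow> real"
  assumes [measurable]: "f \<in> borel_measurable M"
  shows "(\<integral>x. f ((T ^^ i) x) \<partial>M) = (\<integral>x. f x \<partial>M)"
proof -
  have "(\<integral>x. f x \<partial>M) = (\<integral>x. f x \<partial>(distr M M (T ^^ i)))" by (simp add: distr_T_pow)
  also have "\<dots> = (\<integral>x. f ((T ^^ i) x) \<partial>M)" by (rule integral_distr) auto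
  finally show ?thesis ..
qed

lemma integrable_T_pow:
  fixes f :: "'a \<Rightarrow> real"
  assumes "integrable M f"
  shows "integrable M (\<lambda>x. f ((T ^^ i) x))"
proof -
  have "integrable (distr M M (T ^^ i)) f" using assms by (simp add: distr_T_pow)
  then show ?thesis by (rule integrable_distr[rotated]) auto
qed

text \<open>Katznelson--Weiss covering: walking along the orbit, jump by \<open>l \<le> K\<close> whenever
  \<open>\<Phi> l \<le> c l\<close>, and otherwise move by one step and pay \<open>w\<close>. The last sum pays for a jump that
  would leave the window.\<close>

lemma subadditive_covering:
  fixes \<Phi> :: "nat \<Rightarrow> 'a \<Rightarrow> real"
  assumes sub: "\<And>m n x. x \<in> space M \<Longrightarrow> \<Phi> (m + n) x \<le> \<Phi> m x + \<Phi> n ((T ^^ m) x)"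
    and bnd: "\<And>n x. x \<in> space M \<Longrightarrow> \<Phi> n x \<le> (\<Sum>i<n. H ((T ^^ i) x))"
    and H: "\<And>x. x \<in> space M \<Longrightarrow> H x \<ge> 0"
    and x: "x \<in> space M"
    and w: "\<And>y. w y = (if \<exists>l\<in>{1..K}. \<Phi> l y \<le> c * real l then 0 else H y + \<bar>c\<bar>)"
    and "i \<le> e"
  shows "\<Phi> (e - i) ((T ^^ i) x) \<le> c * real (e - i) + (\<Sum>j=i..<e. w ((T ^^ j) x))
           + (\<Sum>j | j < e \<and> e \<le> j + K. H ((T ^^ j) x) + \<bar>c\<bar>)"
  using \<open>i \<le> e\<close>
proof (induction "e - i" arbitrary: i rule: less_induct)
  case less
  let ?R = "\<Sum>j | j < e \<and> e \<le> j + K. H ((T ^^ j) x) + \<bar>c\<bar>"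
  have wpos: "w ((T ^^ j) x) \<ge> 0" for j
    using H[OF T_space[OF x]] by (auto simp: w intro!: add_nonneg_nonneg)
  have Rpos: "?R \<ge> 0" using H[OF T_space[OF x]] by (intro sum_nonneg) auto
  have y: "(T ^^ i) x \<in> space M" by (rule T_space[OF x])
  have shift: "(T ^^ m) ((T ^^ i) x) = (T ^^ (i + m)) x" for m
    using funpow_add[of m i T] by (simp add: add.commute[of i m])
  show ?case
  proof (cases "i = e")
    case True
    then show ?thesis using bnd[OF y, of 0] Rpos by simp
  next
    case False
    with less.prems have ie: "i < e" by simp
    show ?thesis
    proof (cases "\<exists>l\<in>{1..K}. \<Phi> l ((T ^^ i) x) \<le> c * real l")
      case True
      then obtain l where l: "1 \<le> l" "l \<le> K" "\<Phi> l ((T ^^ i) x) \<le> c * real l" by auto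
      show ?thesis
      proof (cases "l \<le> e - i")
        case True
        have "\<Phi> (e - i) ((T ^^ i) x) = \<Phi> (l + (e - (i + l))) ((T ^^ i) x)"
          using True by (intro arg_cong2[where f=\<Phi>]) auto
        also have "\<dots> \<le> \<Phi> l ((T ^^ i) x) + \<Phi> (e - (i + l)) ((T ^^ (i + l)) x)"
          using sub[OF y, of l "e - (i + l)"] by (simp only: shift)
        also have "\<dots> \<le> c * real l + (c * real (e - (i + l)) + (\<Sum>j=i+l..<e. w ((T ^^ j) x)) + ?R)"
          using l True ie by (intro add_mono less.hyps) auto
        also have "(\<Sum>j=i+l..<e. w ((T ^^ j) x)) \<le> (\<Sum>j=i..<e. w ((T ^^ j) x))"
          using wpos by (intro sum_mono2) auto
        also have "c * real l + (c * real (e - (i + l)) + (\<Sum>j=i..<e. w ((T ^^ j) x)) + ?R)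
            = c * real (e - i) + (\<Sum>j=i..<e. w ((T ^^ j) x)) + ?R"
        proof -
          have "real (e - i) = real l + real (e - (i + l))" using True by simp
          then show ?thesis by (simp only: distrib_left)
        qed
        finally show ?thesis by simp
      next
        case False
        \<comment> \<open>The jump would leave the window, so fewer than \<open>K\<close> steps
          remain. The index set of the last sum contains all of them, and that sum pays for the rest
          of the walk.\<close>
        have "\<Phi> (e - i) ((T ^^ i) x) \<le> (\<Sum>m<e - i. H ((T ^^ (i + m)) x))"
          using bnd[OF y, of "e - i"] by (simp only: shift)
        also have "\<dots> = (\<Sum>j=i..<e. H ((T ^^ j) x))"
          using ie by (intro sum.reindex_bij_witness[of _ "\<lambda>j. j - i" "\<lambda>m. i + m"]) auto
        also have "\<dots> = (\<Sum>j=i..<e. (H ((T ^^ j) x) + \<bar>c\<bar>)) - real (e - i) * \<bar>c\<bar>"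
          using ie by (simp add: sum.distrib)
        also have "(\<Sum>j=i..<e. (H ((T ^^ j) x) + \<bar>c\<bar>)) \<le> ?R"
          using False l H[OF T_space[OF x]] by (intro sum_mono2) auto
        finally have *: "\<Phi> (e - i) ((T ^^ i) x) \<le> ?R - real (e - i) * \<bar>c\<bar>" by simp
        have "- (real (e - i) * \<bar>c\<bar>) \<le> c * real (e - i)"
          by (metis abs_ge_minus_self minus_le_iff minus_mult_right mult.commute mult_left_mono of_nat_0_le_iff)
        moreover have "(\<Sum>j=i..<e. w ((T ^^ j) x)) \<ge> 0" using wpos by (intro sum_nonneg) auto
        ultimately show ?thesis using * by linarith
      qed
    next
      case bad: False
      have "\<Phi> (e - i) ((T ^^ i) x) = \<Phi> (1 + (e - (i + 1))) ((T ^^ i) x)"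
        using ie by (intro arg_cong2[where f=\<Phi>]) auto
      also have "\<dots> \<le> \<Phi> 1 ((T ^^ i) x) + \<Phi> (e - (i + 1)) ((T ^^ (i + 1)) x)"
        using sub[OF y, of 1 "e - (i + 1)"] by (simp only: shift)
      also have "\<dots> \<le> H ((T ^^ i) x) + (c * real (e - (i + 1)) + (\<Sum>j=i+1..<e. w ((T ^^ j) x)) + ?R)"
        using bnd[OF y, of 1] ie by (intro add_mono less.hyps) auto
      also have "\<dots> \<le> c * real (e - i) + (H ((T ^^ i) x) + \<bar>c\<bar>) + (\<Sum>j=i+1..<e. w ((T ^^ j) x)) + ?R"
        using ie by (simp add: of_nat_diff algebra_simps)
      also have "H ((T ^^ i) x) + \<bar>c\<bar> = w ((T ^^ i) x)" using bad by (simp add: w)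
      also have "c * real (e - i) + w ((T ^^ i) x) + (\<Sum>j=i+1..<e. w ((T ^^ j) x))
          = c * real (e - i) + (\<Sum>j=i..<e. w ((T ^^ j) x))"
        using ie by (simp add: sum.atLeast_Suc_lessThan)
      finally show ?thesis by simp
    qed
  qed
qed

text \<open>Integrate the covering bound over a window of length \<open>n\<close>. The boundary sum
  has at most \<open>K\<close> terms and disappears after division by \<open>n\<close>. As
  \<open>K\<close> grows, \<open>w K\<close> tends to zero almost everywhere and is dominated by
  \<open>H x + \<bar>c\<bar>\<close>, so the cost of the single steps disappears too.\<close>

lemma subadditive_rate_le:
  fixes \<Phi> :: "nat \<Rightarrow> 'a \<Rightarrow> real"
  assumes sub: "\<And>m n x. x \<in> space M \<Longrightarrow> \<Phi> (m + n) x \<le> \<Phi> m x + \<Phi> n ((T ^^ m) x)"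
    and bnd: "\<And>n x. x \<in> space M \<Longrightarrow> \<Phi> n x \<le> (\<Sum>i<n. H ((T ^^ i) x))"
    and H: "\<And>x. x \<in> space M \<Longrightarrow> H x \<ge> 0" and iH: "integrable M H"
    and int: "\<And>n. integrable M (\<Phi> n)"
    and s: "\<And>n. s * real n \<le> (\<integral>x. \<Phi> n x \<partial>M)"
    and ae: "AE x in M. \<exists>l\<ge>1. \<Phi> l x \<le> c * real l"
  shows "s \<le> c"
proof -
  have [measurable]: "\<Phi> n \<in> borel_measurable M" for n using int by auto
  have [measurable]: "H \<in> borel_measurable M" using iH by auto
  define w where "w K y = (if \<exists>l\<in>{1..K}. \<Phi> l y \<le> c * real l then 0 else H y + \<bar>c\<bar>)" for K y
  have [measurable]: "w K \<in> borel_measurable M" for K unfolding w_def by measurable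
  have iw: "integrable M (w K)" for K
  proof (rule Bochner_Integration.integrable_bound)
    show "integrable M (\<lambda>x. H x + \<bar>c\<bar>)" using iH by auto
    show "AE x in M. norm (w K x) \<le> norm (H x + \<bar>c\<bar>)"
      by (intro AE_I2) (auto simp: w_def)
  qed auto
  define C where "C = (\<integral>x. H x + \<bar>c\<bar> \<partial>M)"
  have C0: "C \<ge> 0" unfolding C_def using H by (intro integral_nonneg_AE AE_I2) auto
  have *: "s \<le> c + (\<integral>x. w K x \<partial>M)" for K
  proof -
    have total: "s * real n \<le> c * real n + real n * (\<integral>x. w K x \<partial>M) + real K * C" for n
    proof -
      let ?J = "{j. j < n \<and> n \<le> j + K}"
      have iT: "integrable M (\<lambda>x. H ((T ^^ j) x) + \<bar>c\<bar>)" for j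
        using integrable_T_pow[OF iH] by auto
      have "?J \<subseteq> {n - K..<n}" by auto
      from card_mono[OF _ this] have card: "card ?J \<le> K" by simp
      have "(\<integral>x. \<Phi> n x \<partial>M) \<le> (\<integral>x. c * real n + (\<Sum>j=0..<n. w K ((T ^^ j) x))
           + (\<Sum>j\<in>?J. H ((T ^^ j) x) + \<bar>c\<bar>) \<partial>M)"
      proof (rule integral_mono)
        show "integrable M (\<lambda>x. c * real n + (\<Sum>j=0..<n. w K ((T ^^ j) x))
           + (\<Sum>j\<in>?J. H ((T ^^ j) x) + \<bar>c\<bar>))"
          using integrable_T_pow[OF iw] integrable_T_pow[OF iH]
          by (intro Bochner_Integration.integrable_add Bochner_Integration.integrable_sum) auto
        fix x assume "x \<in> space M"
        from subadditive_covering[OF sub bnd H this, of "w K" K c 0 n]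
        show "\<Phi> n x \<le> c * real n + (\<Sum>j=0..<n. w K ((T ^^ j) x)) + (\<Sum>j\<in>?J. H ((T ^^ j) x) + \<bar>c\<bar>)"
          by (simp add: w_def)
      qed (use int in auto)
      also have "\<dots> = c * real n + (\<Sum>j=0..<n. \<integral>x. w K ((T ^^ j) x) \<partial>M) + (\<Sum>j\<in>?J. \<integral>x. H ((T ^^ j) x) + \<bar>c\<bar> \<partial>M)"
        using integrable_T_pow[OF iw] integrable_T_pow[OF iH]
        by (simp add: prob_space)
      also have "\<dots> = c * real n + real n * (\<integral>x. w K x \<partial>M) + real (card ?J) * C"
      proof -
        have "(\<integral>x. H ((T ^^ j) x) + \<bar>c\<bar> \<partial>M) = C" for j
          unfolding C_def by (rule integral_T_pow[of "\<lambda>x. H x + \<bar>c\<bar>"]) simp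
        then show ?thesis by (simp add: integral_T_pow)
      qed
      also have "\<dots> \<le> c * real n + real n * (\<integral>x. w K x \<partial>M) + real K * C"
        using card C0 by (intro add_left_mono mult_right_mono) auto
      finally show ?thesis using s[of n] by simp
    qed
    have "s \<le> c + (\<integral>x. w K x \<partial>M) + real K * C / real (Suc n)" for n
      using total[of "Suc n"] by (simp add: field_simps del: of_nat_Suc)
    moreover have "(\<lambda>n. c + (\<integral>x. w K x \<partial>M) + real K * C / real (Suc n)) \<longlonglongrightarrow> c + (\<integral>x. w K x \<partial>M) + 0"
      by (intro tendsto_intros LIMSEQ_Suc[OF lim_const_over_n])
    ultimately show ?thesis by (intro LIMSEQ_le_const) auto
  qed
  have "(\<lambda>K. \<integral>x. w K x \<partial>M) \<longlonglongrightarrow> (\<integral>x. 0 \<partial>M)"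
  proof (rule integral_dominated_convergence[where w="\<lambda>x. H x + \<bar>c\<bar>"])
    show "AE x in M. (\<lambda>K. w K x) \<longlonglongrightarrow> 0"
      using ae
    proof eventually_elim
      case (elim x)
      then obtain l where l: "l \<ge> 1" "\<Phi> l x \<le> c * real l" by auto
      have "eventually (\<lambda>K. w K x = 0) sequentially"
        using eventually_ge_at_top[of l] by eventually_elim (use l in \<open>auto simp: w_def\<close>)
      then show ?case by (rule tendsto_eventually)
    qed
    show "AE x in M. norm (w K x) \<le> H x + \<bar>c\<bar>" for K
      using H by (intro AE_I2) (auto simp: w_def)
  qed (use iH in auto)
  then have "(\<lambda>K. c + (\<integral>x. w K x \<partial>M)) \<longlonglongrightarrow> c + 0" by (intro tendsto_intros) simp
  then show ?thesis using * LIMSEQ_le_const by fastforce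
qed

text \<open>The event that the liminf lies below \<open>d\<close> obeys the zero-one law. If it had
  probability one, almost every point would admit some \<open>l\<close> with
  \<open>\<Phi> l x \<le> d * l\<close>, and \<open>subadditive_rate_le\<close> would give
  \<open>s \<le> d\<close>.\<close>

lemma subadditive_liminf:
  fixes \<Phi> :: "nat \<Rightarrow> 'a \<Rightarrow> real"
  assumes sub: "\<And>m n x. x \<in> space M \<Longrightarrow> \<Phi> (m + n) x \<le> \<Phi> m x + \<Phi> n ((T ^^ m) x)"
    and bnd: "\<And>n x. x \<in> space M \<Longrightarrow> \<Phi> n x \<le> (\<Sum>i<n. H ((T ^^ i) x))"
    and H: "\<And>x. x \<in> space M \<Longrightarrow> H x \<ge> 0" and iH: "integrable M H"
    and int: "\<And>n. integrable M (\<Phi> n)"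
    and s: "\<And>n. s * real n \<le> (\<integral>x. \<Phi> n x \<partial>M)"
    and c: "c < s"
  shows "AE x in M. eventually (\<lambda>n. c * real n < \<Phi> n x) sequentially"
proof -
  have [measurable]: "\<Phi> n \<in> borel_measurable M" for n using int by auto
  define d where "d = (c + s) / 2"
  \<comment> \<open>The margin \<open>1 / Suc j\<close> leaves room: prepending one step costs at
    most \<open>H x\<close>, which is absorbed by passing from \<open>j\<close> to
    \<open>Suc j\<close>.\<close>
  define E where "E = {x \<in> space M. \<exists>j. \<exists>\<^sub>F n in sequentially. \<Phi> n x \<le> (d - 1 / real (Suc j)) * real n}"
  have E[measurable]: "E \<in> sets M"
    unfolding E_def frequently_sequentially by measurable
  have "prob E = 0 \<or> prob E = 1"
  proof (rule zero_one[OF E])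
    fix x assume x: "x \<in> space M" and TE: "T x \<in> E"
    then obtain j where j: "\<exists>\<^sub>F n in sequentially. \<Phi> n (T x) \<le> (d - 1 / real (Suc j)) * real n"
      by (auto simp: E_def)
    define a where "a = d - 1 / real (Suc j)"
    define b where "b = d - 1 / real (Suc (Suc j))"
    have ab: "a < b" unfolding a_def b_def by (simp add: field_simps)
    have "eventually (\<lambda>n. (H x - b) / (b - a) \<le> real n) sequentially"
      using filterlim_real_sequentially by (simp add: filterlim_at_top)
    then have ev: "eventually (\<lambda>n. H x \<le> (b - a) * real n + b) sequentially"
      by eventually_elim (use ab in \<open>simp add: field_simps\<close>)
    have "\<exists>\<^sub>F n in sequentially. \<Phi> (Suc n) x \<le> b * real (Suc n)"
      using frequently_eventually_frequently[OF j ev]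
    proof (rule frequently_elim1)
      fix n assume n: "\<Phi> n (T x) \<le> (d - 1 / real (Suc j)) * real n \<and> H x \<le> (b - a) * real n + b"
      have "\<Phi> (Suc n) x \<le> \<Phi> 1 x + \<Phi> n (T x)" using sub[OF x, of 1 n] by simp
      also have "\<dots> \<le> H x + a * real n" using n bnd[OF x, of 1] by (auto simp: a_def)
      also have "\<dots> \<le> b * real (Suc n)" using n by (simp add: algebra_simps)
      finally show "\<Phi> (Suc n) x \<le> b * real (Suc n)" .
    qed
    then have "\<exists>\<^sub>F n in sequentially. \<Phi> n x \<le> b * real n"
      unfolding frequently_def by (simp add: eventually_sequentially_Suc[of "\<lambda>n. \<not> \<Phi> n x \<le> b * real n"] del: of_nat_Suc)
    then show "x \<in> E" using x unfolding E_def b_def by blast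
  qed
  moreover have "prob E \<noteq> 1"
  proof
    assume "prob E = 1"
    then have "AE x in M. x \<in> E" by (subst AE_in_set_eq_1) auto
    then have "AE x in M. \<exists>l\<ge>1. \<Phi> l x \<le> d * real l"
    proof eventually_elim
      case (elim x)
      then obtain j where "\<exists>\<^sub>F n in sequentially. \<Phi> n x \<le> (d - 1 / real (Suc j)) * real n"
        by (auto simp: E_def)
      from frequently_eventually_frequently[OF this eventually_ge_at_top[of 1]]
      obtain n where n: "n \<ge> 1" "\<Phi> n x \<le> (d - 1 / real (Suc j)) * real n"
        by (auto dest: frequently_ex)
      have "(d - 1 / real (Suc j)) * real n \<le> d * real n" by (intro mult_right_mono) auto
      with n show ?case by (meson order_trans)
    qed
    from subadditive_rate_le[OF sub bnd H iH int s this] c show False by (simp add: d_def)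
  qed
  ultimately have "prob E = 0" by simp
  then have "AE x in M. x \<notin> E" by (simp add: prob_eq_0)
  then show ?thesis
  proof (rule AE_mp[OF _ AE_I2], intro impI)
    fix x assume x: "x \<in> space M" and "x \<notin> E"
    then have *: "eventually (\<lambda>n. \<not> \<Phi> n x \<le> (d - 1 / real (Suc j)) * real n) sequentially" for j
      by (auto simp: E_def frequently_def)
    have "d - c > 0" using c by (simp add: d_def)
    then obtain j where j: "1 / real (Suc j) < d - c" using nat_approx_posE by metis
    show "eventually (\<lambda>n. c * real n < \<Phi> n x) sequentially"
      using *[of j]
    proof eventually_elim
      case (elim n)
      have "c * real n \<le> (d - 1 / real (Suc j)) * real n" using j by (intro mult_right_mono) auto
      with elim show ?case by simp
    qed
  qed
qed

lemma AE_rational_ball: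
  assumes "\<And>q::real. q \<in> \<rat> \<Longrightarrow> Q q \<Longrightarrow> AE x in M. P q x"
  shows "AE x in M. \<forall>q\<in>\<rat>. Q q \<longrightarrow> P q x"
  using assms by (subst AE_ball_countable) (auto simp: countable_rat)

text \<open>Birkhoff sums are additive, so \<open>subadditive_liminf\<close> applies to both
  \<open>g\<close> and \<open>- g\<close>. The limsup half of Kingman's theorem relies on
  this.\<close>

theorem birkhoff:
  fixes g :: "'a \<Rightarrow> real"
  assumes g: "integrable M g"
  shows "AE x in M. (\<lambda>n. (\<Sum>i<n. g ((T ^^ i) x)) / real n) \<longlonglongrightarrow> (\<integral>x. g x \<partial>M)"
proof -
  have lower: "AE x in M. eventually (\<lambda>n. c * real n < (\<Sum>i<n. g ((T ^^ i) x))) sequentially"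
    if g: "integrable M g" and "c < (\<integral>x. g x \<partial>M)" for g and c
  proof (rule subadditive_liminf[where H="\<lambda>x. \<bar>g x\<bar>" and s="\<integral>x. g x \<partial>M"])
    show "(\<Sum>i<m + n. g ((T ^^ i) x)) \<le> (\<Sum>i<m. g ((T ^^ i) x)) + (\<Sum>i<n. g ((T ^^ i) ((T ^^ m) x)))" for m n x
    proof -
      have "(\<Sum>i<m + n. g ((T ^^ i) x)) = (\<Sum>i<m. g ((T ^^ i) x)) + (\<Sum>i<n. g ((T ^^ (m + i)) x))"
        by (induction n) auto
      then show ?thesis by (simp add: funpow_add add.commute[of m])
    qed
    show "integrable M (\<lambda>x. \<Sum>i<n. g ((T ^^ i) x))" for n
      using integrable_T_pow[OF g] by auto
    show "(\<integral>x. g x \<partial>M) * real n \<le> (\<integral>x. (\<Sum>i<n. g ((T ^^ i) x)) \<partial>M)" for n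
      using g integrable_T_pow[OF g] by (simp add: integral_T_pow)
  qed (use that in \<open>auto intro: sum_mono\<close>)
  have "AE x in M. \<forall>q\<in>\<rat>. q < (\<integral>x. g x \<partial>M) \<longrightarrow> eventually (\<lambda>n. q * real n < (\<Sum>i<n. g ((T ^^ i) x))) sequentially"
    by (rule AE_rational_ball) (rule lower[OF g])
  moreover have "AE x in M. \<forall>q\<in>\<rat>. (\<integral>x. g x \<partial>M) < q \<longrightarrow> eventually (\<lambda>n. (\<Sum>i<n. g ((T ^^ i) x)) < q * real n) sequentially"
  proof (rule AE_rational_ball)
    fix q :: real assume "(\<integral>x. g x \<partial>M) < q"
    then show "AE x in M. eventually (\<lambda>n. (\<Sum>i<n. g ((T ^^ i) x)) < q * real n) sequentially"
      using lower[of "\<lambda>x. - g x" "- q"] g by (simp add: sum_negf)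
  qed
  ultimately show ?thesis
    by eventually_elim (intro tendsto_of_rational_bounds, auto)
qed

text \<open>Scheffe's argument: the negative part of \<open>G n - c\<close> lies between
  \<open>0\<close> and \<open>c\<close>, so its mean tends to zero by dominated convergence; as the
  mean of \<open>G n\<close> is at most \<open>c\<close>, the positive part cannot have a larger
  mean.\<close>

lemma mean_convergence_of_nonneg:
  fixes G :: "nat \<Rightarrow> 'a \<Rightarrow> real"
  assumes int: "\<And>n. integrable M (G n)"
    and nn: "\<And>n. AE x in M. 0 \<le> G n x"
    and lim: "AE x in M. (\<lambda>n. G n x) \<longlonglongrightarrow> c"
    and le: "\<And>n. n \<ge> 1 \<Longrightarrow> (\<integral>x. G n x \<partial>M) \<le> c"
  shows "(\<lambda>n. \<integral>x. \<bar>G n x - c\<bar> \<partial>M) \<longlonglongrightarrow> 0"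
proof -
  have [measurable]: "G n \<in> borel_measurable M" for n using int by auto
  have c: "c \<ge> 0"
    using le[of 1] integral_nonneg_AE[OF nn[of 1]] by simp
  have "(\<lambda>n. \<integral>x. max 0 (c - G n x) \<partial>M) \<longlonglongrightarrow> (\<integral>x. 0 \<partial>M)"
  proof (rule integral_dominated_convergence[where w="\<lambda>_. c"])
    show "AE x in M. (\<lambda>n. max 0 (c - G n x)) \<longlonglongrightarrow> 0"
      using lim
    proof eventually_elim
      case (elim x)
      have "(\<lambda>n. max 0 (c - G n x)) \<longlonglongrightarrow> max 0 (c - c)" by (intro tendsto_intros elim)
      then show ?case by simp
    qed
    show "AE x in M. norm (max 0 (c - G n x)) \<le> c" for n
      using nn[of n] by eventually_elim (use c in auto)
  qed auto
  then have *: "(\<lambda>n. 2 * (\<integral>x. max 0 (c - G n x) \<partial>M)) \<longlonglongrightarrow> 0"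
    using tendsto_mult_right_zero by fastforce
  show ?thesis
  proof (rule tendsto_sandwich[OF _ _ tendsto_const *])
    show "eventually (\<lambda>n. (\<integral>x. \<bar>G n x - c\<bar> \<partial>M) \<le> 2 * (\<integral>x. max 0 (c - G n x) \<partial>M)) sequentially"
      using eventually_ge_at_top[of 1]
    proof eventually_elim
      case (elim n)
      have i: "integrable M (\<lambda>x. max 0 (c - G n x))" using int[of n] by auto
      have "(\<integral>x. \<bar>G n x - c\<bar> \<partial>M) = (\<integral>x. 2 * max 0 (c - G n x) + (G n x - c) \<partial>M)"
        by (intro Bochner_Integration.integral_cong) (auto simp: max_def abs_if)
      also have "\<dots> = 2 * (\<integral>x. max 0 (c - G n x) \<partial>M) + ((\<integral>x. G n x \<partial>M) - c)"
        using int[of n] i by (simp add: prob_space)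
      finally show ?case using le[OF elim] by simp
    qed
  qed auto
qed

lemma birkhoff_mean:
  fixes g :: "'a \<Rightarrow> real"
  assumes g: "integrable M g" and nn: "\<And>x. x \<in> space M \<Longrightarrow> g x \<ge> 0"
  shows "(\<lambda>n. \<integral>x. \<bar>(\<Sum>i<n. g ((T ^^ i) x)) / real n - (\<integral>x. g x \<partial>M)\<bar> \<partial>M) \<longlonglongrightarrow> 0"
proof (rule mean_convergence_of_nonneg[OF _ _ birkhoff[OF g]])
  show "integrable M (\<lambda>x. (\<Sum>i<n. g ((T ^^ i) x)) / real n)" for n
    using integrable_T_pow[OF g] by auto
  show "AE x in M. 0 \<le> (\<Sum>i<n. g ((T ^^ i) x)) / real n" for n
    using nn[OF T_space] by (auto intro!: AE_I2 divide_nonneg_nonneg sum_nonneg)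
  show "(\<integral>x. (\<Sum>i<n. g ((T ^^ i) x)) / real n \<partial>M) \<le> (\<integral>x. g x \<partial>M)" if "n \<ge> 1" for n
    using that g integrable_T_pow[OF g] by (simp add: integral_T_pow)
qed

text \<open>Averaging the decomposition into blocks of length \<open>k\<close> over all \<open>k\<close> starting points
  turns the block sums into a Birkhoff sum.\<close>

lemma subadditive_block_average:
  fixes \<Phi> :: "nat \<Rightarrow> 'a \<Rightarrow> real"
  assumes sub: "\<And>m n x. x \<in> space M \<Longrightarrow> \<Phi> (m + n) x \<le> \<Phi> m x + \<Phi> n ((T ^^ m) x)"
    and bnd: "\<And>n x. x \<in> space M \<Longrightarrow> \<Phi> n x \<le> (\<Sum>i<n. H ((T ^^ i) x))"
    and H: "\<And>x. x \<in> space M \<Longrightarrow> H x \<ge> 0"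
    and x: "x \<in> space M" and e: "k \<le> e"
  shows "real k * \<Phi> e x \<le> (\<Sum>i<Suc (e - k). \<Phi> k ((T ^^ i) x))
           + real k * ((\<Sum>i<k. H ((T ^^ i) x)) + ((\<Sum>i<e. H ((T ^^ i) x)) - (\<Sum>i<Suc e - k. H ((T ^^ i) x))))"
proof -
  have y: "(T ^^ i) x \<in> space M" for i by (rule T_space[OF x])
  have shift: "(T ^^ m) ((T ^^ i) x) = (T ^^ (i + m)) x" for m i
    using funpow_add[of m i T] by (simp add: add.commute[of i m])
  define a where "a i = \<Phi> (e - i) ((T ^^ i) x)" for i
  define S where "S n = (\<Sum>i<n. H ((T ^^ i) x))" for n
  have S_mono: "S m \<le> S n" if "m \<le> n" for m n
    unfolding S_def using that H[OF y] by (intro sum_mono2) auto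
  have tail: "a i \<le> S e - S i" if "i \<le> e" for i
  proof -
    have "a i \<le> (\<Sum>m<e - i. H ((T ^^ (i + m)) x))"
      unfolding a_def using bnd[OF y, of "e - i" i] by (simp only: shift)
    also have "\<dots> = S e - S i"
    proof -
      have "S (i + n) = S i + (\<Sum>m<n. H ((T ^^ (i + m)) x))" for n
        by (induction n) (auto simp: S_def)
      from this[of "e - i"] that show ?thesis by simp
    qed
    finally show ?thesis .
  qed
  have step: "a i \<le> \<Phi> k ((T ^^ i) x) + a (i + k)" if "i \<le> e - k" for i
  proof -
    have "a i = \<Phi> (k + (e - (i + k))) ((T ^^ i) x)"
      unfolding a_def using that e by (intro arg_cong2[where f=\<Phi>]) auto
    also have "\<dots> \<le> \<Phi> k ((T ^^ i) x) + a (i + k)"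
      unfolding a_def using sub[OF y, of k "e - (i + k)" i] by (simp only: shift)
    finally show ?thesis .
  qed
  have start: "a 0 \<le> S i + a i" if "i \<le> e" for i
  proof -
    have "a 0 = \<Phi> (i + (e - i)) x" unfolding a_def using that by simp
    also have "\<dots> \<le> \<Phi> i x + a i" unfolding a_def by (rule sub[OF x])
    also have "\<Phi> i x \<le> S i" unfolding S_def by (rule bnd[OF x])
    finally show ?thesis by simp
  qed
  have split: "(\<Sum>i<Suc (e - k). a i) + (\<Sum>i=Suc (e - k)..e. a i) = (\<Sum>i<k. a i) + (\<Sum>i=k..e. a i)"
  proof -
    have "{..e} = {..<Suc (e - k)} \<union> {Suc (e - k)..e}" "{..e} = {..<k} \<union> {k..e}"
      using e by auto
    then show ?thesis
      by (metis (no_types, lifting) finite_atLeastAtMost finite_lessThan ivl_disj_int_one(4)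
          ivl_disj_int_one(2) sum.union_disjoint ivl_disj_int_one(5) Int_commute ivl_disj_int_two(7)
          atLeastAtMost_iff disjoint_iff lessThan_iff not_less)
  qed
  \<comment> \<open>Summed over all positions, \<open>step\<close> leaves the first \<open>k\<close>
    values of \<open>a\<close> on the left and the last \<open>k\<close> on the right once the
    common terms cancel.\<close>
  have "(\<Sum>i<Suc (e - k). a i) \<le> (\<Sum>i<Suc (e - k). \<Phi> k ((T ^^ i) x) + a (i + k))"
    using step by (intro sum_mono) auto
  also have "\<dots> = (\<Sum>i<Suc (e - k). \<Phi> k ((T ^^ i) x)) + (\<Sum>i<Suc (e - k). a (i + k))"
    by (simp add: sum.distrib)
  also have "(\<Sum>i<Suc (e - k). a (i + k)) = (\<Sum>i=k..e. a i)"
    using e by (intro sum.reindex_bij_witness[of _ "\<lambda>i. i - k" "\<lambda>i. i + k"]) auto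
  finally have 1: "(\<Sum>i<k. a i) \<le> (\<Sum>i<Suc (e - k). \<Phi> k ((T ^^ i) x)) + (\<Sum>i=Suc (e - k)..e. a i)"
    using split by linarith
  have "(\<Sum>i=Suc (e - k)..e. a i) \<le> (\<Sum>i=Suc (e - k)..e. S e - S (Suc e - k))"
  proof (rule sum_mono)
    fix i assume i: "i \<in> {Suc (e - k)..e}"
    then have "S (Suc e - k) \<le> S i" using e by (intro S_mono) auto
    then show "a i \<le> S e - S (Suc e - k)" using tail[of i] i by auto
  qed
  also have "\<dots> = real k * (S e - S (Suc e - k))" using e by simp
  finally have 2: "(\<Sum>i=Suc (e - k)..e. a i) \<le> real k * (S e - S (Suc e - k))" .
  have "real k * a 0 = (\<Sum>i<k. a 0)" by simp
  also have "\<dots> \<le> (\<Sum>i<k. S k + a i)"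
  proof (rule sum_mono)
    fix i assume "i \<in> {..<k}"
    then show "a 0 \<le> S k + a i" using start[of i] S_mono[of i k] e by auto
  qed
  also have "\<dots> = real k * S k + (\<Sum>i<k. a i)" by (simp add: sum.distrib)
  finally have "real k * a 0 \<le> (\<Sum>i<Suc (e - k). \<Phi> k ((T ^^ i) x)) + real k * (S k + (S e - S (Suc e - k)))"
    using 1 2 by (simp add: algebra_simps)
  then show ?thesis by (simp add: a_def S_def)
qed

text \<open>In \<open>subadditive_block_average\<close> the block sums form a Birkhoff sum of
  \<open>\<Phi> k\<close>. The sum of \<open>H\<close> over the last few indices is negligible,
  being the difference of two Birkhoff sums with the same asymptotics.\<close>

lemma subadditive_limsup:
  fixes \<Phi> :: "nat \<Rightarrow> 'a \<Rightarrow> real"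
  assumes sub: "\<And>m n x. x \<in> space M \<Longrightarrow> \<Phi> (m + n) x \<le> \<Phi> m x + \<Phi> n ((T ^^ m) x)"
    and bnd: "\<And>n x. x \<in> space M \<Longrightarrow> \<Phi> n x \<le> (\<Sum>i<n. H ((T ^^ i) x))"
    and H: "\<And>x. x \<in> space M \<Longrightarrow> H x \<ge> 0" and iH: "integrable M H"
    and int: "\<And>n. integrable M (\<Phi> n)"
    and k: "k \<ge> 1" and q: "(\<integral>x. \<Phi> k x \<partial>M) < q * real k"
  shows "AE x in M. eventually (\<lambda>n. \<Phi> n x < q * real n) sequentially"
  using birkhoff[OF iH] birkhoff[OF int[of k]] AE_space
proof eventually_elim
  case (elim x)
  define S where "S n = (\<Sum>i<n. H ((T ^^ i) x))" for n
  define P where "P n = (\<Sum>i<n. \<Phi> k ((T ^^ i) x))" for n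
  have S: "(\<lambda>n. S n / real n) \<longlonglongrightarrow> (\<integral>x. H x \<partial>M)" using elim by (simp add: S_def)
  have P: "(\<lambda>n. P n / real n) \<longlonglongrightarrow> (\<integral>x. \<Phi> k x \<partial>M)" using elim by (simp add: P_def)
  have ratio: "(\<lambda>n. real (n + 1) / real (n + k)) \<longlonglongrightarrow> 1"
    by real_asymp
  have shifted: "(\<lambda>n. f (Suc n) / real (n + k)) \<longlonglongrightarrow> l" if "(\<lambda>n. f n / real n) \<longlonglongrightarrow> l" for f :: "nat \<Rightarrow> real" and l
  proof -
    have "(\<lambda>n. f (Suc n) / real (Suc n) * (real (n + 1) / real (n + k))) \<longlonglongrightarrow> l * 1"
      by (intro tendsto_mult ratio LIMSEQ_Suc[OF that])
    then show ?thesis by simp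
  qed
  \<comment> \<open>The time is written as \<open>n + k\<close>, so that the truncated differences
    disappear.\<close>
  define B where "B n = P (Suc n) / real (n + k) + real k * (S k / real (n + k) + (S (n + k) / real (n + k) - S (Suc n) / real (n + k)))" for n
  have "(\<lambda>n. S k / real (n + k)) \<longlonglongrightarrow> 0" by real_asymp
  then have "B \<longlonglongrightarrow> (\<integral>x. \<Phi> k x \<partial>M) + real k * (0 + ((\<integral>x. H x \<partial>M) - (\<integral>x. H x \<partial>M)))"
    unfolding B_def by (intro tendsto_intros shifted P S LIMSEQ_ignore_initial_segment[OF S])
  then have "B \<longlonglongrightarrow> (\<integral>x. \<Phi> k x \<partial>M)" by simp
  then have "eventually (\<lambda>n. B n < q * real k) sequentially" using q by (rule order_tendstoD)
  then have "eventually (\<lambda>n. \<Phi> (n + k) x < q * real (n + k)) sequentially"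
  proof eventually_elim
    case n: (elim n)
    have pos: "real (n + k) > 0" using k by simp
    have "real k * \<Phi> (n + k) x \<le> P (Suc n) + real k * (S k + (S (n + k) - S (Suc n)))"
      using subadditive_block_average[OF sub bnd H, of x k "n + k"] elim
      by (simp add: P_def S_def)
    also have "\<dots> = B n * real (n + k)" using pos by (simp add: B_def field_simps del: of_nat_add)
    also have "\<dots> < q * real k * real (n + k)" using n pos by (rule mult_strict_right_mono)
    finally have "real k * \<Phi> (n + k) x < real k * (q * real (n + k))" by (simp add: mult_ac)
    then show ?case using k by simp
  qed
  then show ?case by (rule eventually_sequentially_seg[THEN iffD1])
qed

text \<open>The rate is the infimum of the normalized means, which \<open>H\<close> keeps finite.
  For convergence in mean, the Birkhoff averages of \<open>H\<close> minus
  \<open>\<Phi> n x / n\<close> are nonnegative with mean at most their limit, so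
  \<open>mean_convergence_of_nonneg\<close> applies; \<open>birkhoff_mean\<close> then removes the
  averages of \<open>H\<close>.\<close>

theorem kingman:
  fixes \<Phi> :: "nat \<Rightarrow> 'a \<Rightarrow> real"
  assumes sub: "\<And>m n x. x \<in> space M \<Longrightarrow> \<Phi> (m + n) x \<le> \<Phi> m x + \<Phi> n ((T ^^ m) x)"
    and bnd: "\<And>n x. x \<in> space M \<Longrightarrow> \<bar>\<Phi> n x\<bar> \<le> (\<Sum>i<n. H ((T ^^ i) x))"
    and H: "\<And>x. x \<in> space M \<Longrightarrow> H x \<ge> 0" and iH: "integrable M H"
    and meas [measurable]: "\<And>n. \<Phi> n \<in> borel_measurable M"
  obtains s where "AE x in M. (\<lambda>n. \<Phi> n x / real n) \<longlonglongrightarrow> s"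
    and "(\<lambda>n. \<integral>x. \<bar>\<Phi> n x / real n - s\<bar> \<partial>M) \<longlonglongrightarrow> 0"
proof -
  let ?h = "\<integral>x. H x \<partial>M"
  have bnd': "\<Phi> n x \<le> (\<Sum>i<n. H ((T ^^ i) x))" if "x \<in> space M" for n x
    using bnd[OF that, of n] by simp
  have iS: "integrable M (\<lambda>x. \<Sum>i<n. H ((T ^^ i) x))" for n
    using integrable_T_pow[OF iH] by auto
  have ES: "(\<integral>x. (\<Sum>i<n. H ((T ^^ i) x)) \<partial>M) = real n * ?h" for n
    using integrable_T_pow[OF iH] iH by (simp add: integral_T_pow)
  have int: "integrable M (\<Phi> n)" for n
    by (rule Bochner_Integration.integrable_bound[OF iS[of n]])
       (use bnd in \<open>auto intro!: AE_I2 intro: order_trans[OF _ abs_ge_self]\<close>)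
  define s where "s = (INF n\<in>{1..}. (\<integral>x. \<Phi> n x \<partial>M) / real n)"
  have lower: "- ?h \<le> (\<integral>x. \<Phi> n x \<partial>M) / real n" if "n \<ge> 1" for n
  proof -
    have "(\<integral>x. - (\<Sum>i<n. H ((T ^^ i) x)) \<partial>M) \<le> (\<integral>x. \<Phi> n x \<partial>M)"
    proof (rule integral_mono[OF _ int])
      show "- (\<Sum>i<n. H ((T ^^ i) x)) \<le> \<Phi> n x" if "x \<in> space M" for x
        using bnd[OF that, of n] by linarith
    qed (use iS[of n] in auto)
    then show ?thesis using that by (simp add: ES field_simps)
  qed
  have s: "s * real n \<le> (\<integral>x. \<Phi> n x \<partial>M)" for n
  proof (cases "n = 0")
    case True
    have "(\<integral>x. \<Phi> 0 x \<partial>M) = (\<integral>x. 0 \<partial>M)"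
      using bnd[of _ 0] by (intro Bochner_Integration.integral_cong) auto
    then show ?thesis using True by simp
  next
    case False
    have "s \<le> (\<integral>x. \<Phi> n x \<partial>M) / real n"
      unfolding s_def using False lower by (intro cINF_lower bdd_belowI2) auto
    then show ?thesis using False by (simp add: field_simps)
  qed
  have "AE x in M. \<forall>q\<in>\<rat>. q < s \<longrightarrow> eventually (\<lambda>n. q * real n < \<Phi> n x) sequentially"
    by (rule AE_rational_ball) (rule subadditive_liminf[OF sub bnd' H iH int s])
  moreover have "AE x in M. \<forall>q\<in>\<rat>. s < q \<longrightarrow> eventually (\<lambda>n. \<Phi> n x < q * real n) sequentially"
  proof (rule AE_rational_ball)
    fix q :: real assume "s < q"
    then obtain k :: nat where k: "k \<ge> 1" "(\<integral>x. \<Phi> k x \<partial>M) / real k < q"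
      unfolding s_def using lower by (subst (asm) cINF_less_iff) (auto intro!: bdd_belowI2)
    then have "(\<integral>x. \<Phi> k x \<partial>M) < q * real k" by (simp add: field_simps)
    from subadditive_limsup[OF sub bnd' H iH int k(1) this]
    show "AE x in M. eventually (\<lambda>n. \<Phi> n x < q * real n) sequentially" .
  qed
  ultimately have ae: "AE x in M. (\<lambda>n. \<Phi> n x / real n) \<longlonglongrightarrow> s"
    by eventually_elim (intro tendsto_of_rational_bounds, auto)
  define G where "G n x = (\<Sum>i<n. H ((T ^^ i) x)) / real n - \<Phi> n x / real n" for n x
  have "(\<lambda>n. \<integral>x. \<bar>G n x - (?h - s)\<bar> \<partial>M) \<longlonglongrightarrow> 0"
  proof (rule mean_convergence_of_nonneg)
    show "integrable M (G n)" for n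
      unfolding G_def using iS int by (intro Bochner_Integration.integrable_diff) auto
    show "AE x in M. 0 \<le> G n x" for n
      by (intro AE_I2) (auto simp: G_def intro!: divide_right_mono bnd')
    show "AE x in M. (\<lambda>n. G n x) \<longlonglongrightarrow> ?h - s"
      using birkhoff[OF iH] ae by eventually_elim (unfold G_def, intro tendsto_intros)
    show "(\<integral>x. G n x \<partial>M) \<le> ?h - s" if "n \<ge> 1" for n
      unfolding G_def using that s[of n] iS int by (simp add: ES field_simps)
  qed
  from tendsto_add[OF this birkhoff_mean[OF iH H]]
  have sum: "(\<lambda>n. (\<integral>x. \<bar>G n x - (?h - s)\<bar> \<partial>M) + (\<integral>x. \<bar>(\<Sum>i<n. H ((T ^^ i) x)) / real n - ?h\<bar> \<partial>M)) \<longlonglongrightarrow> 0"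
    by simp
  have "(\<lambda>n. \<integral>x. \<bar>\<Phi> n x / real n - s\<bar> \<partial>M) \<longlonglongrightarrow> 0"
  proof (rule tendsto_sandwich[OF _ _ tendsto_const sum])
    show "eventually (\<lambda>n. (\<integral>x. \<bar>\<Phi> n x / real n - s\<bar> \<partial>M) \<le> (\<integral>x. \<bar>G n x - (?h - s)\<bar> \<partial>M)
        + (\<integral>x. \<bar>(\<Sum>i<n. H ((T ^^ i) x)) / real n - ?h\<bar> \<partial>M)) sequentially"
    proof (intro always_eventually allI)
      fix n
      have iG: "integrable M (G n)" 
        unfolding G_def using iS int by (intro Bochner_Integration.integrable_diff) auto
      have "(\<integral>x. \<bar>\<Phi> n x / real n - s\<bar> \<partial>M) \<le> (\<integral>x. \<bar>G n x - (?h - s)\<bar> + \<bar>(\<Sum>i<n. H ((T ^^ i) x)) / real n - ?h\<bar> \<partial>M)"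
        using iG iS int by (intro integral_mono) (auto simp: G_def)
      also have "\<dots> = (\<integral>x. \<bar>G n x - (?h - s)\<bar> \<partial>M) + (\<integral>x. \<bar>(\<Sum>i<n. H ((T ^^ i) x)) / real n - ?h\<bar> \<partial>M)"
        using iG iS by (intro Bochner_Integration.integral_add) auto
      finally show "(\<integral>x. \<bar>\<Phi> n x / real n - s\<bar> \<partial>M) \<le> \<dots>" .
    qed
  qed (auto intro!: always_eventually)
  with ae show ?thesis by (rule that)
qed

end

section \<open>The shift on independent sequences\<close>

text \<open>Serves for the shift, for the later block of a product and for the exchange of its two
  blocks.\<close>

lemma distr_PiM_UNIV_inj:
  assumes "prob_space \<mu>" and f: "inj (f :: nat \<Rightarrow> nat)"
  shows "distr (\<Pi>\<^sub>M i\<in>UNIV. \<mu>) (\<Pi>\<^sub>M i\<in>UNIV. \<mu>) (\<lambda>x i. x (f i)) = (\<Pi>\<^sub>M i\<in>UNIV. \<mu>)"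
  using distr_PiM_reindex[of UNIV "\<lambda>_. \<mu>" f UNIV] assms by (simp add: restrict_def)

lemma funpow_shift: "((\<lambda>x i. x (Suc i)) ^^ k) x = (\<lambda>i. x (i + k))"
  by (induction k arbitrary: x) (auto simp: funpow_swap1)

text \<open>If \<open>E\<close> contains its preimage, then the iterated preimages
  \<open>F k\<close> decrease and all have the probability of \<open>E\<close>, hence so does their
  intersection. For every \<open>n\<close> it depends only on the coordinates from \<open>n\<close>
  on, so Kolmogorov's law applies.\<close>

lemma ergodic_shift:
  assumes \<mu>: "prob_space \<mu>"
  shows "ergodic_system (\<Pi>\<^sub>M i\<in>(UNIV :: nat set). \<mu>) (\<lambda>x i. x (Suc i))"
proof -
  let ?P = "\<Pi>\<^sub>M i\<in>(UNIV :: nat set). \<mu>"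
  let ?T = "\<lambda>x i. x (Suc i)"
  interpret prob_space ?P using \<mu> by (intro prob_space_PiM)
  have meas: "(\<lambda>x i. x (f i)) \<in> measurable ?P ?P" for f :: "nat \<Rightarrow> nat"
    by (intro measurable_PiM_single') (auto simp: space_PiM PiE_def)
  define A where "A i = {(\<lambda>x. x i) -` B \<inter> space ?P | B. B \<in> sets \<mu>}" for i :: nat
  have indep: "indep_sets A UNIV"
  proof -
    have "distr ?P ?P (\<lambda>x. \<lambda>i\<in>UNIV. x i) = (\<Pi>\<^sub>M i\<in>UNIV. distr ?P \<mu> (\<lambda>x. x i))"
    proof -
      have "distr ?P ?P (\<lambda>x. \<lambda>i\<in>UNIV. x i) = ?P" by (simp add: restrict_def distr_id2)
      also have "\<dots> = (\<Pi>\<^sub>M i\<in>UNIV. distr ?P \<mu> (\<lambda>x. x i))"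
        using distr_PiM_component[of "UNIV :: nat set" "\<lambda>_. \<mu>"] \<mu> by simp
      finally show ?thesis .
    qed
    then have "indep_vars (\<lambda>_. \<mu>) (\<lambda>i x. x i) UNIV"
      by (subst indep_vars_iff_distr_eq_PiM) auto
    then show ?thesis unfolding indep_vars_def2 A_def by simp
  qed
  have alg: "sigma_algebra (space ?P) (A i)" for i
  proof -
    have "A i = sets (vimage_algebra (space ?P) (\<lambda>x. x i) \<mu>)"
      unfolding A_def by (subst sets_vimage_algebra2) (auto simp: space_PiM)
    then show ?thesis by (metis sets.sigma_algebra_axioms space_vimage_algebra)
  qed
  show ?thesis
  proof (unfold_locales)
    show "?T \<in> measurable ?P ?P" by (rule meas)
    show "distr ?P ?P ?T = ?P" by (rule distr_PiM_UNIV_inj[OF \<mu>]) simp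
    fix E assume E: "E \<in> sets ?P" and sub: "\<And>x. x \<in> space ?P \<Longrightarrow> ?T x \<in> E \<Longrightarrow> x \<in> E"
    define F where "F k = {x \<in> space ?P. (\<lambda>i. x (i + k)) \<in> E}" for k :: nat
    have Fsets: "F k \<in> sets ?P" for k
      using measurable_sets[OF meas[of "\<lambda>i. i + k"] E] unfolding F_def
      by (simp add: vimage_def Int_def conj_commute)
    have probF: "prob (F k) = prob E" for k
    proof -
      have "prob (F k) = measure (distr ?P ?P (\<lambda>x i. x (i + k))) E"
        by (subst measure_distr[OF meas E]) (simp add: F_def vimage_def Int_def conj_commute)
      also have "\<dots> = prob E" by (subst distr_PiM_UNIV_inj[OF \<mu>]) (auto intro: injI)
      finally show ?thesis .
    qed
    have Fdec: "F (Suc k) \<subseteq> F k" for k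
    proof
      fix x assume x: "x \<in> F (Suc k)"
      then have "(\<lambda>i. x (i + k)) \<in> space ?P" by (auto simp: F_def space_PiM)
      from sub[OF this] x show "x \<in> F k" by (auto simp: F_def)
    qed
    then have dec: "decseq F" by (rule decseq_SucI)
    have "(\<lambda>k. prob (F k)) \<longlonglongrightarrow> prob (\<Inter>k. F k)"
      using Fsets dec by (intro finite_Lim_measure_decseq) auto
    then have eq: "prob (\<Inter>k. F k) = prob E"
      unfolding probF by (simp add: LIMSEQ_const_iff)
    have "(\<Inter>k. F k) \<in> tail_events A"
      unfolding tail_events_def
    proof (rule INT_I)
      fix n
      let ?S = "sigma (space ?P) (\<Union>(A ` {n..}))"
      have AP: "\<Union>(A ` {n..}) \<subseteq> Pow (space ?P)" by (auto simp: A_def)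
      have "F k \<in> sets ?S" if "k \<ge> n" for k
      proof -
        have "(\<lambda>x i. x (i + k)) \<in> measurable ?S ?P"
        proof (rule measurable_PiM_single')
          fix i :: nat
          show "(\<lambda>x. x (i + k)) \<in> measurable ?S \<mu>"
          proof (rule measurableI)
            fix B assume "B \<in> sets \<mu>"
            then have "(\<lambda>x. x (i + k)) -` B \<inter> space ?P \<in> \<Union>(A ` {n..})"
              using that unfolding A_def by (intro UN_I[of "i + k"]) auto
            then show "(\<lambda>x. x (i + k)) -` B \<inter> space ?S \<in> sets ?S"
              using AP by (simp add: sets_measure_of space_measure_of sigma_sets.Basic)
          qed (use AP in \<open>auto simp: space_measure_of space_PiM\<close>)
        qed (use AP in \<open>auto simp: space_measure_of space_PiM\<close>)
        from measurable_sets[OF this E] show ?thesis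
          using AP unfolding F_def by (simp add: space_measure_of vimage_def Int_def conj_commute)
      qed
      then have "(\<Inter>k\<in>{n..}. F k) \<in> sets ?S" by (intro sets.countable_INT) auto
      \<comment> \<open>By monotonicity the first \<open>n\<close> sets may be dropped.\<close>
      moreover have "(\<Inter>k\<in>{n..}. F k) = (\<Inter>k. F k)"
      proof
        show "(\<Inter>k\<in>{n..}. F k) \<subseteq> (\<Inter>k. F k)"
        proof (rule INT_greatest)
          show "(\<Inter>k\<in>{n..}. F k) \<subseteq> F k" for k
            using decseqD[OF dec, of k "max n k"] by (intro order_trans[OF INT_lower[of "max n k"]]) auto
        qed
      qed auto
      ultimately show "(\<Inter>k. F k) \<in> sigma_sets (space ?P) (\<Union>(A ` {n..}))"
        using AP by (simp add: sets_measure_of)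
    qed
    from kolmogorov_0_1_law[OF alg indep this] show "prob E = 0 \<or> prob E = 1"
      by (simp add: eq)
  qed
qed

section \<open>Products of independent matrices\<close>

text \<open>Counting from \<open>0\<close> fits the shift on sequences indexed by all
  naturals.\<close>

primrec seq_prod :: "(nat \<Rightarrow> complex^'n^'n) \<Rightarrow> nat \<Rightarrow> complex^'n^'n"
  where
    "seq_prod x 0 = mat 1"
  | "seq_prod x (Suc n) = x n ** seq_prod x n"

lemma left_prod_eq_seq_prod: "left_prod x n = seq_prod (\<lambda>i. x (Suc i)) n"
  by (induction n) auto

lemma seq_prod_add: "seq_prod x (m + n) = seq_prod (\<lambda>i. x (i + m)) n ** seq_prod x m"
  by (induction n) (auto simp: matrix_mul_assoc add.commute)

lemma seq_prod_cong: "(\<And>i. i < n \<Longrightarrow> x i = y i) \<Longrightarrow> seq_prod x n = seq_prod y n"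
  by (induction n) auto

section \<open>Measurability and the cost of single factors\<close>

lemma borel_measurable_matrix_mult [measurable (raw)]:
  fixes A B :: "'w \<Rightarrow> complex^'n^'n"
  assumes "A \<in> borel_measurable M" "B \<in> borel_measurable M"
  shows "(\<lambda>x. A x ** B x) \<in> borel_measurable M"
proof (rule borel_measurable_continuous_Pair[OF assms])
  show "continuous_on UNIV (\<lambda>x. fst x ** snd x :: complex^'n^'n)"
    unfolding matrix_matrix_mult_def
    by (intro continuous_on_vec_lambda continuous_intros)
qed

lemma borel_measurable_minor_norm [measurable]:
  "minor_norm p \<in> borel_measurable (borel :: (complex^'n^'n) measure)"
proof (rule borel_measurable_continuous_onI)
  show "continuous_on UNIV (minor_norm p :: complex^'n^'n \<Rightarrow> real)"
    unfolding minor_norm_def minor_def by (intro continuous_intros) auto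
qed

lemma matrix_inv_mult_right: "invertible g \<Longrightarrow> g ** matrix_inv g = mat 1"
  unfolding invertible_def matrix_inv_def by (rule someI2_ex) auto

lemma op_norm_le_N: "op_norm g \<le> N g" "op_norm (matrix_inv g) \<le> N g"
  by (auto simp: N_def)

lemma N_ge_1:
  assumes "invertible g"
  shows "N g \<ge> 1"
proof (rule ccontr)
  assume "\<not> N g \<ge> 1"
  then have lt: "op_norm g < 1" "op_norm (matrix_inv g) < 1" using op_norm_le_N[of g] by auto
  have "1 = op_norm (g ** matrix_inv g)"
    using assms by (simp add: matrix_inv_mult_right op_norm_mat_1)
  also have "\<dots> \<le> op_norm g * op_norm (matrix_inv g)" by (rule op_norm_mult)
  also have "\<dots> \<le> op_norm g * 1" using lt op_norm_nonneg[of g] by (intro mult_left_mono) auto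
  finally show False using lt by simp
qed

text \<open>The logarithm of a common bound for the minors of \<open>g\<close> and of its inverse;
  at the first coordinate it becomes the dominating function \<open>H\<close> of Kingman's
  theorem.\<close>

definition minor_cost :: "nat \<Rightarrow> complex^'n^'n \<Rightarrow> real"
  where "minor_cost p g = ln (real (CARD('n) ^ p * CARD('n) ^ p)) + real p * ln (N g)"

lemma minor_norm_le_exp_cost:
  fixes g :: "complex^'n^'n"
  assumes g: "invertible g"
  shows "minor_norm p g \<le> exp (minor_cost p g)" "minor_norm p (matrix_inv g) \<le> exp (minor_cost p g)"
    and "minor_cost p g \<ge> 0"
proof -
  let ?C = "real (CARD('n) ^ p * CARD('n) ^ p)"
  have N: "N g \<ge> 1" by (rule N_ge_1[OF g])
  have C: "?C \<ge> 1" by (metis One_nat_def Suc_leI nat_0_less_mult_iff of_nat_1 of_nat_mono zero_less_card_finite zero_less_power)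
  have eq: "exp (minor_cost p g) = ?C * N g ^ p"
  proof -
    have "exp (real p * ln (N g)) = N g ^ p" using N by (simp add: exp_of_nat_mult)
    moreover have "exp (ln ?C) = ?C" using C by (intro exp_ln) linarith
    ultimately show ?thesis by (simp only: minor_cost_def exp_add)
  qed
  have "minor_norm p a \<le> ?C * N g ^ p" if "op_norm a \<le> N g" for a :: "complex^'n^'n"
  proof -
    have "op_norm a ^ p \<le> N g ^ p" using that op_norm_nonneg by (intro power_mono)
    then have "?C * op_norm a ^ p \<le> ?C * N g ^ p" by (intro mult_left_mono) auto
    with minor_norm_le_op_norm[of p a] show ?thesis by linarith
  qed
  then show "minor_norm p g \<le> exp (minor_cost p g)" "minor_norm p (matrix_inv g) \<le> exp (minor_cost p g)"
    unfolding eq using op_norm_le_N by blast+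
  show "minor_cost p g \<ge> 0"
    unfolding minor_cost_def using C N by (intro add_nonneg_nonneg mult_nonneg_nonneg ln_ge_zero) auto
qed

text \<open>The latest factor is peeled off with its inverse, whose minors are bounded by the same
  cost.\<close>

lemma minor_norm_seq_prod_ge:
  fixes x :: "nat \<Rightarrow> complex^'n^'n"
  assumes inv: "\<And>i. invertible (x i)" and p: "p \<le> CARD('n)"
  shows "exp (- (\<Sum>i<n. minor_cost p (x i))) \<le> minor_norm p (seq_prod x n)"
proof (induction n)
  case 0
  show ?case using minor_norm_mat_1[OF p] by simp
next
  case (Suc n)
  let ?P = "seq_prod x n" and ?c = "minor_cost p (x n)"
  have "?P = matrix_inv (x n) ** (x n ** ?P)"
    by (simp add: matrix_mul_assoc matrix_inv_mult_left inv)
  then have "minor_norm p ?P \<le> minor_norm p (matrix_inv (x n)) * minor_norm p (x n ** ?P)"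
    using minor_norm_mult[of p "matrix_inv (x n)" "x n ** ?P"] by simp
  also have "\<dots> \<le> exp ?c * minor_norm p (x n ** ?P)"
    by (intro mult_right_mono minor_norm_le_exp_cost inv minor_norm_nonneg)
  finally have "exp (- (\<Sum>i<n. minor_cost p (x i))) \<le> exp ?c * minor_norm p (x n ** ?P)"
    using Suc by linarith
  then have "exp (- ?c) * exp (- (\<Sum>i<n. minor_cost p (x i))) \<le> exp (- ?c) * (exp ?c * minor_norm p (x n ** ?P))"
    by (intro mult_left_mono) auto
  also have "exp (- ?c) * (exp ?c * minor_norm p (x n ** ?P)) = minor_norm p (seq_prod x (Suc n))"
    by (simp add: exp_minus)
  also have "exp (- ?c) * exp (- (\<Sum>i<n. minor_cost p (x i))) = exp (- (\<Sum>i<Suc n. minor_cost p (x i)))"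
    unfolding exp_add[symmetric] by simp
  finally show ?case .
qed

text \<open>Starts at one factor, since the minor norm of the identity may exceed one.\<close>

lemma minor_norm_seq_prod_le:
  fixes x :: "nat \<Rightarrow> complex^'n^'n"
  assumes inv: "\<And>i. invertible (x i)"
  shows "minor_norm p (seq_prod x (Suc n)) \<le> exp (\<Sum>i<Suc n. minor_cost p (x i))"
proof (induction n)
  case 0
  show ?case using minor_norm_le_exp_cost(1)[OF inv[of 0], of p] by simp
next
  case (Suc n)
  have "minor_norm p (seq_prod x (Suc (Suc n))) \<le> minor_norm p (x (Suc n)) * minor_norm p (seq_prod x (Suc n))"
    by (subst seq_prod.simps(2)) (rule minor_norm_mult)
  also have "\<dots> \<le> exp (minor_cost p (x (Suc n))) * exp (\<Sum>i<Suc n. minor_cost p (x i))"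
    by (intro mult_mono minor_norm_le_exp_cost inv Suc minor_norm_nonneg) simp
  also have "\<dots> = exp (\<Sum>i<Suc (Suc n). minor_cost p (x i))" by (simp add: exp_add[symmetric] add_ac)
  finally show ?case .
qed

text \<open>The left inverse is assembled from the inverses of the factors in reverse order, and
  \<open>N\<close> bounds each factor together with its inverse.\<close>

lemma op_norm_seq_prod:
  fixes x :: "nat \<Rightarrow> complex^'n^'n"
  assumes inv: "\<And>i. invertible (x i)"
  shows "op_norm (seq_prod x n) \<le> exp (\<Sum>i<n. ln (N (x i)))"
    and "\<exists>R. R ** seq_prod x n = mat 1 \<and> op_norm R \<le> exp (\<Sum>i<n. ln (N (x i)))"
proof (induction n)
  case 0
  show "op_norm (seq_prod x 0) \<le> exp (\<Sum>i<0. ln (N (x i)))" by (simp add: op_norm_mat_1)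
  show "\<exists>R. R ** seq_prod x 0 = mat 1 \<and> op_norm R \<le> exp (\<Sum>i<0. ln (N (x i)))"
    by (rule exI[of _ "mat 1"]) (simp add: op_norm_mat_1)
next
  case (Suc n)
  have Nx: "exp (ln (N (x n))) = N (x n)" using N_ge_1[OF inv[of n]] by (intro exp_ln) linarith
  have sum: "exp (\<Sum>i<Suc n. ln (N (x i))) = exp (\<Sum>i<n. ln (N (x i))) * N (x n)"
    by (simp add: exp_add Nx)
  have "op_norm (seq_prod x (Suc n)) \<le> op_norm (x n) * op_norm (seq_prod x n)"
    by (simp add: op_norm_mult)
  also have "\<dots> \<le> N (x n) * exp (\<Sum>i<n. ln (N (x i)))"
    using N_ge_1[OF inv[of n]] by (intro mult_mono op_norm_le_N Suc op_norm_nonneg) auto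
  finally show "op_norm (seq_prod x (Suc n)) \<le> exp (\<Sum>i<Suc n. ln (N (x i)))"
    unfolding sum by (simp add: mult.commute)
  obtain R where R: "R ** seq_prod x n = mat 1" "op_norm R \<le> exp (\<Sum>i<n. ln (N (x i)))"
    using Suc(2) by blast
  show "\<exists>R. R ** seq_prod x (Suc n) = mat 1 \<and> op_norm R \<le> exp (\<Sum>i<Suc n. ln (N (x i)))"
  proof (intro exI conjI)
    have "R ** matrix_inv (x n) ** seq_prod x (Suc n) = R ** (matrix_inv (x n) ** x n) ** seq_prod x n"
      by (simp add: matrix_mul_assoc)
    then show "R ** matrix_inv (x n) ** seq_prod x (Suc n) = mat 1"
      by (simp add: matrix_inv_mult_left inv R)
    have "op_norm (R ** matrix_inv (x n)) \<le> op_norm R * op_norm (matrix_inv (x n))"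
      by (rule op_norm_mult)
    also have "\<dots> \<le> exp (\<Sum>i<n. ln (N (x i))) * N (x n)"
      by (intro mult_mono op_norm_le_N R op_norm_nonneg) simp
    finally show "op_norm (R ** matrix_inv (x n)) \<le> exp (\<Sum>i<Suc n. ln (N (x i)))" unfolding sum .
  qed
qed

lemma abs_ln_spectral_radius_seq_prod_le:
  fixes x :: "nat \<Rightarrow> complex^'n^'n"
  assumes inv: "\<And>i. invertible (x i)"
  shows "spectral_radius (seq_prod x n) > 0"
    and "\<bar>ln (spectral_radius (seq_prod x n))\<bar> \<le> (\<Sum>i<n. ln (N (x i)))"
proof -
  let ?\<rho> = "spectral_radius (seq_prod x n)" and ?S = "\<Sum>i<n. ln (N (x i))"
  obtain R where R: "R ** seq_prod x n = mat 1" "op_norm R \<le> exp ?S"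
    using op_norm_seq_prod(2)[of x, OF inv] by blast
  have "1 \<le> ?\<rho> * op_norm R" by (rule spectral_radius_op_norm_left_inverse[OF R(1)])
  moreover have \<rho>0: "?\<rho> \<ge> 0" by (metis spectral_radius_attained norm_ge_zero)
  ultimately have ge: "1 \<le> ?\<rho> * exp ?S"
    using mult_left_mono[OF R(2) \<rho>0] by linarith
  then have "?\<rho> \<noteq> 0" by auto
  with \<rho>0 show pos: "?\<rho> > 0" by simp
  have "?\<rho> \<le> exp ?S"
    using spectral_radius_le_op_norm op_norm_seq_prod(1)[of x, OF inv] order_trans by blast
  then have "ln ?\<rho> \<le> ?S" using pos by (metis ln_exp ln_le_cancel_iff exp_gt_zero)
  moreover have "exp (- ?S) \<le> ?\<rho>" using ge by (simp add: exp_minus field_simps)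
  then have "- ?S \<le> ln ?\<rho>" using pos by (simp add: ln_ge_iff)
  ultimately show "\<bar>ln ?\<rho>\<bar> \<le> ?S" by simp
qed

section \<open>Growth rates of minors along the random product\<close>

locale random_product =
  fixes \<mu> :: "(complex^'n^'n) measure"
  assumes prob_mu: "prob_space \<mu>"
    and sets_mu: "sets \<mu> = sets GL_borel"
    and moment: "finite_first_moment \<mu>"
begin

abbreviation \<Omega> :: "(nat \<Rightarrow> complex^'n^'n) measure"
  where "\<Omega> \<equiv> \<Pi>\<^sub>M i\<in>UNIV. \<mu>"

sublocale ergodic_system \<Omega> "\<lambda>x i. x (Suc i)"
  by (rule ergodic_shift[OF prob_mu])

lemma space_mu: "space \<mu> = GL"
  using sets_eq_imp_space_eq[OF sets_mu] by (simp add: GL_borel_def space_restrict_space)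

lemma invertible_component: "x \<in> space \<Omega> \<Longrightarrow> invertible (x i)"
  by (auto simp: space_PiM space_mu GL_def PiE_iff)

lemma component_measurable_mu: "(\<lambda>x. x i) \<in> measurable \<Omega> \<mu>"
  by (rule measurable_component_singleton) simp

lemma component_measurable: "(\<lambda>x. x i) \<in> borel_measurable \<Omega>"
proof (rule measurable_compose[OF component_measurable_mu])
  have "(\<lambda>x. x) \<in> measurable GL_borel borel"
    unfolding GL_borel_def by (intro measurable_restrict_space1) simp
  then show "(\<lambda>x. x) \<in> borel_measurable \<mu>"
    by (simp cong: measurable_cong_sets add: sets_mu)
qed

lemma seq_prod_measurable [measurable]: "(\<lambda>x. seq_prod x n) \<in> borel_measurable \<Omega>"
  by (induction n) (simp_all add: borel_measurable_matrix_mult component_measurable)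

lemma minor_norm_seq_prod_measurable: "(\<lambda>x. minor_norm p (seq_prod x n)) \<in> borel_measurable \<Omega>"
  by (rule measurable_compose[OF seq_prod_measurable borel_measurable_minor_norm])

lemma integral_component:
  assumes [measurable]: "f \<in> borel_measurable \<mu>"
  shows "(\<integral>x. f (x i) \<partial>\<Omega>) = (\<integral>g. f g \<partial>\<mu> :: real)"
proof -
  have "distr \<Omega> \<mu> (\<lambda>x. x i) = \<mu>"
    using distr_PiM_component[of "UNIV :: nat set" "\<lambda>_. \<mu>" i] prob_mu by simp
  then show ?thesis
    using integral_distr[OF component_measurable_mu[of i] assms] by simp
qed

lemma integrable_component:
  assumes f: "integrable \<mu> (f :: _ \<Rightarrow> real)"
  shows "integrable \<Omega> (\<lambda>x. f (x i))"
proof -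
  have "distr \<Omega> \<mu> (\<lambda>x. x i) = \<mu>"
    using distr_PiM_component[of "UNIV :: nat set" "\<lambda>_. \<mu>" i] prob_mu by simp
  then show ?thesis
    using integrable_distr[OF component_measurable_mu[of i], of f] f by simp
qed

lemma integrable_ln_N: "integrable \<mu> (\<lambda>g. ln (N g))"
  using moment by (simp add: finite_first_moment_def)

lemma integrable_minor_cost: "integrable \<mu> (minor_cost p)"
proof -
  have "integrable \<mu> (\<lambda>_. ln (real (CARD('n) ^ p * CARD('n) ^ p)))"
    by (rule finite_measure.integrable_const[OF prob_space.axioms(1)[OF prob_mu]])
  then show ?thesis
    unfolding minor_cost_def
    by (intro Bochner_Integration.integrable_add integrable_mult_right integrable_ln_N)
qed

lemma minor_norm_seq_prod_pos:
  assumes "x \<in> space \<Omega>" "p \<le> CARD('n)"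
  shows "minor_norm p (seq_prod x n) > 0"
  using minor_norm_seq_prod_ge[of x p n] invertible_component assms
  by (metis exp_gt_zero order_less_le_trans)

lemma minor_norm_growth_exists:
  assumes p: "p \<le> CARD('n)"
  shows "\<exists>s. (AE x in \<Omega>. (\<lambda>n. ln (minor_norm p (seq_prod x n)) / real n) \<longlonglongrightarrow> s)
    \<and> (\<lambda>n. \<integral>x. \<bar>ln (minor_norm p (seq_prod x n)) / real n - s\<bar> \<partial>\<Omega>) \<longlonglongrightarrow> 0
    \<and> (\<forall>n. integrable \<Omega> (\<lambda>x. ln (minor_norm p (seq_prod x n)) / real n))"
proof -
  \<comment> \<open>Set to zero at \<open>n = 0\<close>: there the domination by an empty sum forces
    the value zero, while the minor norm of the identity may exceed one. Quotients by
    \<open>n\<close> are unaffected, as division by zero gives zero.\<close>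
  define \<Phi> where "\<Phi> n x = (if n = 0 then 0 else ln (minor_norm p (seq_prod x n)))"
    for n and x :: "nat \<Rightarrow> complex^'n^'n"
  define H where "H x = minor_cost p (x 0)" for x :: "nat \<Rightarrow> complex^'n^'n"
  have pos: "minor_norm p (seq_prod x n) > 0" if "x \<in> space \<Omega>" for x n
    by (rule minor_norm_seq_prod_pos[OF that p])
  have shift_space: "(\<lambda>i. x (i + m)) \<in> space \<Omega>" if "x \<in> space \<Omega>" for x m
    using that by (auto simp: space_PiM PiE_iff)
  have HT: "H (((\<lambda>x i. x (Suc i)) ^^ i) x) = minor_cost p (x i)" for i and x :: "nat \<Rightarrow> complex^'n^'n"
    by (simp add: H_def funpow_shift)
  have sub: "\<Phi> (m + n) x \<le> \<Phi> m x + \<Phi> n (((\<lambda>x i. x (Suc i)) ^^ m) x)" if x: "x \<in> space \<Omega>" for m n x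
  proof (cases "m = 0 \<or> n = 0")
    case True
    then show ?thesis by (auto simp: \<Phi>_def)
  next
    case False
    let ?y = "\<lambda>i. x (i + m)"
    have "minor_norm p (seq_prod x (m + n)) \<le> minor_norm p (seq_prod ?y n) * minor_norm p (seq_prod x m)"
      unfolding seq_prod_add by (rule minor_norm_mult)
    then have "ln (minor_norm p (seq_prod x (m + n))) \<le> ln (minor_norm p (seq_prod ?y n) * minor_norm p (seq_prod x m))"
      using pos[OF x] pos[OF shift_space[OF x]] by (subst ln_le_cancel_iff) (auto intro: mult_pos_pos)
    also have "\<dots> = ln (minor_norm p (seq_prod ?y n)) + ln (minor_norm p (seq_prod x m))"
      using pos[OF x, of m] pos[OF shift_space[OF x], of m n] by (simp add: ln_mult)
    finally show ?thesis using False by (simp add: \<Phi>_def funpow_shift)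
  qed
  have bnd: "\<bar>\<Phi> n x\<bar> \<le> (\<Sum>i<n. H (((\<lambda>x i. x (Suc i)) ^^ i) x))" if x: "x \<in> space \<Omega>" for n x
  proof (cases n)
    case 0
    then show ?thesis by (simp add: \<Phi>_def)
  next
    case (Suc k)
    let ?S = "\<Sum>i<n. minor_cost p (x i)"
    have "minor_norm p (seq_prod x n) \<le> exp ?S" "exp (- ?S) \<le> minor_norm p (seq_prod x n)"
      using minor_norm_seq_prod_le[of x p k] minor_norm_seq_prod_ge[of x p n] invertible_component[OF x] p Suc
      by blast+
    then have "ln (minor_norm p (seq_prod x n)) \<le> ?S" "- ?S \<le> ln (minor_norm p (seq_prod x n))"
      using pos[OF x, of n] by (metis ln_exp ln_le_cancel_iff exp_gt_zero)+
    then show ?thesis unfolding HT using Suc by (simp add: \<Phi>_def)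
  qed
  have H0: "H x \<ge> 0" if "x \<in> space \<Omega>" for x
    unfolding H_def by (rule minor_norm_le_exp_cost(3)[OF invertible_component[OF that]])
  have iH: "integrable \<Omega> H"
    unfolding H_def by (rule integrable_component[OF integrable_minor_cost])
  have meas: "\<Phi> n \<in> borel_measurable \<Omega>" for n
  proof (cases "n = 0")
    case True
    then have "\<Phi> n = (\<lambda>_. 0)" by (simp add: \<Phi>_def fun_eq_iff)
    then show ?thesis by (simp only: borel_measurable_const)
  next
    case False
    then have "\<Phi> n = (\<lambda>x. ln (minor_norm p (seq_prod x n)))" by (simp add: \<Phi>_def fun_eq_iff)
    then show ?thesis using borel_measurable_ln[OF minor_norm_seq_prod_measurable[of p n]] by (simp only:)
  qed
  obtain s where s: "AE x in \<Omega>. (\<lambda>n. \<Phi> n x / real n) \<longlonglongrightarrow> s"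
      "(\<lambda>n. \<integral>x. \<bar>\<Phi> n x / real n - s\<bar> \<partial>\<Omega>) \<longlonglongrightarrow> 0"
    using kingman[OF sub bnd H0 iH meas] by blast
  have eq: "\<Phi> n x / real n = ln (minor_norm p (seq_prod x n)) / real n" for n x
    by (simp add: \<Phi>_def)
  have "integrable \<Omega> (\<lambda>x. ln (minor_norm p (seq_prod x n)) / real n)" for n
  proof -
    have "integrable \<Omega> (\<Phi> n)"
    proof (rule Bochner_Integration.integrable_bound)
      show "integrable \<Omega> (\<lambda>x. \<Sum>i<n. H (((\<lambda>x i. x (Suc i)) ^^ i) x))"
        using integrable_T_pow[OF iH] by (intro Bochner_Integration.integrable_sum)
      show "AE x in \<Omega>. norm (\<Phi> n x) \<le> norm (\<Sum>i<n. H (((\<lambda>x i. x (Suc i)) ^^ i) x))"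
        unfolding real_norm_def by (intro AE_I2 order_trans[OF bnd abs_ge_self])
    qed (rule meas)
    then have "integrable \<Omega> (\<lambda>x. \<Phi> n x / real n)" by (rule integrable_divide)
    then show ?thesis unfolding eq .
  qed
  then show ?thesis using s unfolding eq by blast
qed

text \<open>For \<open>p\<close> up to the dimension this is the sum of the first \<open>p\<close>
  Lyapunov exponents; the exponents beyond the first enter only through these sums.\<close>

definition growth :: "nat \<Rightarrow> real"
  where "growth p = (SOME s. (AE x in \<Omega>. (\<lambda>n. ln (minor_norm p (seq_prod x n)) / real n) \<longlonglongrightarrow> s)
    \<and> (\<lambda>n. \<integral>x. \<bar>ln (minor_norm p (seq_prod x n)) / real n - s\<bar> \<partial>\<Omega>) \<longlonglongrightarrow> 0
    \<and> (\<forall>n. integrable \<Omega> (\<lambda>x. ln (minor_norm p (seq_prod x n)) / real n)))"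

lemma
  assumes "p \<le> CARD('n)"
  shows growth_AE: "AE x in \<Omega>. (\<lambda>n. ln (minor_norm p (seq_prod x n)) / real n) \<longlonglongrightarrow> growth p"
    and growth_mean: "(\<lambda>n. \<integral>x. \<bar>ln (minor_norm p (seq_prod x n)) / real n - growth p\<bar> \<partial>\<Omega>) \<longlonglongrightarrow> 0"
    and integrable_ln_minor_norm: "integrable \<Omega> (\<lambda>x. ln (minor_norm p (seq_prod x n)) / real n)"
  using someI_ex[OF minor_norm_growth_exists[OF assms]] unfolding growth_def by blast+

lemma ln_op_norm_minus_ln_minor_norm_1:
  assumes x: "x \<in> space \<Omega>"
  shows "op_norm (seq_prod x n) > 0"
    and "\<bar>ln (op_norm (seq_prod x n)) - ln (minor_norm 1 (seq_prod x n))\<bar> \<le> ln (real (CARD('n) * CARD('n)))"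
proof -
  let ?A = "seq_prod x n" and ?K = "real (CARD('n) * CARD('n))"
  have m: "minor_norm 1 ?A > 0" by (rule minor_norm_seq_prod_pos[OF x]) (simp add: Suc_le_eq)
  have K: "?K > 0" by simp
  have 1: "minor_norm 1 ?A \<le> ?K * op_norm ?A" using minor_norm_le_op_norm[of 1 ?A] by simp
  have 2: "op_norm ?A \<le> ?K * minor_norm 1 ?A" by (rule op_norm_le_minor_norm_1)
  have "?K * op_norm ?A > 0" using m 1 by linarith
  then show o: "op_norm ?A > 0" using K by (simp add: zero_less_mult_iff)
  have "ln (minor_norm 1 ?A) \<le> ln (?K * op_norm ?A)" using 1 m o K by (subst ln_le_cancel_iff) auto
  also have "\<dots> = ln ?K + ln (op_norm ?A)" by (rule ln_mult_pos[OF K o])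
  finally have a: "ln (minor_norm 1 ?A) \<le> ln ?K + ln (op_norm ?A)" .
  have "ln (op_norm ?A) \<le> ln (?K * minor_norm 1 ?A)" using 2 m o K by (subst ln_le_cancel_iff) auto
  also have "\<dots> = ln ?K + ln (minor_norm 1 ?A)" by (rule ln_mult_pos[OF K m])
  finally show "\<bar>ln (op_norm ?A) - ln (minor_norm 1 ?A)\<bar> \<le> ln ?K" using a by (simp only: abs_le_iff) linarith
qed

text \<open>Operator norm and \<open>minor_norm 1\<close> differ by a bounded factor, which averages
  out; this ties \<open>growth 1\<close> to the first Lyapunov exponent.\<close>

lemma growth_op_norm_AE:
  "AE x in \<Omega>. (\<lambda>n. 1 / real n * ln (op_norm (seq_prod x n))) \<longlonglongrightarrow> growth 1"
proof -
  have "1 \<le> CARD('n)" by (simp add: Suc_le_eq)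
  from growth_AE[OF this] AE_space show ?thesis
  proof eventually_elim
    case (elim x)
    let ?a = "\<lambda>n. ln (op_norm (seq_prod x n)) - ln (minor_norm 1 (seq_prod x n))"
    have "(\<lambda>n. ?a n / real n) \<longlonglongrightarrow> 0"
    proof (rule Lim_null_comparison)
      show "eventually (\<lambda>n. norm (?a n / real n) \<le> ln (real (CARD('n) * CARD('n))) / real n) sequentially"
        using ln_op_norm_minus_ln_minor_norm_1(2)[OF elim(2)]
        by (intro always_eventually allI) (simp add: divide_right_mono)
      show "(\<lambda>n. ln (real (CARD('n) * CARD('n))) / real n) \<longlonglongrightarrow> 0" by (rule lim_const_over_n)
    qed
    from tendsto_add[OF this elim(1)]
    show ?case by (simp add: diff_divide_distrib)
  qed
qed

text \<open>A \<open>p\<close>-minor is at most a constant times the \<open>p\<close>-th power of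
  the operator norm. Equality means that the first \<open>p\<close> exponents coincide.\<close>

lemma growth_le_linear:
  assumes p: "p \<le> CARD('n)"
  shows "growth p \<le> real p * growth 1"
proof -
  let ?C = "real (CARD('n) ^ p * CARD('n) ^ p)"
  have C: "?C > 0" by simp
  have "AE x in \<Omega>. growth p \<le> real p * growth 1"
    using growth_AE[OF p] growth_op_norm_AE AE_space
  proof eventually_elim
    case (elim x)
    have "(\<lambda>n. ln ?C / real n + real p * (1 / real n * ln (op_norm (seq_prod x n)))) \<longlonglongrightarrow> 0 + real p * growth 1"
      by (intro tendsto_intros lim_const_over_n elim)
    then have "(\<lambda>n. ln ?C / real n + real p * (1 / real n * ln (op_norm (seq_prod x n)))) \<longlonglongrightarrow> real p * growth 1"
      by simp
    moreover have "ln (minor_norm p (seq_prod x n)) / real n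
        \<le> ln ?C / real n + real p * (1 / real n * ln (op_norm (seq_prod x n)))" for n
    proof -
      have o: "op_norm (seq_prod x n) > 0" by (rule ln_op_norm_minus_ln_minor_norm_1(1)[OF elim(3)])
      have "ln (minor_norm p (seq_prod x n)) \<le> ln (?C * op_norm (seq_prod x n) ^ p)"
        using minor_norm_le_op_norm[of p "seq_prod x n"] minor_norm_seq_prod_pos[OF elim(3) p] o C
        by (subst ln_le_cancel_iff) auto
      also have "\<dots> = ln ?C + real p * ln (op_norm (seq_prod x n))"
        using o C by (subst ln_mult_pos) (auto simp: ln_realpow)
      finally have "ln (minor_norm p (seq_prod x n)) / real n \<le> (ln ?C + real p * ln (op_norm (seq_prod x n))) / real n"
        by (intro divide_right_mono) auto
      then show ?thesis by (simp only: add_divide_distrib) simp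
    qed
    ultimately show ?case by (intro LIMSEQ_le[OF elim(1)]) auto
  qed
  then show ?thesis by simp
qed

section \<open>Deviations of minors in probability\<close>

lemma tail_measure_tendsto_0:
  fixes f :: "nat \<Rightarrow> (nat \<Rightarrow> complex^'n^'n) \<Rightarrow> real"
  assumes int: "\<And>n. integrable \<Omega> (f n)"
    and lim: "(\<lambda>n. \<integral>x. \<bar>f n x - s\<bar> \<partial>\<Omega>) \<longlonglongrightarrow> 0" and \<delta>: "\<delta> > 0"
  shows "(\<lambda>n. prob {x \<in> space \<Omega>. \<delta> \<le> \<bar>f n x - s\<bar>}) \<longlonglongrightarrow> 0"
proof (rule tendsto_sandwich[OF _ _ tendsto_const])
  show "(\<lambda>n. (\<integral>x. \<bar>f n x - s\<bar> \<partial>\<Omega>) / \<delta>) \<longlonglongrightarrow> 0"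
    using tendsto_divide[OF lim tendsto_const[of \<delta>]] \<delta> by simp
  show "eventually (\<lambda>n. prob {x \<in> space \<Omega>. \<delta> \<le> \<bar>f n x - s\<bar>} \<le> (\<integral>x. \<bar>f n x - s\<bar> \<partial>\<Omega>) / \<delta>) sequentially"
    using int \<delta> by (intro always_eventually allI integral_Markov_inequality_measure[where A="{}"]) auto
qed auto

lemma minor_norm_window_measurable:
  "{x \<in> space \<Omega>. \<not> (a \<le> minor_norm p (seq_prod x n) \<and> minor_norm p (seq_prod x n) \<le> b)} \<in> events"
  using minor_norm_seq_prod_measurable[of p n] by measurable

lemma minor_norm_le_measurable: "{x \<in> space \<Omega>. \<not> minor_norm p (seq_prod x n) \<le> b} \<in> events"
  using minor_norm_seq_prod_measurable[of p n] by measurable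

lemma minor_norm_window:
  assumes p: "p \<le> CARD('n)" and \<delta>: "\<delta> > 0"
  shows "(\<lambda>n. prob {x \<in> space \<Omega>. \<not> (exp (real n * (growth p - \<delta>)) \<le> minor_norm p (seq_prod x n)
    \<and> minor_norm p (seq_prod x n) \<le> exp (real n * (growth p + \<delta>)))}) \<longlonglongrightarrow> 0"
    (is "(\<lambda>n. prob (?E n)) \<longlonglongrightarrow> 0")
proof (rule tendsto_sandwich[OF _ _ tendsto_const])
  let ?f = "\<lambda>n x. ln (minor_norm p (seq_prod x n)) / real n"
  show "(\<lambda>n. prob {x \<in> space \<Omega>. \<delta> \<le> \<bar>?f n x - growth p\<bar>}) \<longlonglongrightarrow> 0"
    by (rule tail_measure_tendsto_0[OF integrable_ln_minor_norm[OF p] growth_mean[OF p] \<delta>])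
  show "eventually (\<lambda>n. prob (?E n) \<le> prob {x \<in> space \<Omega>. \<delta> \<le> \<bar>?f n x - growth p\<bar>}) sequentially"
    using eventually_ge_at_top[of 1]
  proof eventually_elim
    case (elim n)
    have "?f n \<in> borel_measurable \<Omega>" using integrable_ln_minor_norm[OF p] by auto
    then have "{x \<in> space \<Omega>. \<delta> \<le> \<bar>?f n x - growth p\<bar>} \<in> events" by measurable
    moreover have "?E n \<subseteq> {x \<in> space \<Omega>. \<delta> \<le> \<bar>?f n x - growth p\<bar>}"
    proof (rule subsetI, rule ccontr)
      fix x assume x: "x \<in> ?E n" and "x \<notin> {x \<in> space \<Omega>. \<delta> \<le> \<bar>?f n x - growth p\<bar>}"
      then have xs: "x \<in> space \<Omega>" and lt: "\<bar>?f n x - growth p\<bar> < \<delta>" by auto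
      have n: "real n > 0" using elim by simp
      have m: "minor_norm p (seq_prod x n) > 0" by (rule minor_norm_seq_prod_pos[OF xs p])
      have "real n * (growth p - \<delta>) \<le> ln (minor_norm p (seq_prod x n))"
        "ln (minor_norm p (seq_prod x n)) \<le> real n * (growth p + \<delta>)"
        using lt n by (auto simp: abs_less_iff field_simps)
      then have "exp (real n * (growth p - \<delta>)) \<le> exp (ln (minor_norm p (seq_prod x n)))"
        "exp (ln (minor_norm p (seq_prod x n))) \<le> exp (real n * (growth p + \<delta>))"
        by simp_all
      then show False using x m by simp
    qed
    ultimately show ?case by (intro finite_measure_mono)
  qed
qed auto

text \<open>The largest \<open>p\<close> with \<open>growth p = p \<lambda>\<^sub>1\<close> is the multiplicity of the top Lyapunov exponent; the
  spectral gap behind it makes the \<open>(p+1)\<close>-minors exponentially smaller than expected.\<close>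

lemma spectral_gap:
  obtains p \<gamma> where "1 \<le> p" "p \<le> CARD('n)" "growth p = real p * growth 1" "\<gamma> > 0"
    and "(\<lambda>n. prob {x \<in> space \<Omega>. \<not> minor_norm (Suc p) (seq_prod x n) \<le> exp (real n * ((real p + 1) * growth 1 - \<gamma>))}) \<longlonglongrightarrow> 0"
proof -
  define P where "P = {p \<in> {1..CARD('n)}. growth p = real p * growth 1}"
  have fin: "finite P" by (simp add: P_def)
  have "1 \<in> P" by (simp add: P_def Suc_le_eq)
  define p where "p = Max P"
  have "p \<in> P" unfolding p_def using fin \<open>1 \<in> P\<close> by (intro Max_in) auto
  then have p: "1 \<le> p" "p \<le> CARD('n)" "growth p = real p * growth 1" by (auto simp: P_def)
  show ?thesis
  proof (cases "p = CARD('n)")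
    case True
    \<comment> \<open>All \<open>(p+1)\<close>-minors vanish, so any positive
      \<open>\<gamma>\<close> will do.\<close>
    then have "minor_norm (Suc p) A = 0" for A :: "complex^'n^'n" by (intro minor_norm_eq_0) simp
    then show ?thesis by (intro that[OF p, of 1]) simp_all
  next
    case False
    then have p': "Suc p \<le> CARD('n)" using p by simp
    have "Suc p \<notin> P" using Max_ge[OF fin, of "Suc p"] by (auto simp: p_def)
    then have "growth (Suc p) \<noteq> real (Suc p) * growth 1" using p' by (auto simp: P_def)
    with growth_le_linear[OF p'] have lt: "growth (Suc p) < real (Suc p) * growth 1" by simp
    \<comment> \<open>Half of the deficit, so that the required threshold is the upper edge of the
      window around \<open>growth (Suc p)\<close>.\<close>
    define \<gamma> where "\<gamma> = (real (Suc p) * growth 1 - growth (Suc p)) / 2"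
    have \<gamma>: "\<gamma> > 0" using lt by (simp add: \<gamma>_def)
    show ?thesis
    proof (rule that[OF p \<gamma>], rule tendsto_sandwich[OF _ _ tendsto_const minor_norm_window[OF p' \<gamma>]])
      have eq: "(real p + 1) * growth 1 - \<gamma> = growth (Suc p) + \<gamma>"
        by (simp add: \<gamma>_def field_simps)
      show "eventually (\<lambda>n. prob {x \<in> space \<Omega>. \<not> minor_norm (Suc p) (seq_prod x n) \<le> exp (real n * ((real p + 1) * growth 1 - \<gamma>))}
        \<le> prob {x \<in> space \<Omega>. \<not> (exp (real n * (growth (Suc p) - \<gamma>)) \<le> minor_norm (Suc p) (seq_prod x n)
          \<and> minor_norm (Suc p) (seq_prod x n) \<le> exp (real n * (growth (Suc p) + \<gamma>)))}) sequentially"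
        unfolding eq
        by (intro always_eventually allI finite_measure_mono minor_norm_window_measurable) auto
    qed auto
  qed
qed

section \<open>Exchanging the two blocks of a product\<close>

lemma prob_reindex:
  assumes f: "inj (f :: nat \<Rightarrow> nat)" and E: "E \<in> events"
  shows "prob {x \<in> space \<Omega>. (\<lambda>i. x (f i)) \<in> E} = prob E" "{x \<in> space \<Omega>. (\<lambda>i. x (f i)) \<in> E} \<in> events"
proof -
  have meas: "(\<lambda>x i. x (f i)) \<in> measurable \<Omega> \<Omega>"
    by (intro measurable_PiM_single') (auto simp: space_PiM PiE_def intro: component_measurable_mu)
  have eq: "{x \<in> space \<Omega>. (\<lambda>i. x (f i)) \<in> E} = (\<lambda>x i. x (f i)) -` E \<inter> space \<Omega>" by auto
  show "{x \<in> space \<Omega>. (\<lambda>i. x (f i)) \<in> E} \<in> events"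
    unfolding eq by (rule measurable_sets[OF meas E])
  have "prob E = measure (distr \<Omega> \<Omega> (\<lambda>x i. x (f i))) E"
    using distr_PiM_UNIV_inj[OF prob_mu f] by simp
  then show "prob {x \<in> space \<Omega>. (\<lambda>i. x (f i)) \<in> E} = prob E"
    unfolding eq by (simp add: measure_distr[OF meas E])
qed

text \<open>The first \<open>u\<close> positions receive the entries from \<open>v\<close> on, the
  next \<open>v\<close> positions the entries before. Fixing all later positions keeps the map
  injective, so the reindexed sequence has the same law.\<close>

definition swap_halves :: "nat \<Rightarrow> nat \<Rightarrow> nat \<Rightarrow> nat"
  where "swap_halves u v i = (if i < u then i + v else if i < u + v then i - u else i)"

lemma inj_swap_halves: "inj (swap_halves u v)"
  by (rule injI) (auto simp: swap_halves_def split: if_splits)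

lemma seq_prod_halves:
  "seq_prod x (u + v) = seq_prod (\<lambda>i. x (i + v)) u ** seq_prod x v"
  "seq_prod (\<lambda>i. x (swap_halves u v i)) (u + v) = seq_prod x v ** seq_prod (\<lambda>i. x (i + v)) u"
proof -
  show "seq_prod x (u + v) = seq_prod (\<lambda>i. x (i + v)) u ** seq_prod x v"
    using seq_prod_add[of x v u] by (simp add: add.commute)
  have "seq_prod (\<lambda>i. x (swap_halves u v (i + u))) v = seq_prod x v"
    "seq_prod (\<lambda>i. x (swap_halves u v i)) u = seq_prod (\<lambda>i. x (i + v)) u"
    by (auto intro!: seq_prod_cong simp: swap_halves_def)
  then show "seq_prod (\<lambda>i. x (swap_halves u v i)) (u + v) = seq_prod x v ** seq_prod (\<lambda>i. x (i + v)) u"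
    using seq_prod_add[of "\<lambda>i. x (swap_halves u v i)" u v] by simp
qed

lemma spectral_radius_seq_prod_measurable: "(\<lambda>x. spectral_radius (seq_prod x n)) \<in> borel_measurable \<Omega>"
  by (rule measurable_compose[OF seq_prod_measurable borel_measurable_spectral_radius])

text \<open>Four good events suffice: for the whole product, for the product with its blocks
  exchanged and for each block. By reindexing, the complement of each has the probability of some
  \<open>B k\<close> with \<open>k\<close> tending to infinity, and on their intersection
  \<open>spectral_radius_lower_bound\<close> applies.\<close>

lemma spectral_radius_lower_tail:
  assumes \<epsilon>: "\<epsilon> > 0"
  shows "(\<lambda>n. prob {x \<in> space \<Omega>. spectral_radius (seq_prod x n) < exp (real n * (growth 1 - \<epsilon>))}) \<longlonglongrightarrow> 0"
proof -
  obtain p \<gamma> where p: "1 \<le> p" "p \<le> CARD('n)" "growth p = real p * growth 1" and \<gamma>: "\<gamma> > 0"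
    and gap: "(\<lambda>n. prob {x \<in> space \<Omega>. \<not> minor_norm (Suc p) (seq_prod x n) \<le> exp (real n * ((real p + 1) * growth 1 - \<gamma>))}) \<longlonglongrightarrow> 0"
    by (rule spectral_gap)
  define l where "l = growth 1"
  \<comment> \<open>The two terms meet the two conditions on \<open>\<delta>\<close> in
    \<open>spectral_radius_lower_bound\<close>.\<close>
  define \<delta> where "\<delta> = min (\<gamma> / (6 * (real p + 3))) (\<epsilon> / 6)"
  have \<delta>: "\<delta> > 0" using \<gamma> \<epsilon> by (simp add: \<delta>_def)
  have "\<delta> \<le> \<gamma> / (6 * (real p + 3))" by (simp add: \<delta>_def)
  then have \<delta>\<gamma>: "\<delta> * (real p + 3) \<le> \<gamma> / 6" by (simp add: field_simps)
  have \<delta>\<epsilon>: "3 * \<delta> \<le> \<epsilon> / 2" by (simp add: \<delta>_def)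
  define K where "K = real (CARD('n) * CARD('n))"
  have K: "K > 0" by (simp add: K_def)
  define B1 where "B1 n = {x \<in> space \<Omega>. \<not> (exp (real n * (growth p - \<delta>)) \<le> minor_norm p (seq_prod x n)
    \<and> minor_norm p (seq_prod x n) \<le> exp (real n * (growth p + \<delta>)))}" for n
  define B2 where "B2 n = {x \<in> space \<Omega>. \<not> (exp (real n * (growth 1 - \<delta>)) \<le> minor_norm 1 (seq_prod x n)
    \<and> minor_norm 1 (seq_prod x n) \<le> exp (real n * (growth 1 + \<delta>)))}" for n
  define B3 where "B3 n = {x \<in> space \<Omega>. \<not> minor_norm (Suc p) (seq_prod x n) \<le> exp (real n * ((real p + 1) * growth 1 - \<gamma>))}" for n
  define B where "B n = B1 n \<union> B2 n \<union> B3 n" for n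
  have B_events: "B1 n \<in> events" "B2 n \<in> events" "B3 n \<in> events" "B n \<in> events" for n
    unfolding B_def B1_def B2_def B3_def
    by (intro sets.Un minor_norm_window_measurable minor_norm_le_measurable)+
  have "(\<lambda>n. prob (B1 n) + prob (B2 n) + prob (B3 n)) \<longlonglongrightarrow> 0 + 0 + 0"
    unfolding B1_def B2_def B3_def
    by (intro tendsto_add gap minor_norm_window[OF p(2) \<delta>] minor_norm_window[OF _ \<delta>]) (simp add: Suc_le_eq)
  then have sum0: "(\<lambda>n. prob (B1 n) + prob (B2 n) + prob (B3 n)) \<longlonglongrightarrow> 0" by simp
  have prob_le: "prob (B n) \<le> prob (B1 n) + prob (B2 n) + prob (B3 n)" for n
    unfolding B_def
    using measure_Un_le[OF sets.Un[OF B_events(1,2)] B_events(3), of n n n] measure_Un_le[OF B_events(1,2), of n n]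
    by linarith
  have probB: "(\<lambda>n. prob (B n)) \<longlonglongrightarrow> 0"
    by (rule tendsto_sandwich[OF _ _ tendsto_const sum0]) (simp_all add: prob_le)
  define v where "v n = n div 2" for n :: nat
  define u where "u n = n - n div 2" for n :: nat
  have uv: "u n + v n = n" for n by (simp add: u_def v_def)
  have v_lim: "filterlim v at_top sequentially"
    unfolding v_def filterlim_at_top
  proof
    fix Z :: nat
    show "eventually (\<lambda>n. Z \<le> n div 2) sequentially"
      using eventually_ge_at_top[of "2 * Z"] by eventually_elim simp
  qed
  have u_lim: "filterlim u at_top sequentially"
    by (rule filterlim_at_top_mono[OF v_lim]) (auto simp: u_def v_def intro!: always_eventually)
  have bound: "(\<lambda>n. prob (B n) + prob (B n) + prob (B (u n)) + prob (B (v n))) \<longlonglongrightarrow> 0 + 0 + 0 + 0"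
    by (intro tendsto_add probB filterlim_compose[OF probB u_lim] filterlim_compose[OF probB v_lim])
  show ?thesis
  proof (rule tendsto_sandwich[OF _ _ tendsto_const])
    show "(\<lambda>n. prob (B n) + prob (B n) + prob (B (u n)) + prob (B (v n))) \<longlonglongrightarrow> 0" using bound by simp
    show "eventually (\<lambda>n. prob {x \<in> space \<Omega>. spectral_radius (seq_prod x n) < exp (real n * (growth 1 - \<epsilon>))}
      \<le> prob (B n) + prob (B n) + prob (B (u n)) + prob (B (v n))) sequentially"
      using spectral_radius_lower_bound[OF p(1) K \<gamma> \<epsilon> \<delta> \<delta>\<gamma> \<delta>\<epsilon>, where l=l and 'n='n] eventually_ge_at_top[of 2]
    proof eventually_elim
      case (elim n)
      let ?S = "{x \<in> space \<Omega>. (\<lambda>i. x (swap_halves (u n) (v n) i)) \<in> B n}"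
      let ?A = "{x \<in> space \<Omega>. (\<lambda>i. x (i + v n)) \<in> B (u n)}"
      have S: "prob ?S = prob (B n)" "?S \<in> events"
        by (rule prob_reindex[OF inj_swap_halves B_events(4)])+
      have A: "prob ?A = prob (B (u n))" "?A \<in> events"
        using prob_reindex[of "\<lambda>i. i + v n", OF _ B_events(4)] by (auto intro: injI)
      have "{x \<in> space \<Omega>. spectral_radius (seq_prod x n) < exp (real n * (growth 1 - \<epsilon>))}
        \<subseteq> B n \<union> ?S \<union> ?A \<union> B (v n)"
      proof (rule subsetI, rule ccontr)
        fix x assume x: "x \<in> {x \<in> space \<Omega>. spectral_radius (seq_prod x n) < exp (real n * (growth 1 - \<epsilon>))}"
          and notin: "x \<notin> B n \<union> ?S \<union> ?A \<union> B (v n)"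
        have xs: "x \<in> space \<Omega>" using x by simp
        have re: "(\<lambda>i. x (f i)) \<in> space \<Omega>" for f :: "nat \<Rightarrow> nat" using xs by (auto simp: space_PiM PiE_iff)
        let ?P = "seq_prod (\<lambda>i. x (i + v n)) (u n)" and ?Q = "seq_prod x (v n)"
        have AB: "seq_prod x n = ?P ** ?Q" and BA: "seq_prod (\<lambda>i. x (swap_halves (u n) (v n) i)) n = ?Q ** ?P"
          using seq_prod_halves[of x "u n" "v n"] uv[of n] by simp_all
        have good: "exp (real k * (real p * l - \<delta>)) \<le> minor_norm p (seq_prod y k)"
            "minor_norm p (seq_prod y k) \<le> exp (real k * (real p * l + \<delta>))"
            "op_norm (seq_prod y k) \<le> K * exp (real k * (l + \<delta>))"
            "minor_norm (Suc p) (seq_prod y k) \<le> exp (real k * ((real p + 1) * l - \<gamma>))"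
          if y: "y \<in> space \<Omega>" "y \<notin> B k" for y k
        proof -
          show "exp (real k * (real p * l - \<delta>)) \<le> minor_norm p (seq_prod y k)"
            "minor_norm p (seq_prod y k) \<le> exp (real k * (real p * l + \<delta>))"
            "minor_norm (Suc p) (seq_prod y k) \<le> exp (real k * ((real p + 1) * l - \<gamma>))"
            using y by (auto simp: B_def B1_def B3_def l_def p(3))
          have "minor_norm 1 (seq_prod y k) \<le> exp (real k * (l + \<delta>))"
            using y by (auto simp: B_def B2_def l_def)
          then have "K * minor_norm 1 (seq_prod y k) \<le> K * exp (real k * (l + \<delta>))"
            using K by (intro mult_left_mono) auto
          then show "op_norm (seq_prod y k) \<le> K * exp (real k * (l + \<delta>))"
            using op_norm_le_minor_norm_1[of "seq_prod y k"] unfolding K_def by linarith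
        qed
        \<comment> \<open>The shorter half \<open>n div 2\<close> is at least a third of
          \<open>n\<close> as soon as \<open>n \<ge> 2\<close>, with equality at
          \<open>n = 3\<close>.\<close>
        have nn: "n \<le> 3 * u n" "n \<le> 3 * v n" using elim(2) by (auto simp: u_def v_def)
        have yA: "(\<lambda>i. x (i + v n)) \<notin> B (u n)" and yS: "(\<lambda>i. x (swap_halves (u n) (v n) i)) \<notin> B n"
          and xB: "x \<notin> B n" "x \<notin> B (v n)" using notin xs by auto
        note gA = good[OF re yA] and gB = good[OF xs xB(2)] and gn = good[OF xs xB(1)] and gS = good[OF re yS]
        have "exp (real n * (l - \<epsilon>)) \<le> spectral_radius (?P ** ?Q)"
          using elim(1)[rule_format, OF uv nn gA(2) gB(2) gn(1)[unfolded AB] gS(1)[unfolded BA] gA(3) gB(3) gA(4) gB(4)] .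
        then show False using x by (simp add: l_def AB[symmetric])
      qed
      then have "prob {x \<in> space \<Omega>. spectral_radius (seq_prod x n) < exp (real n * (growth 1 - \<epsilon>))}
          \<le> prob (B n \<union> ?S \<union> ?A \<union> B (v n))"
        by (intro finite_measure_mono sets.Un B_events S A)
      also have "\<dots> \<le> prob (B n \<union> ?S \<union> ?A) + prob (B (v n))"
        by (intro measure_Un_le sets.Un B_events S A)
      also have "prob (B n \<union> ?S \<union> ?A) \<le> prob (B n \<union> ?S) + prob ?A"
        by (intro measure_Un_le sets.Un B_events S A)
      also have "prob (B n \<union> ?S) \<le> prob (B n) + prob ?S"
        by (intro measure_Un_le sets.Un B_events S A)
      finally show ?case unfolding S(1) A(1) by simp
    qed
  qed auto
qed

section \<open>Convergence in mean\<close>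

lemma ln_spectral_radius_measurable:
  "(\<lambda>x. 1 / real n * ln (spectral_radius (seq_prod x n))) \<in> borel_measurable \<Omega>"
  using borel_measurable_ln[OF spectral_radius_seq_prod_measurable[of n]]
  by (rule borel_measurable_times[OF borel_measurable_const])

lemma integrable_average_ln_N: "integrable \<Omega> (\<lambda>x. (\<Sum>i<n. ln (N (x i))) / real n)"
  by (intro integrable_divide Bochner_Integration.integrable_sum integrable_component integrable_ln_N)

lemma abs_ln_spectral_radius_le_average:
  assumes x: "x \<in> space \<Omega>"
  shows "\<bar>1 / real n * ln (spectral_radius (seq_prod x n))\<bar> \<le> (\<Sum>i<n. ln (N (x i))) / real n"
proof -
  have "\<bar>ln (spectral_radius (seq_prod x n))\<bar> / real n \<le> (\<Sum>i<n. ln (N (x i))) / real n"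
    by (intro divide_right_mono abs_ln_spectral_radius_seq_prod_le(2) invertible_component[OF x]) simp
  then show ?thesis by (simp add: abs_mult)
qed

lemma integrable_ln_spectral_radius:
  "integrable \<Omega> (\<lambda>x. 1 / real n * ln (spectral_radius (seq_prod x n)))"
proof (rule Bochner_Integration.integrable_bound[OF integrable_average_ln_N[of n] ln_spectral_radius_measurable])
  show "AE x in \<Omega>. norm (1 / real n * ln (spectral_radius (seq_prod x n))) \<le> norm ((\<Sum>i<n. ln (N (x i))) / real n)"
    unfolding real_norm_def by (intro AE_I2 order_trans[OF abs_ln_spectral_radius_le_average abs_ge_self])
qed

lemma average_ln_N_mean:
  "(\<lambda>n. \<integral>x. \<bar>(\<Sum>i<n. ln (N (x i))) / real n - (\<integral>g. ln (N g) \<partial>\<mu>)\<bar> \<partial>\<Omega>) \<longlonglongrightarrow> 0"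
proof -
  have m: "(\<lambda>g. ln (N g)) \<in> borel_measurable \<mu>" using integrable_ln_N by auto
  have "(\<lambda>n. \<integral>x. \<bar>(\<Sum>i<n. (\<lambda>x. ln (N (x 0))) (((\<lambda>x i. x (Suc i)) ^^ i) x)) / real n
      - (\<integral>x. ln (N (x 0)) \<partial>\<Omega>)\<bar> \<partial>\<Omega>) \<longlonglongrightarrow> 0"
    by (rule birkhoff_mean[OF integrable_component[OF integrable_ln_N]])
       (intro ln_ge_zero N_ge_1 invertible_component)
  then show ?thesis by (simp add: funpow_shift integral_component[OF m])
qed

text \<open>The upper deviations are controlled by those of the norm; the lower ones have small
  probability, and there the averages of \<open>ln N\<close> provide uniform integrability.\<close>

theorem spectral_radius_mean:
  "(\<lambda>n. \<integral>x. \<bar>1 / real n * ln (spectral_radius (seq_prod x n)) - growth 1\<bar> \<partial>\<Omega>) \<longlonglongrightarrow> 0"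
proof (rule order_tendstoI)
  let ?R = "\<lambda>n x. 1 / real n * ln (spectral_radius (seq_prod x n))"
  let ?U = "\<lambda>n x. ln (minor_norm 1 (seq_prod x n)) / real n"
  let ?A = "\<lambda>n x. (\<Sum>i<n. ln (N (x i))) / real n"
  define l where "l = growth 1"
  define \<nu> where "\<nu> = (\<integral>g. ln (N g) \<partial>\<mu>)"
  define K where "K = ln (real (CARD('n) * CARD('n)))"
  have one: "1 \<le> CARD('n)" by (simp add: Suc_le_eq)
  have K0: "K \<ge> 0" unfolding K_def by (rule ln_ge_zero) (metis one mult_le_mono nat_mult_1 of_nat_1 of_nat_le_iff)
  show "eventually (\<lambda>n. a < (\<integral>x. \<bar>?R n x - growth 1\<bar> \<partial>\<Omega>)) sequentially" if "a < 0" for a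
    using that by (intro always_eventually allI) (auto intro: order_less_le_trans integral_nonneg_AE)
  fix a :: real assume a: "0 < a"
  define \<epsilon> where "\<epsilon> = a / 2"
  have \<epsilon>: "\<epsilon> > 0" using a by (simp add: \<epsilon>_def)
  define E where "E n = {x \<in> space \<Omega>. spectral_radius (seq_prod x n) < exp (real n * (l - \<epsilon>))}" for n
  have E: "E n \<in> events" for n
    unfolding E_def using spectral_radius_seq_prod_measurable[of n] by measurable
  have lim: "(\<lambda>n. K / real n + (\<integral>x. \<bar>?U n x - l\<bar> \<partial>\<Omega>) + (\<integral>x. \<bar>?A n x - \<nu>\<bar> \<partial>\<Omega>) + (\<bar>\<nu>\<bar> + \<bar>l\<bar>) * prob (E n) + \<epsilon>)
      \<longlonglongrightarrow> 0 + 0 + 0 + (\<bar>\<nu>\<bar> + \<bar>l\<bar>) * 0 + \<epsilon>"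
    unfolding l_def \<nu>_def E_def
    by (intro tendsto_add tendsto_mult tendsto_const lim_const_over_n growth_mean[OF one] average_ln_N_mean
        spectral_radius_lower_tail \<epsilon>)
  have "0 + 0 + 0 + (\<bar>\<nu>\<bar> + \<bar>l\<bar>) * 0 + \<epsilon> < a" using a by (simp add: \<epsilon>_def)
  from order_tendstoD(2)[OF lim this]
  have "eventually (\<lambda>n. K / real n + (\<integral>x. \<bar>?U n x - l\<bar> \<partial>\<Omega>) + (\<integral>x. \<bar>?A n x - \<nu>\<bar> \<partial>\<Omega>)
      + (\<bar>\<nu>\<bar> + \<bar>l\<bar>) * prob (E n) + \<epsilon> < a) sequentially" .
  then show "eventually (\<lambda>n. (\<integral>x. \<bar>?R n x - growth 1\<bar> \<partial>\<Omega>) < a) sequentially"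
    using eventually_ge_at_top[of 1]
  proof eventually_elim
    case (elim n)
    have n: "real n > 0" using elim(2) by simp
    have iU: "integrable \<Omega> (\<lambda>x. \<bar>?U n x - l\<bar>)"
      using integrable_ln_minor_norm[OF one, of n] by (intro integrable_abs Bochner_Integration.integrable_diff) auto
    have iA: "integrable \<Omega> (\<lambda>x. \<bar>?A n x - \<nu>\<bar>)"
      using integrable_average_ln_N[of n] by (intro integrable_abs Bochner_Integration.integrable_diff) auto
    have iE: "integrable \<Omega> (\<lambda>x. (\<bar>\<nu>\<bar> + \<bar>l\<bar>) * indicator (E n) x)"
      using E by (intro integrable_mult_right integrable_real_indicator) (auto simp: emeasure_eq_measure)
    have "(\<integral>x. \<bar>?R n x - l\<bar> \<partial>\<Omega>)
        \<le> (\<integral>x. (K / real n + \<epsilon>) + \<bar>?U n x - l\<bar> + \<bar>?A n x - \<nu>\<bar> + (\<bar>\<nu>\<bar> + \<bar>l\<bar>) * indicator (E n) x \<partial>\<Omega>)"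
    proof (rule integral_mono)
      show "integrable \<Omega> (\<lambda>x. \<bar>?R n x - l\<bar>)"
        using integrable_ln_spectral_radius[of n] by (intro integrable_abs Bochner_Integration.integrable_diff) auto
      show "integrable \<Omega> (\<lambda>x. (K / real n + \<epsilon>) + \<bar>?U n x - l\<bar> + \<bar>?A n x - \<nu>\<bar> + (\<bar>\<nu>\<bar> + \<bar>l\<bar>) * indicator (E n) x)"
        by (intro Bochner_Integration.integrable_add iU iA iE) auto
      fix x assume x: "x \<in> space \<Omega>"
      have \<rho>: "spectral_radius (seq_prod x n) > 0"
        by (rule abs_ln_spectral_radius_seq_prod_le(1)[OF invertible_component[OF x]])
      have upper: "?R n x \<le> K / real n + ?U n x"
      proof -
        have "ln (spectral_radius (seq_prod x n)) \<le> ln (op_norm (seq_prod x n))"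
          using \<rho> ln_op_norm_minus_ln_minor_norm_1(1)[OF x, of n] spectral_radius_le_op_norm
          by (subst ln_le_cancel_iff) auto
        also have "\<dots> \<le> K + ln (minor_norm 1 (seq_prod x n))"
          using ln_op_norm_minus_ln_minor_norm_1(2)[OF x, of n] unfolding K_def by linarith
        finally have "ln (spectral_radius (seq_prod x n)) / real n \<le> (K + ln (minor_norm 1 (seq_prod x n))) / real n"
          by (rule divide_right_mono) simp
        then show ?thesis by (simp add: add_divide_distrib)
      qed
      have Kn: "K / real n \<ge> 0" using K0 by simp
      show "\<bar>?R n x - l\<bar> \<le> (K / real n + \<epsilon>) + \<bar>?U n x - l\<bar> + \<bar>?A n x - \<nu>\<bar> + (\<bar>\<nu>\<bar> + \<bar>l\<bar>) * indicator (E n) x"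
      proof (cases "x \<in> E n")
        case True
        \<comment> \<open>On the bad set the excess of the average over \<open>\<nu>\<close> is paid
          by its convergence in mean, the constants by the small probability of
          \<open>E n\<close>.\<close>
        have "\<bar>?R n x\<bar> \<le> ?A n x" by (rule abs_ln_spectral_radius_le_average[OF x])
        then have "\<bar>?R n x - l\<bar> \<le> \<bar>?A n x - \<nu>\<bar> + \<bar>\<nu>\<bar> + \<bar>l\<bar>" by linarith
        then show ?thesis using True Kn \<epsilon> by simp
      next
        case False
        then have "exp (real n * (l - \<epsilon>)) \<le> spectral_radius (seq_prod x n)" using x by (simp add: E_def)
        then have "real n * (l - \<epsilon>) \<le> ln (spectral_radius (seq_prod x n))" using \<rho> by (simp add: ln_ge_iff)
        then have "l - \<epsilon> \<le> ?R n x" using n by (simp add: field_simps)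
        then have "\<bar>?R n x - l\<bar> \<le> (K / real n + \<epsilon>) + \<bar>?U n x - l\<bar>" using upper Kn \<epsilon> by linarith
        then show ?thesis using False by simp
      qed
    qed
    also have "\<dots> = (K / real n + \<epsilon>) + (\<integral>x. \<bar>?U n x - l\<bar> \<partial>\<Omega>) + (\<integral>x. \<bar>?A n x - \<nu>\<bar> \<partial>\<Omega>) + (\<bar>\<nu>\<bar> + \<bar>l\<bar>) * prob (E n)"
    proof -
      have ic: "integrable \<Omega> (\<lambda>x. K / real n + \<epsilon>)" by (rule integrable_const)
      have c: "(\<integral>x. K / real n + \<epsilon> \<partial>\<Omega>) = K / real n + \<epsilon>" by (simp add: prob_space)
      have e: "(\<integral>x. (\<bar>\<nu>\<bar> + \<bar>l\<bar>) * indicator (E n) x \<partial>\<Omega>) = (\<bar>\<nu>\<bar> + \<bar>l\<bar>) * prob (E n)"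
        using E[of n] sets.sets_into_space[OF E[of n]] by (simp add: Int_absorb2)
      show ?thesis
        unfolding Bochner_Integration.integral_add[OF Bochner_Integration.integrable_add[OF Bochner_Integration.integrable_add[OF ic iU] iA] iE]
          Bochner_Integration.integral_add[OF Bochner_Integration.integrable_add[OF ic iU] iA]
          Bochner_Integration.integral_add[OF ic iU] c e ..
    qed
    finally show ?case using elim(1) by (simp add: l_def)
  qed
qed

section \<open>Renumbering the sequence, and the Lyapunov exponent\<close>

lemma distr_shift_index:
  "(\<lambda>x i. x (Suc i)) \<in> measurable (\<Pi>\<^sub>M i\<in>{1..}. \<mu>) \<Omega>"
  "distr (\<Pi>\<^sub>M i\<in>{1..}. \<mu>) \<Omega> (\<lambda>x i. x (Suc i)) = \<Omega>"
proof -
  show "(\<lambda>x i. x (Suc i)) \<in> measurable (\<Pi>\<^sub>M i\<in>{1..}. \<mu>) \<Omega>"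
    by (intro measurable_PiM_single' measurable_component_singleton) (auto simp: space_PiM PiE_iff)
  have "distr (\<Pi>\<^sub>M i\<in>{1..}. \<mu>) \<Omega> (\<lambda>x. \<lambda>n\<in>UNIV. x (Suc n)) = \<Omega>"
    using distr_PiM_reindex[of "{1..}" "\<lambda>_. \<mu>" Suc UNIV] prob_mu by auto
  then show "distr (\<Pi>\<^sub>M i\<in>{1..}. \<mu>) \<Omega> (\<lambda>x i. x (Suc i)) = \<Omega>"
    by (simp add: restrict_def)
qed

text \<open>Two almost sure limits agree at some point because the measure has mass one, so the
  definite description in \<open>lyapunov1\<close> denotes this limit.\<close>

lemma lyapunov1_eq_growth: "lyapunov1 \<mu> = growth 1"
proof -
  let ?P = "\<Pi>\<^sub>M i\<in>{1::nat..}. \<mu>"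
  let ?lim = "\<lambda>l x. (\<lambda>n. 1 / real n * ln (op_norm (left_prod x n))) \<longlonglongrightarrow> l"
  have prob: "prob_space ?P" by (rule prob_space_PiM) (rule prob_mu)
  have "AE x in distr ?P \<Omega> (\<lambda>x i. x (Suc i)). (\<lambda>n. 1 / real n * ln (op_norm (seq_prod x n))) \<longlonglongrightarrow> growth 1"
    unfolding distr_shift_index(2) by (rule growth_op_norm_AE)
  from AE_distrD[OF distr_shift_index(1) this]
  have ae: "AE x in ?P. ?lim (growth 1) x" by (simp add: left_prod_eq_seq_prod)
  show ?thesis
    unfolding lyapunov1_def
  proof (rule the_equality[where P="\<lambda>l. AE x in ?P. ?lim l x", OF ae])
    fix l assume "AE x in ?P. ?lim l x"
    with ae have "AE x in ?P. l = growth 1"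
    proof eventually_elim
      case (elim x)
      show ?case by (rule LIMSEQ_unique[OF elim(2,1)])
    qed
    then show "l = growth 1" using prob_space.AE_const[OF prob] by simp
  qed
qed

end

theorem theorem1p2:
  fixes \<mu> :: "(complex^'n^'n) measure"
    and M :: "'w measure"
    and X :: "nat \<Rightarrow> 'w \<Rightarrow> complex^'n^'n"
    and L :: "nat \<Rightarrow> 'w \<Rightarrow> complex^'n^'n"
  assumes mu_prob: "prob_space \<mu>"
    and mu_sets: "sets \<mu> = sets GL_borel"
    and mu_moment: "finite_first_moment \<mu>"
    and M_prob: "prob_space M"
    and X_indep: "prob_space.indep_vars M (\<lambda>_. GL_borel) X {1..}"
    and X_distr: "\<And>n. n \<ge> 1 \<Longrightarrow> distr M GL_borel (X n) = \<mu>"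
    and L_def: "\<And>n \<omega>. L n \<omega> = left_prod (\<lambda>i. X i \<omega>) n"
  shows "(\<forall>n\<ge>1. integrable M (\<lambda>\<omega>. 1 / real n * ln (spectral_radius (L n \<omega>)))) \<and>
         (\<lambda>n. \<integral>\<omega>. \<bar>1 / real n * ln (spectral_radius (L n \<omega>)) - lyapunov1 \<mu>\<bar> \<partial>M)
           \<longlonglongrightarrow> 0 \<and>
         (\<forall>\<epsilon>>0. (\<lambda>n. measure M {\<omega> \<in> space M.
            \<bar>1 / real n * ln (spectral_radius (L n \<omega>)) - lyapunov1 \<mu>\<bar> > \<epsilon>})
           \<longlonglongrightarrow> 0)"
proof -
  interpret random_product \<mu> by (rule random_product.intro[OF mu_prob mu_sets mu_moment])
  interpret M: prob_space M by (rule M_prob)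
  let ?P = "\<Pi>\<^sub>M i\<in>{1::nat..}. \<mu>"
  let ?Q = "\<Pi>\<^sub>M i\<in>{1::nat..}. (GL_borel :: (complex^'n^'n) measure)"
  let ?R = "\<lambda>n x. 1 / real n * ln (spectral_radius (seq_prod x n))"
  have X_meas: "X i \<in> measurable M GL_borel" if "i \<in> {1..}" for i
    using X_indep that unfolding M.indep_vars_def by blast
  \<comment> \<open>Restriction to \<open>{1..}\<close> discards \<open>X 0\<close>, of which
    nothing is assumed, and makes the sequence a point of the product space; independence and equal
    laws give it the product law.\<close>
  define Z where "Z = (\<lambda>\<omega>. \<lambda>i\<in>{1..}. X i \<omega>)"
  have sets_PQ: "sets ?Q = sets ?P" by (intro sets_PiM_cong) (simp_all add: mu_sets)
  have Z_meas: "Z \<in> measurable M ?P"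
  proof -
    have "Z \<in> measurable M ?Q" unfolding Z_def by (intro measurable_restrict X_meas)
    then show ?thesis using measurable_cong_sets[OF refl[of "sets M"] sets_PQ] by blast
  qed
  have "distr M ?Q Z = (\<Pi>\<^sub>M i\<in>{1..}. distr M GL_borel (X i))"
    unfolding Z_def
    by (rule M.indep_vars_iff_distr_eq_PiM'[THEN iffD1, OF _ X_meas X_indep]) auto
  also have "\<dots> = ?P" by (intro PiM_cong refl X_distr) simp
  finally have "distr M ?Q Z = ?P" .
  moreover have "distr M ?Q Z = distr M ?P Z" by (rule distr_cong[OF refl sets_PQ refl])
  ultimately have distr_Z: "distr M ?P Z = ?P" by simp
  \<comment> \<open>Renumbering from \<open>0\<close> moves the sequence to the shift space, where
    it has the law \<open>\<Omega>\<close>.\<close>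
  define Y where "Y = (\<lambda>x i. x (Suc i)) \<circ> Z"
  have Y_meas: "Y \<in> measurable M \<Omega>"
    unfolding Y_def by (rule measurable_comp[OF Z_meas distr_shift_index(1)])
  have distr_Y: "distr M \<Omega> Y = \<Omega>"
    unfolding Y_def distr_distr[OF distr_shift_index(1) Z_meas, symmetric] distr_Z by (rule distr_shift_index(2))
  have L_eq: "L n \<omega> = seq_prod (Y \<omega>) n" for n \<omega>
    unfolding L_def left_prod_eq_seq_prod by (rule seq_prod_cong) (simp add: Y_def Z_def)
  have int: "integrable M (\<lambda>\<omega>. ?R n (Y \<omega>))" for n
  proof -
    have "integrable (distr M \<Omega> Y) (?R n)"
      unfolding distr_Y by (rule integrable_ln_spectral_radius)
    then show ?thesis by (rule integrable_distr[OF Y_meas])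
  qed
  have mean_eq: "(\<integral>\<omega>. \<bar>?R n (Y \<omega>) - growth 1\<bar> \<partial>M) = (\<integral>x. \<bar>?R n x - growth 1\<bar> \<partial>\<Omega>)" for n
  proof -
    have "(\<lambda>x. \<bar>?R n x - growth 1\<bar>) \<in> borel_measurable \<Omega>"
      by (intro borel_measurable_abs borel_measurable_diff ln_spectral_radius_measurable borel_measurable_const)
    from integral_distr[OF Y_meas this] show ?thesis unfolding distr_Y by simp
  qed
  have mean: "(\<lambda>n. \<integral>\<omega>. \<bar>?R n (Y \<omega>) - growth 1\<bar> \<partial>M) \<longlonglongrightarrow> 0"
    unfolding mean_eq by (rule spectral_radius_mean)
  \<comment> \<open>Convergence in probability follows from convergence in mean by Markov's
    inequality.\<close>
  have "(\<lambda>n. measure M {\<omega> \<in> space M. \<bar>?R n (Y \<omega>) - growth 1\<bar> > \<epsilon>}) \<longlonglongrightarrow> 0" if \<epsilon>: "\<epsilon> > 0" for \<epsilon>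
  proof (rule tendsto_sandwich[OF _ _ tendsto_const])
    show "(\<lambda>n. (\<integral>\<omega>. \<bar>?R n (Y \<omega>) - growth 1\<bar> \<partial>M) / \<epsilon>) \<longlonglongrightarrow> 0"
      using tendsto_divide[OF mean tendsto_const[of \<epsilon>]] \<epsilon> by simp
    show "eventually (\<lambda>n. measure M {\<omega> \<in> space M. \<bar>?R n (Y \<omega>) - growth 1\<bar> > \<epsilon>}
        \<le> (\<integral>\<omega>. \<bar>?R n (Y \<omega>) - growth 1\<bar> \<partial>M) / \<epsilon>) sequentially"
    proof (intro always_eventually allI)
      fix n
      have i: "integrable M (\<lambda>\<omega>. \<bar>?R n (Y \<omega>) - growth 1\<bar>)"
        by (intro integrable_abs Bochner_Integration.integrable_diff int M.integrable_const)
      then have m: "(\<lambda>\<omega>. \<bar>?R n (Y \<omega>) - growth 1\<bar>) \<in> borel_measurable M" by auto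
      have "measure M {\<omega> \<in> space M. \<bar>?R n (Y \<omega>) - growth 1\<bar> > \<epsilon>}
          \<le> measure M {\<omega> \<in> space M. \<bar>?R n (Y \<omega>) - growth 1\<bar> \<ge> \<epsilon>}"
        using m by (intro M.finite_measure_mono) auto
      also have "\<dots> \<le> (\<integral>\<omega>. \<bar>?R n (Y \<omega>) - growth 1\<bar> \<partial>M) / \<epsilon>"
        using \<epsilon> by (intro integral_Markov_inequality_measure[where A="{}"] i) auto
      finally show "measure M {\<omega> \<in> space M. \<bar>?R n (Y \<omega>) - growth 1\<bar> > \<epsilon>}
          \<le> (\<integral>\<omega>. \<bar>?R n (Y \<omega>) - growth 1\<bar> \<partial>M) / \<epsilon>" .
    qed
  qed auto
  with int mean show ?thesis unfolding L_eq lyapunov1_eq_growth by blast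
qed

end
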